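(* Let $K\subset\mathbb{R}^2$ be a convex body, let $r\ge 1$ be real, and let $N\ge 3$ be an integer. Let $T\subset\mathbb{R}^2$ be a triangle with centroid at the origin and $|T|=|K|$. Then $$\mathbb{E}\,\bigl|([K]_N)^{s\circ}\bigr|^{-r}\;\le\;\mathbb{E}\,\bigl|([T]_N)^{s\circ}\bigr|^{-r}.$$
   Context: A convex body in $\mathbb{R}^2$ is a compact convex set with non-empty interior (no symmetry is assumed). $|\cdot|$ denotes Lebesgue measure on $\mathbb{R}^2$. Here $[K]_N=\operatorname{conv}\{X_1,\dots,X_N\}$, where $X_1,\dots,X_N$ are independent random vectors uniformly distributed in $K$ (and similarly $[T]_N$ is built from independent random vectors uniformly distributed in $T$). For a set $L$, the polar is $L^{\circ}=\{\omega\in\mathbb{R}^2:\langle\omega,x\rangle\le 1\ \forall x\in L\}$. For a convex body $L$, $L^{s\circ}=(L-s)^{\circ}$, where $s$ is the Santaló point of $L$, i.e. the unique point in the interior of $L$ such that $|(L-s)^{\circ}|=\min_{x\in\operatorname{int}L}|(L-x)^{\circ}|$. With probability one $[K]_N$ and $[T]_N$ have non-empty interior, so these quantities are almost surely defined. *)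

theory Defs
  imports "HOL-Probability.Probability"
begin

definition convex_body :: "(real ^ 2) set \<Rightarrow> bool" where
  "convex_body K \<longleftrightarrow> compact K \<and> convex K \<and> interior K \<noteq> {}"

definition polar_set :: "(real ^ 2) set \<Rightarrow> (real ^ 2) set" where
  "polar_set L = {w. \<forall>x\<in>L. w \<bullet> x \<le> 1}"

(* All sets measured below are compact or closed, so lborel gives their Lebesgue measure. *)
abbreviation area :: "(real ^ 2) set \<Rightarrow> real" where
  "area A \<equiv> measure lborel A"

definition polar_at :: "(real ^ 2) set \<Rightarrow> real ^ 2 \<Rightarrow> (real ^ 2) set" where
  "polar_at L z = polar_set ((\<lambda>x. x - z) ` L)"

(* The minimum is over interior points only: there the polar of a body is bounded, so that
   area is its actual finite measure. For a point z of L outside the interior the polar has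
   infinite measure, which area would report as 0. *)
definition is_santalo_point :: "(real ^ 2) set \<Rightarrow> real ^ 2 \<Rightarrow> bool" where
  "is_santalo_point L s \<longleftrightarrow>
     s \<in> interior L \<and> (\<forall>z\<in>interior L. area (polar_at L s) \<le> area (polar_at L z))"

definition santalo_point :: "(real ^ 2) set \<Rightarrow> real ^ 2" where
  "santalo_point L = (THE s. is_santalo_point L s)"

definition santalo_polar :: "(real ^ 2) set \<Rightarrow> (real ^ 2) set" where
  "santalo_polar L = polar_at L (santalo_point L)"

definition is_triangle :: "(real ^ 2) set \<Rightarrow> bool" where
  "is_triangle T \<longleftrightarrow> (\<exists>a b c. \<not> collinear {a, b, c} \<and> T = convex hull {a, b, c})"

definition centroid :: "(real ^ 2) set \<Rightarrow> real ^ 2" where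
  "centroid S = (1 / area S) *\<^sub>R (LINT x:S|lborel. x)"

definition iid_uniform :: "'a measure \<Rightarrow> (nat \<Rightarrow> 'a \<Rightarrow> real ^ 2) \<Rightarrow> nat \<Rightarrow> (real ^ 2) set \<Rightarrow> bool" where
  "iid_uniform M X N K \<longleftrightarrow>
     prob_space M \<and>
     prob_space.indep_vars M (\<lambda>_. borel) X {1..N} \<and>
     (\<forall>i\<in>{1..N}. distr M lborel (X i) = uniform_measure lborel K)"

definition random_polytope :: "(nat \<Rightarrow> 'a \<Rightarrow> real ^ 2) \<Rightarrow> nat \<Rightarrow> 'a \<Rightarrow> (real ^ 2) set" where
  "random_polytope X N \<omega> = convex hull ((\<lambda>i. X i \<omega>) ` {1..N})"

end

theory Submission
  imports Defs
begin

text \<open>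
  The expectation is affinely covariant, so all triangles of the same area give the same value, and
  by exhausting \<open>K\<close> from inside it suffices to treat polygons. A polygon with at least four vertices can be
  deformed by sliding a vertex parallel to the line through its two neighbours: on the triangle cut
  off by that line this is a shear, elsewhere the identity, so area and uniform distribution are
  preserved, and at the two ends of the admissible range a vertex disappears. During the
  movement every random point moves along the same direction with constant speed, and for such a
  movement the reciprocal of the minimal polar area is convex in time (Campi--Gronchi,
  Meyer--Reisner). Hence the expectation is at most its value at one of the two ends, and
  induction on the number of vertices ends at triangles.

  For the convexity, the polar is cut along the axis orthogonal to the movement. In the
  coordinates \<open>u = b (s, \<plusminus>1)\<close> each half has area \<open>1/2 \<integral> h(s, \<plusminus>1)\<^sup>-\<^sup>2 ds\<close>, where
  the support function \<open>h\<close> is jointly convex in \<open>s\<close> and time, so a one-dimensional Borell inequality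
  makes the reciprocal of each half convex.
\<close>

section \<open>The plane and its affine maps\<close>

text \<open>Joint convexity comes from the choice of coordinates: in the direction (s, 1) a point
  that moves vertically has the inner product s times a constant abscissa plus a height that is
  affine in time. For a jointly convex positive function, the exponent -2 in dimension one becomes
  -1 after integration in Borell's inequality, which is why reciprocals of areas are the convex
  quantities. The obstacle is the sum of the two halves, since convexity of two reciprocals says
  nothing about the reciprocal of the sum. What helps is that the centres at the two ends of a
  movement are free: replacing them by the Santalo points afterwards only increases the right-hand
  side. They can therefore be chosen to make the two halves proportional. The assumption
  \<open>r \<ge> 1\<close> finally passes from reciprocals to their powers by convexity of
  \<open>powr\<close>. Integrals with values in \<open>ennreal\<close> spare all questions of
  integrability of the random quantity.\<close>

definition vec2 :: "real \<Rightarrow> real \<Rightarrow> real ^ 2" where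
  "vec2 a b = vector [a, b]"

lemma vec2_nth [simp]: "vec2 a b $ 1 = a" "vec2 a b $ 2 = b"
  by (simp_all add: vec2_def)

lemma vec2_eqI: "u $ 1 = v $ 1 \<Longrightarrow> u $ 2 = v $ 2 \<Longrightarrow> u = (v :: real ^ 2)"
  by (simp add: vec_eq_iff forall_2)

lemma inner_vec2: "u \<bullet> v = u $ 1 * v $ 1 + u $ 2 * v $ 2" for u v :: "real ^ 2"
  by (simp add: inner_vec_def sum_2)

lemma norm_vec2: "norm u = sqrt ((u $ 1)\<^sup>2 + (u $ 2)\<^sup>2)" for u :: "real ^ 2"
  by (simp add: norm_vec_def L2_set_def sum_2)

lemma Basis_vec2: "(Basis :: (real ^ 2) set) = {axis 1 1, axis 2 1}"
  by (auto simp: Basis_vec_def UNIV_2)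

lemma vec2_measurable [measurable]:
  assumes "f \<in> borel_measurable M" "g \<in> borel_measurable M"
  shows "(\<lambda>x. vec2 (f x) (g x)) \<in> borel_measurable M"
proof -
  have "vec2 a b = a *\<^sub>R axis 1 1 + b *\<^sub>R axis 2 1" for a b
    by (rule vec2_eqI) (simp_all add: axis_def)
  then have "continuous_on UNIV (\<lambda>p. vec2 (fst p) (snd p))"
    by (auto intro!: continuous_intros)
  then have *: "(\<lambda>p. vec2 (fst p) (snd p)) \<in> borel_measurable borel"
    by (rule borel_measurable_continuous_onI)
  have "(\<lambda>x. (f x, g x)) \<in> borel_measurable M" using assms by measurable
  from measurable_compose[OF this *] show ?thesis by simp
qed

lemma vec_nth_measurable [measurable]:
  "f \<in> borel_measurable M \<Longrightarrow> (\<lambda>x. f x $ i) \<in> borel_measurable M" for f :: "_ \<Rightarrow> real ^ 2"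
  by (rule measurable_compose[OF _ borel_measurable_continuous_onI])
    (auto intro!: continuous_intros)

text \<open>Gives Tonelli's theorem in both orders for the plane; it suffices to compare the two
  measures on boxes.\<close>

lemma lborel_vec2:
  "(lborel :: (real ^ 2) measure) = distr (lborel \<Otimes>\<^sub>M lborel) borel (\<lambda>p. vec2 (fst p) (snd p))"
proof (rule lborel_eqI)
  fix l u :: "real ^ 2"
  assume lu: "\<And>b. b \<in> Basis \<Longrightarrow> l \<bullet> b \<le> u \<bullet> b"
  have le: "l $ 1 \<le> u $ 1" "l $ 2 \<le> u $ 2"
    using lu[of "axis 1 1"] lu[of "axis 2 1"] by (auto simp: Basis_vec2 inner_axis)
  have "(\<lambda>p. vec2 (fst p) (snd p)) -` box l u \<inter> space (lborel \<Otimes>\<^sub>M lborel)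
      = {l $ 1<..<u $ 1} \<times> {l $ 2<..<u $ 2}"
    by (auto simp: mem_box_cart forall_2 space_pair_measure)
  then have "emeasure (distr (lborel \<Otimes>\<^sub>M lborel) borel (\<lambda>p. vec2 (fst p) (snd p))) (box l u)
      = emeasure (lborel \<Otimes>\<^sub>M lborel) ({l $ 1<..<u $ 1} \<times> {l $ 2<..<u $ 2})"
    by (subst emeasure_distr) auto
  also have "\<dots> = ennreal (u $ 1 - l $ 1) * ennreal (u $ 2 - l $ 2)"
    using le by (subst lborel.emeasure_pair_measure_Times) auto
  also have "\<dots> = ennreal (\<Prod>b\<in>Basis. (u - l) \<bullet> b)"
    using le by (simp add: Basis_vec2 axis_eq_axis inner_axis ennreal_mult)
  finally show "emeasure (distr (lborel \<Otimes>\<^sub>M lborel) borel (\<lambda>p. vec2 (fst p) (snd p))) (box l u)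
      = ennreal (\<Prod>b\<in>Basis. (u - l) \<bullet> b)" .
qed simp

lemma nn_integral_vec2:
  fixes f :: "real ^ 2 \<Rightarrow> ennreal"
  assumes [measurable]: "f \<in> borel_measurable borel"
  shows "(\<integral>\<^sup>+ u. f u \<partial>lborel) = (\<integral>\<^sup>+ a. \<integral>\<^sup>+ b. f (vec2 a b) \<partial>lborel \<partial>lborel)"
    and "(\<integral>\<^sup>+ u. f u \<partial>lborel) = (\<integral>\<^sup>+ b. \<integral>\<^sup>+ a. f (vec2 a b) \<partial>lborel \<partial>lborel)"
proof -
  have *: "(\<integral>\<^sup>+ u. f u \<partial>lborel)
      = (\<integral>\<^sup>+ p. f (vec2 (fst p) (snd p)) \<partial>(lborel \<Otimes>\<^sub>M lborel))"
    by (subst lborel_vec2, subst nn_integral_distr) simp_all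
  show "(\<integral>\<^sup>+ u. f u \<partial>lborel) = (\<integral>\<^sup>+ a. \<integral>\<^sup>+ b. f (vec2 a b) \<partial>lborel \<partial>lborel)"
    unfolding * by (subst lborel.nn_integral_fst[symmetric]) simp_all
  show "(\<integral>\<^sup>+ u. f u \<partial>lborel) = (\<integral>\<^sup>+ b. \<integral>\<^sup>+ a. f (vec2 a b) \<partial>lborel \<partial>lborel)"
    unfolding * by (subst lborel_pair.nn_integral_snd[symmetric]) simp_all
qed

definition cross2 :: "real ^ 2 \<Rightarrow> real ^ 2 \<Rightarrow> real" where
  "cross2 u v = u $ 1 * v $ 2 - u $ 2 * v $ 1"

text \<open>The affine map with image c of the origin whose linear part has the columns p and q,
  hence the determinant \<open>cross2 p q\<close>.\<close>

definition frame :: "real ^ 2 \<Rightarrow> real ^ 2 \<Rightarrow> real ^ 2 \<Rightarrow> real ^ 2 \<Rightarrow> real ^ 2" where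
  "frame c p q x = c + x $ 1 *\<^sub>R p + x $ 2 *\<^sub>R q"

lemma frame_measurable [measurable]: "frame c p q \<in> borel_measurable borel"
  unfolding frame_def by measurable

lemma nn_integral_vertical_shear:
  fixes f :: "real ^ 2 \<Rightarrow> ennreal" and g :: "real \<Rightarrow> real"
  assumes [measurable]: "f \<in> borel_measurable borel" "g \<in> borel_measurable borel"
  shows "(\<integral>\<^sup>+ u. f (vec2 ((u :: real ^ 2) $ 1) (u $ 2 + g (u $ 1))) \<partial>lborel) = (\<integral>\<^sup>+ u. f u \<partial>lborel)"
proof -
  have "(\<integral>\<^sup>+ u. f (vec2 ((u :: real ^ 2) $ 1) (u $ 2 + g (u $ 1))) \<partial>lborel)
      = (\<integral>\<^sup>+ a. \<integral>\<^sup>+ b. f (vec2 a (b + g a)) \<partial>lborel \<partial>lborel)"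
    by (subst nn_integral_vec2(1)) simp_all
  also have "\<dots> = (\<integral>\<^sup>+ a. \<integral>\<^sup>+ b. f (vec2 a b) \<partial>lborel \<partial>lborel)"
  proof (rule nn_integral_cong)
    fix a :: real
    show "(\<integral>\<^sup>+ b. f (vec2 a (b + g a)) \<partial>lborel) = (\<integral>\<^sup>+ b. f (vec2 a b) \<partial>lborel)"
      using nn_integral_real_affine[of "\<lambda>b. f (vec2 a b)" 1 "g a"] by (simp add: add.commute)
  qed
  finally show ?thesis by (simp add: nn_integral_vec2(1))
qed

text \<open>Gaussian elimination under the integral sign: if \<open>p $ 1\<close> is non-zero,
  substituting in the first coordinate gives the factor \<open>p $ 1\<close>, and after exchanging
  the integrals the other coordinate gives the second pivot k.\<close>

lemma nn_integral_frame:
  fixes f :: "real ^ 2 \<Rightarrow> ennreal"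
  assumes [measurable]: "f \<in> borel_measurable borel" and pq: "cross2 p q \<noteq> 0"
  shows "ennreal \<bar>cross2 p q\<bar> * (\<integral>\<^sup>+ x. f (frame c p q x) \<partial>lborel) = (\<integral>\<^sup>+ u. f u \<partial>lborel)"
proof -
  have *: "ennreal \<bar>cross2 p q\<bar> * (\<integral>\<^sup>+ b. \<integral>\<^sup>+ a. f (frame c p q (vec2 a b)) \<partial>lborel \<partial>lborel) = (\<integral>\<^sup>+ u. f u \<partial>lborel)"
    if pq: "cross2 p q \<noteq> 0" and p1: "p $ 1 \<noteq> 0" for p q
  proof -
    define k where "k = q $ 2 - p $ 2 * q $ 1 / p $ 1"
    have k: "cross2 p q = p $ 1 * k" using p1 by (simp add: k_def cross2_def field_simps)
    with pq have k0: "k \<noteq> 0" by auto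
    have inner: "ennreal \<bar>p $ 1\<bar> * (\<integral>\<^sup>+ a. f (frame c p q (vec2 a b)) \<partial>lborel)
        = (\<integral>\<^sup>+ a. f (vec2 a (c $ 2 + (a - c $ 1) * p $ 2 / p $ 1 + b * k)) \<partial>lborel)" for b
    proof -
      have "frame c p q (vec2 a b) = vec2 (c $ 1 + q $ 1 * b + p $ 1 * a)
         (c $ 2 + ((c $ 1 + q $ 1 * b + p $ 1 * a) - c $ 1) * p $ 2 / p $ 1 + b * k)" for a
        using p1 by (intro vec2_eqI) (simp_all add: frame_def k_def field_simps)
      then show ?thesis using p1
        by (subst nn_integral_real_affine[where c = "p $ 1" and t = "c $ 1 + q $ 1 * b"]) simp_all
    qed
    have inner2: "ennreal \<bar>k\<bar> * (\<integral>\<^sup>+ b. f (vec2 a (c $ 2 + (a - c $ 1) * p $ 2 / p $ 1 + b * k)) \<partial>lborel)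
        = (\<integral>\<^sup>+ b. f (vec2 a b) \<partial>lborel)" for a
      using k0 nn_integral_real_affine[of "\<lambda>b. f (vec2 a b)" k "c $ 2 + (a - c $ 1) * p $ 2 / p $ 1"]
      by (simp add: mult.commute)
    have "ennreal \<bar>cross2 p q\<bar> * (\<integral>\<^sup>+ b. \<integral>\<^sup>+ a. f (frame c p q (vec2 a b)) \<partial>lborel \<partial>lborel)
        = ennreal \<bar>k\<bar> * (\<integral>\<^sup>+ b. ennreal \<bar>p $ 1\<bar> * (\<integral>\<^sup>+ a. f (frame c p q (vec2 a b)) \<partial>lborel) \<partial>lborel)"
      by (simp add: k abs_mult ennreal_mult nn_integral_cmult mult_ac)
    also have "\<dots> = ennreal \<bar>k\<bar> * (\<integral>\<^sup>+ b. \<integral>\<^sup>+ a. f (vec2 a (c $ 2 + (a - c $ 1) * p $ 2 / p $ 1 + b * k)) \<partial>lborel \<partial>lborel)"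
      by (simp add: inner)
    also have "\<dots> = ennreal \<bar>k\<bar> * (\<integral>\<^sup>+ a. \<integral>\<^sup>+ b. f (vec2 a (c $ 2 + (a - c $ 1) * p $ 2 / p $ 1 + b * k)) \<partial>lborel \<partial>lborel)"
      by (subst lborel_pair.Fubini') simp_all
    also have "\<dots> = (\<integral>\<^sup>+ a. \<integral>\<^sup>+ b. f (vec2 a b) \<partial>lborel \<partial>lborel)"
      by (subst nn_integral_cmult[symmetric]) (simp_all add: inner2)
    finally show ?thesis by (simp add: nn_integral_vec2(1))
  qed
  show ?thesis
  proof (cases "p $ 1 = 0")
    case False
    then show ?thesis using *[OF pq] by (subst nn_integral_vec2(2)) simp_all
  next
    case True
    \<comment> \<open>The first pivot vanishes, so the columns are interchanged; this alters only
      the sign of the determinant.\<close>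
    have "cross2 q p = - cross2 p q" by (simp add: cross2_def)
    moreover have "q $ 1 \<noteq> 0" using pq True by (auto simp: cross2_def)
    moreover have "frame c q p (vec2 a b) = frame c p q (vec2 b a)" for a b
      by (simp add: frame_def add_ac)
    ultimately show ?thesis using *[of q p] pq by (subst nn_integral_vec2(1)) simp_all
  qed
qed

section \<open>An inequality for integrals of inverse squares\<close>

lemma DERIV_inverse_global:
  fixes f g :: "real \<Rightarrow> real"
  assumes "DERIV f x :> D" "D \<noteq> 0" "continuous_on UNIV f" "\<And>z. g (f z) = z"
  shows "DERIV g (f x) :> inverse D"
proof -
  have "(*) D \<circ> (*) (inverse D) = id" using assms(2) by (simp add: fun_eq_iff)
  moreover have "(f has_derivative (*) D) (at x)"
    using assms(1) by (simp add: has_field_derivative_def)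
  ultimately have "(g has_derivative (*) (inverse D)) (at (f x))"
    by (intro has_derivative_inverse_strong[where S = UNIV, OF open_UNIV UNIV_I assms(3,4)])
  then show ?thesis by (simp add: has_field_derivative_def)
qed

lemma antiderivative_on_line:
  fixes f :: "real \<Rightarrow> real"
  assumes f: "integrable lborel f" and cont: "continuous_on UNIV f"
    and pos: "\<And>s. f s > 0"
  defines "A \<equiv> (\<integral>s. f s \<partial>lborel)"
  obtains G where "\<And>s. DERIV G s :> f s" "(G \<longlongrightarrow> 0) at_bot" "(G \<longlongrightarrow> A) at_top"
    "\<And>s. 0 < G s" "\<And>s. G s < A"
proof -
  define G where "G s = (\<integral>u. indicator {..s} u * f u \<partial>lborel)" for s
  have int: "integrable lborel (\<lambda>u. indicator B u * f u)" if "B \<in> sets borel" for B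
    using integrable_mult_indicator[of B lborel f] f that by simp
  have D: "DERIV G x :> f x" for x
  proof -
    \<comment> \<open>Around x, G differs by the constant \<open>G a\<close> from an integral over a
      compact interval, to which the fundamental theorem applies.\<close>
    define a where "a = x - 1"
    have G: "G s = G a + integral {a..s} f" if "s \<ge> a" for s
    proof -
      have "G s = (\<integral>u. indicator {..a} u * f u + indicator {a<..s} u * f u \<partial>lborel)"
        unfolding G_def using that by (intro Bochner_Integration.integral_cong) (auto simp: indicator_def)
      also have "\<dots> = G a + (\<integral>u. indicator {a<..s} u * f u \<partial>lborel)"
        unfolding G_def by (intro Bochner_Integration.integral_add int) auto
      also have "(\<integral>u. indicator {a<..s} u * f u \<partial>lborel) = (\<integral>u. indicator {a..s} u * f u \<partial>lborel)"
        using AE_lborel_singleton[of a] f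
        by (intro integral_cong_AE) (auto simp: indicator_def)
      also have "\<dots> = (LINT u:{a..s}|lborel. f u)" by (simp add: set_lebesgue_integral_def)
      also have "\<dots> = integral {a..s} f"
        using int[of "{a..s}"] by (intro set_borel_integral_eq_integral) (simp add: set_integrable_def)
      finally show ?thesis .
    qed
    have "((\<lambda>s. integral {a..s} f) has_real_derivative f x) (at x within {a..x + 1})"
      by (rule integral_has_real_derivative) (auto simp: a_def intro: continuous_on_subset[OF cont])
    then have "((\<lambda>s. integral {a..s} f) has_real_derivative f x) (at x)"
      by (simp add: at_within_Icc_at a_def)
    then have "((\<lambda>s. G a + integral {a..s} f) has_real_derivative f x) (at x)"
      by (auto intro!: derivative_eq_intros)
    then show ?thesis
    proof (rule has_field_derivative_transform_within_open[where S = "{a<..}"])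
      show "x \<in> {a<..}" by (simp add: a_def)
      show "G a + integral {a..s} f = G s" if "s \<in> {a<..}" for s
        using G[of s] that by simp
    qed auto
  qed
  have top: "(G \<longlongrightarrow> A) at_top"
    unfolding G_def A_def
  proof (rule integral_dominated_convergence_at_top[where w = f])
    show "\<forall>\<^sub>F i in at_top. AE x in lborel. norm (indicator {..i} x * f x) \<le> f x"
      using pos by (auto simp: indicator_def less_imp_le)
    show "AE x in lborel. ((\<lambda>i. indicator {..i} x * f x) \<longlongrightarrow> f x) at_top"
    proof (rule AE_I2)
      fix x :: real
      have "\<forall>\<^sub>F i in at_top. indicator {..i} x * f x = f x"
        using eventually_ge_at_top[of x] by eventually_elim simp
      then show "((\<lambda>i. indicator {..i} x * f x) \<longlongrightarrow> f x) at_top"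
        by (rule tendsto_eventually)
    qed
  qed (use f in auto)
  have "((\<lambda>i. G (- i)) \<longlongrightarrow> (\<integral>x. 0 \<partial>(lborel :: real measure))) at_top"
    unfolding G_def
  proof (rule integral_dominated_convergence_at_top[where w = f])
    show "\<forall>\<^sub>F i in at_top. AE x in lborel. norm (indicator {..- i} x * f x) \<le> f x"
      using pos by (auto simp: indicator_def less_imp_le)
    show "AE x in lborel. ((\<lambda>i. indicator {..- i} x * f x) \<longlongrightarrow> 0) at_top"
    proof (rule AE_I2)
      fix x :: real
      have "\<forall>\<^sub>F i in at_top. indicator {..- i} x * f x = 0"
        using eventually_gt_at_top[of "- x"] by eventually_elim simp
      then show "((\<lambda>i. indicator {..- i} x * f x) \<longlongrightarrow> 0) at_top"
        by (rule tendsto_eventually)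
    qed
  qed (use f in auto)
  then have bot: "(G \<longlongrightarrow> 0) at_bot" by (simp add: filterlim_at_bot_mirror)
  have mono: "G s < G t" if "s < t" for s t
    by (rule DERIV_pos_imp_increasing[OF that]) (use D pos in blast)
  have "G s > 0" for s
  proof -
    have "\<forall>\<^sub>F i in at_bot. G i \<le> G (s - 1)"
      using eventually_le_at_bot[of "s - 1"] by eventually_elim (metis mono less_eq_real_def)
    then have "0 \<le> G (s - 1)" by (intro tendsto_upperbound[OF bot]) auto
    then show ?thesis using mono[of "s - 1" s] by simp
  qed
  moreover have "G s < A" for s
  proof -
    have "\<forall>\<^sub>F i in at_top. G i \<ge> G (s + 1)"
      using eventually_ge_at_top[of "s + 1"] by eventually_elim (metis mono less_eq_real_def)
    then have "A \<ge> G (s + 1)" by (intro tendsto_lowerbound[OF top]) auto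
    then show ?thesis using mono[of s "s + 1"] by simp
  qed
  ultimately show ?thesis using that D bot top by blast
qed

text \<open>Cauchy-Schwarz with the weights a and b and their reciprocals; the defect is an explicit
  multiple of a square.\<close>

lemma harmonic_cauchy_schwarz:
  fixes a b p q l :: real
  assumes "a > 0" "b > 0" "p > 0" "q > 0" "0 \<le> l" "l \<le> 1"
  shows "((1 - l) * p + l * q)\<^sup>2 \<le> ((1 - l) * a * p\<^sup>2 + l * b * q\<^sup>2) * ((1 - l) / a + l / b)"
proof -
  have "((1 - l) * a * p\<^sup>2 + l * b * q\<^sup>2) * ((1 - l) / a + l / b) - ((1 - l) * p + l * q)\<^sup>2
     = l * (1 - l) * (a * p - b * q)\<^sup>2 / (a * b)"
    using assms by (simp add: field_simps power2_eq_square)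
  also have "\<dots> \<ge> 0" using assms by simp
  finally show ?thesis by simp
qed

text \<open>Borell's inequality in dimension one. The monotone map transporting the normalised density
  \<open>1 / p\<^sub>0\<^sup>2\<close> to \<open>1 / p\<^sub>1\<^sup>2\<close> is interpolated with the identity.\<close>

lemma harmonic_integral_inverse_square:
  fixes p0 p1 p :: "real \<Rightarrow> real" and l :: real
  assumes pos: "\<And>s. p0 s > 0" "\<And>s. p1 s > 0" "\<And>s. p s > 0"
    and cont: "continuous_on UNIV p0" "continuous_on UNIV p1" "continuous_on UNIV p"
    and int: "integrable lborel (\<lambda>s. 1 / (p0 s)\<^sup>2)" "integrable lborel (\<lambda>s. 1 / (p1 s)\<^sup>2)"
      "integrable lborel (\<lambda>s. 1 / (p s)\<^sup>2)"
    and l: "0 < l" "l < 1"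
    and le: "\<And>s t. p ((1 - l) * s + l * t) \<le> (1 - l) * p0 s + l * p1 t"
  defines "A0 \<equiv> (\<integral>s. 1 / (p0 s)\<^sup>2 \<partial>lborel)" and "A1 \<equiv> (\<integral>s. 1 / (p1 s)\<^sup>2 \<partial>lborel)"
    and "A \<equiv> (\<integral>s. 1 / (p s)\<^sup>2 \<partial>lborel)"
  shows "1 / ((1 - l) / A0 + l / A1) \<le> A"
proof -
  have contf: "continuous_on UNIV (\<lambda>s. 1 / (f s)\<^sup>2)" if "continuous_on UNIV f" "\<And>s. f s > 0" for f :: "real \<Rightarrow> real"
    using that by (intro continuous_intros) (auto simp: less_imp_neq[symmetric])
  obtain G0 where G0: "\<And>s. DERIV G0 s :> 1 / (p0 s)\<^sup>2" "(G0 \<longlongrightarrow> 0) at_bot" "(G0 \<longlongrightarrow> A0) at_top"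
    "\<And>s. 0 < G0 s" "\<And>s. G0 s < A0"
    using antiderivative_on_line[OF int(1) contf[OF cont(1)]] pos unfolding A0_def by (metis zero_less_divide_1_iff zero_less_power)
  obtain G1 where G1: "\<And>s. DERIV G1 s :> 1 / (p1 s)\<^sup>2" "(G1 \<longlongrightarrow> 0) at_bot" "(G1 \<longlongrightarrow> A1) at_top"
    "\<And>s. 0 < G1 s" "\<And>s. G1 s < A1"
    using antiderivative_on_line[OF int(2) contf[OF cont(2)]] pos unfolding A1_def by (metis zero_less_divide_1_iff zero_less_power)
  obtain G where G: "\<And>s. DERIV G s :> 1 / (p s)\<^sup>2" "(G \<longlongrightarrow> 0) at_bot" "(G \<longlongrightarrow> A) at_top"
    "\<And>s. 0 < G s" "\<And>s. G s < A"
    using antiderivative_on_line[OF int(3) contf[OF cont(3)]] pos unfolding A_def by (metis zero_less_divide_1_iff zero_less_power)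
  have A: "A0 > 0" "A1 > 0" using G0(4,5)[of 0] G1(4,5)[of 0] by linarith+
  \<comment> \<open>The weighted harmonic mean of the two masses, which is the claimed lower bound
    for A.\<close>
  define H where "H = 1 / ((1 - l) / A0 + l / A1)"
  have den: "(1 - l) / A0 + l / A1 > 0" using A l by (simp add: add_pos_pos)
  have H: "H > 0" using den by (simp add: H_def)
  have mono1: "G1 s < G1 t" if "s < t" for s t
    by (rule DERIV_pos_imp_increasing[OF that]) (meson G1(1) pos(2) zero_less_divide_1_iff zero_less_power)
  then have inj1: "inj G1" by (metis injI linorder_neqE_linordered_idom less_irrefl)
  have contG1: "continuous_on UNIV G1" using G1(1) by (meson DERIV_isCont continuous_at_imp_continuous_on)
  have surj1: "\<exists>s. G1 s = y" if y: "0 < y" "y < A1" for y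
  proof -
    obtain a where a: "G1 a < y" using order_tendstoD(2)[OF G1(2), of y] y
      unfolding eventually_at_bot_linorder by (meson order_refl)
    obtain b where b: "G1 b > y" using order_tendstoD(1)[OF G1(3), of y] y
      unfolding eventually_at_top_linorder by (meson order_refl)
    have "a \<le> b" using mono1[of b a] a b by fastforce
    moreover have "continuous_on {a..b} G1" using contG1 by (rule continuous_on_subset) simp
    ultimately show ?thesis using IVT'[of G1 a y b] a b by auto
  qed
  \<comment> \<open>The transport map: s and \<open>sg s\<close> have the same fraction of the
    respective total mass to their left.\<close>
  define sg where "sg s = inv G1 (A1 / A0 * G0 s)" for s
  have sg: "G1 (sg s) = A1 / A0 * G0 s" for s
  proof -
    have "\<exists>u. G1 u = A1 / A0 * G0 s"
      using G0(4,5)[of s] A by (intro surj1) (auto simp: field_simps)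
    then show ?thesis unfolding sg_def by (metis f_inv_into_f rangeI)
  qed
  have Dsg: "DERIV sg s :> A1 / A0 * (p1 (sg s))\<^sup>2 / (p0 s)\<^sup>2" for s
  proof -
    have "DERIV (inv G1) (G1 (sg s)) :> inverse (1 / (p1 (sg s))\<^sup>2)"
      using G1(1) pos(2)[of "sg s"] contG1 inj1 by (intro DERIV_inverse_global[where f = G1]) auto
    then have 1: "DERIV (inv G1) (A1 / A0 * G0 s) :> (p1 (sg s))\<^sup>2" by (simp add: sg)
    have 2: "DERIV (\<lambda>s. A1 / A0 * G0 s) s :> A1 / A0 * (1 / (p0 s)\<^sup>2)"
      by (rule DERIV_cmult[OF G0(1)])
    show ?thesis using DERIV_chain2[OF 1 2] by (simp add: sg_def[abs_def] mult_ac)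
  qed
  \<comment> \<open>Compares the mass of the interpolated density up to the interpolated point with
    H times the fraction of mass reached at s. If D is non-decreasing and non-negative, letting s
    tend to infinity gives H as a lower bound for A.\<close>
  define D where "D s = G ((1 - l) * s + l * sg s) - H / A0 * G0 s" for s
  have DD: "\<exists>y. DERIV D s :> y \<and> y \<ge> 0" for s
  proof -
    define y where "y = 1 / (p ((1 - l) * s + l * sg s))\<^sup>2 * ((1 - l) + l * (A1 / A0 * (p1 (sg s))\<^sup>2 / (p0 s)\<^sup>2))
       - H / A0 * (1 / (p0 s)\<^sup>2)"
    have "DERIV (\<lambda>s. (1 - l) * s + l * sg s) s :> (1 - l) + l * (A1 / A0 * (p1 (sg s))\<^sup>2 / (p0 s)\<^sup>2)"
      by (rule derivative_eq_intros Dsg refl)+ simp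
    from DERIV_chain2[OF G(1) this] have "DERIV D s :> y"
      unfolding D_def y_def by (intro DERIV_diff DERIV_cmult G0(1)) 
    moreover have "y \<ge> 0"
    proof -
      define P where "P = p ((1 - l) * s + l * sg s)"
      define a where "a = p0 s"
      define b where "b = p1 (sg s)"
      have pos': "P > 0" "a > 0" "b > 0" using pos by (auto simp: P_def a_def b_def)
      \<comment> \<open>The hypothesis \<open>le\<close> at the matched points s and
        \<open>sg s\<close>, followed by Cauchy-Schwarz with the weights A0 and A1. Up to a positive
        denominator this is the sign of y.\<close>
      have "P\<^sup>2 \<le> ((1 - l) * a + l * b)\<^sup>2"
        unfolding P_def a_def b_def using pos(3) le by (intro power_mono) (auto intro: less_imp_le)
      also have "\<dots> \<le> ((1 - l) * A0 * a\<^sup>2 + l * A1 * b\<^sup>2) * ((1 - l) / A0 + l / A1)"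
        using A pos' l by (intro harmonic_cauchy_schwarz) auto
      finally have "H * P\<^sup>2 \<le> (1 - l) * A0 * a\<^sup>2 + l * A1 * b\<^sup>2"
        using den by (simp add: H_def field_simps)
      moreover have "y = ((1 - l) * A0 * a\<^sup>2 + l * A1 * b\<^sup>2 - H * P\<^sup>2) / (A0 * a\<^sup>2 * P\<^sup>2)"
      proof -
        have "y = 1 / P\<^sup>2 * ((1 - l) + l * (A1 / A0 * b\<^sup>2 / a\<^sup>2)) - H / A0 * (1 / a\<^sup>2)"
          unfolding y_def P_def a_def b_def ..
        also have "\<dots> = ((1 - l) * A0 * a\<^sup>2 + l * A1 * b\<^sup>2 - H * P\<^sup>2) / (A0 * a\<^sup>2 * P\<^sup>2)"
          using pos' A by (simp add: divide_simps)
        finally show ?thesis .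
      qed
      ultimately show ?thesis using A pos' by simp
    qed
    ultimately show ?thesis by blast
  qed
  have monoD: "D s \<le> D t" if "s \<le> t" for s t
    by (rule DERIV_nonneg_imp_nondecreasing[OF that]) (use DD in blast)
  have D0: "D s \<ge> 0" for s
  proof -
    \<comment> \<open>Dropping the non-negative term with G leaves a bound that tends to 0 at minus
      infinity, so the behaviour of \<open>sg\<close> there does not have to be known.\<close>
    have "((\<lambda>t. - (H / A0 * G0 t)) \<longlongrightarrow> - (H / A0 * 0)) at_bot" by (intro tendsto_intros G0)
    moreover have "\<forall>\<^sub>F t in at_bot. - (H / A0 * G0 t) \<le> D s"
      using eventually_le_at_bot[of s]
    proof eventually_elim
      case (elim t)
      have "- (H / A0 * G0 t) \<le> D t" using G(4)[of "(1 - l) * t + l * sg t"] by (simp add: D_def)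
      then show ?case using monoD[OF elim] by simp
    qed
    ultimately show ?thesis by (intro tendsto_upperbound[of "\<lambda>t. - (H / A0 * G0 t)" 0 at_bot]) auto
  qed
  have "((\<lambda>t. H / A0 * G0 t) \<longlongrightarrow> H / A0 * A0) at_top" by (intro tendsto_intros G0)
  moreover have "H / A0 * G0 t \<le> A" for t
    using D0[of t] G(5)[of "(1 - l) * t + l * sg t"] by (simp add: D_def)
  ultimately have "H / A0 * A0 \<le> A" by (intro tendsto_upperbound[of "\<lambda>t. H / A0 * G0 t" _ at_top]) auto
  then show ?thesis using A by (simp add: H_def)
qed

section \<open>Polars of finite configurations\<close>

text \<open>The support function of the convex hull of the points, translated so that z becomes the
  origin.\<close>

definition supp_at :: "'i set \<Rightarrow> ('i \<Rightarrow> real ^ 2) \<Rightarrow> real ^ 2 \<Rightarrow> real ^ 2 \<Rightarrow> real" where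
  "supp_at I x z u = Max ((\<lambda>i. u \<bullet> (x i - z)) ` I)"

text \<open>Interiority of z written as a bound on the support function, with e the radius of a ball
  around z inside the hull. This form can be inserted directly into the integrals over
  directions.\<close>

definition inner_pt :: "'i set \<Rightarrow> ('i \<Rightarrow> real ^ 2) \<Rightarrow> real ^ 2 \<Rightarrow> bool" where
  "inner_pt I x z \<longleftrightarrow> (\<exists>e>0. \<forall>u. e * norm u \<le> supp_at I x z u)"

definition polar_pts :: "'i set \<Rightarrow> ('i \<Rightarrow> real ^ 2) \<Rightarrow> real ^ 2 \<Rightarrow> (real ^ 2) set" where
  "polar_pts I x z = {u. \<forall>i\<in>I. u \<bullet> (x i - z) \<le> 1}"

text \<open>Twice the area of the part of the polar in the half plane of positive second coordinate,
  written in the coordinates \<open>u = b (s, 1)\<close>.\<close>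

definition upper_part :: "'i set \<Rightarrow> ('i \<Rightarrow> real ^ 2) \<Rightarrow> real ^ 2 \<Rightarrow> real" where
  "upper_part I x z = (\<integral>s. 1 / (supp_at I x z (vec2 s 1))\<^sup>2 \<partial>lborel)"

text \<open>Reflecting the points and the centre exchanges the two half planes, so the lower part
  needs no formula of its own.\<close>

definition polar_area :: "'i set \<Rightarrow> ('i \<Rightarrow> real ^ 2) \<Rightarrow> real ^ 2 \<Rightarrow> real" where
  "polar_area I x z = (upper_part I x z + upper_part I (\<lambda>i. - x i) (- z)) / 2"

lemma polar_at_convex_hull: "polar_at (convex hull (x ` I)) z = polar_pts I x z"
proof -
  have "(\<forall>y\<in>convex hull (x ` I). w \<bullet> (y - z) \<le> 1) \<longleftrightarrow> (\<forall>i\<in>I. w \<bullet> (x i - z) \<le> 1)" for w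
  proof
    assume *: "\<forall>i\<in>I. w \<bullet> (x i - z) \<le> 1"
    have "convex hull (x ` I) \<subseteq> {y. w \<bullet> y \<le> 1 + w \<bullet> z}"
      using * by (intro hull_minimal convex_halfspace_le) (auto simp: inner_diff_right)
    then show "\<forall>y\<in>convex hull (x ` I). w \<bullet> (y - z) \<le> 1" by (auto simp: inner_diff_right)
  qed (auto simp: hull_inc)
  then show ?thesis by (auto simp: polar_at_def polar_set_def polar_pts_def)
qed

lemma closed_polar_pts: "closed (polar_pts I x z)"
proof -
  have "polar_pts I x z = (\<Inter>i\<in>I. {u. (x i - z) \<bullet> u \<le> 1})"
    by (auto simp: polar_pts_def inner_commute)
  then show ?thesis by (auto intro: closed_halfspace_le)
qed

lemma polar_pts_borel [measurable]: "polar_pts I x z \<in> sets borel"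
  by (simp add: closed_polar_pts borel_closed)

text \<open>The inverse square lies above its tangent at m. The equality case is kept because
  uniqueness of the Santalo point rests on strict convexity.\<close>

lemma inverse_square_tangent:
  fixes a m :: real
  assumes "a > 0" "m > 0"
  shows "1 / m\<^sup>2 - 2 * (a - m) / m ^ 3 \<le> 1 / a\<^sup>2"
    and "1 / m\<^sup>2 - 2 * (a - m) / m ^ 3 = 1 / a\<^sup>2 \<Longrightarrow> a = m"
proof -
  have *: "1 / a\<^sup>2 - (1 / m\<^sup>2 - 2 * (a - m) / m ^ 3) = (a - m)\<^sup>2 * (m + 2 * a) / (a\<^sup>2 * m ^ 3)"
    using assms by (simp add: divide_simps) algebra
  also have "\<dots> \<ge> 0" using assms by simp
  finally show "1 / m\<^sup>2 - 2 * (a - m) / m ^ 3 \<le> 1 / a\<^sup>2" by simp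
  show "a = m" if "1 / m\<^sup>2 - 2 * (a - m) / m ^ 3 = 1 / a\<^sup>2"
    using * that assms by simp
qed

lemma inverse_square_convex:
  fixes a b t :: real
  assumes "a > 0" "b > 0" "0 < t" "t < 1"
  shows "1 / ((1 - t) * a + t * b)\<^sup>2 \<le> (1 - t) * (1 / a\<^sup>2) + t * (1 / b\<^sup>2)"
    and "1 / ((1 - t) * a + t * b)\<^sup>2 = (1 - t) * (1 / a\<^sup>2) + t * (1 / b\<^sup>2) \<Longrightarrow> a = b"
proof -
  define m where "m = (1 - t) * a + t * b"
  have m: "m > 0" using assms by (simp add: m_def add_pos_pos)
  define A where "A = 1 / m\<^sup>2 - 2 * (a - m) / m ^ 3"
  define B where "B = 1 / m\<^sup>2 - 2 * (b - m) / m ^ 3"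
  have "(1 - t) * A + t * B = 1 / m\<^sup>2 - 2 * ((1 - t) * a + t * b - m) / m ^ 3"
    using m by (simp add: A_def B_def divide_simps) algebra
  then have AB: "(1 - t) * A + t * B = 1 / m\<^sup>2" by (simp add: m_def)
  have le: "(1 - t) * A \<le> (1 - t) * (1 / a\<^sup>2)" "t * B \<le> t * (1 / b\<^sup>2)"
    using mult_left_mono[OF inverse_square_tangent(1)[of a m], of "1 - t"]
      mult_left_mono[OF inverse_square_tangent(1)[of b m], of t] assms m
    unfolding A_def B_def by simp_all
  then show "1 / ((1 - t) * a + t * b)\<^sup>2 \<le> (1 - t) * (1 / a\<^sup>2) + t * (1 / b\<^sup>2)"
    using AB by (simp add: m_def)
  assume "1 / ((1 - t) * a + t * b)\<^sup>2 = (1 - t) * (1 / a\<^sup>2) + t * (1 / b\<^sup>2)"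
  then have "(1 - t) * A = (1 - t) * (1 / a\<^sup>2)" "t * B = t * (1 / b\<^sup>2)"
    using AB le unfolding m_def by linarith+
  then have "A = 1 / a\<^sup>2" "B = 1 / b\<^sup>2"
    using assms by (metis diff_gt_0_iff_gt less_irrefl mult_cancel_left)+
  then have "a = m" "b = m" using assms m by (auto simp: A_def B_def intro: inverse_square_tangent(2))
  then show "a = b" by simp
qed

context
  fixes I :: "'i set"
  assumes I: "finite I" "I \<noteq> {}"
begin

lemma supp_at_le_iff: "supp_at I x z u \<le> c \<longleftrightarrow> (\<forall>i\<in>I. u \<bullet> (x i - z) \<le> c)"
  using I by (simp add: supp_at_def)

lemma le_supp_at: "i \<in> I \<Longrightarrow> u \<bullet> (x i - z) \<le> supp_at I x z u"
  using supp_at_le_iff by blast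

lemma supp_at_attained: obtains i where "i \<in> I" "supp_at I x z u = u \<bullet> (x i - z)"
  using Max_in[of "(\<lambda>i. u \<bullet> (x i - z)) ` I"] I unfolding supp_at_def by blast

lemma supp_at_shift: "supp_at I x z u = supp_at I x w u - u \<bullet> (z - w)"
proof -
  have *: "supp_at I x z u \<le> supp_at I x w u - u \<bullet> (z - w)" for z w
    unfolding supp_at_le_iff
  proof
    fix i assume "i \<in> I"
    from le_supp_at[OF this, of u x w] show "u \<bullet> (x i - z) \<le> supp_at I x w u - u \<bullet> (z - w)"
      by (simp add: inner_diff_right)
  qed
  from *[of z w] *[of w z] show ?thesis by (simp add: inner_diff_right)
qed

lemma supp_at_scale: "c \<ge> 0 \<Longrightarrow> supp_at I x z (c *\<^sub>R u) = c * supp_at I x z u"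
proof -
  assume c: "c \<ge> 0"
  obtain i where i: "i \<in> I" "supp_at I x z u = u \<bullet> (x i - z)" by (rule supp_at_attained)
  obtain j where j: "j \<in> I" "supp_at I x z (c *\<^sub>R u) = (c *\<^sub>R u) \<bullet> (x j - z)" by (rule supp_at_attained)
  have "c * supp_at I x z u \<le> supp_at I x z (c *\<^sub>R u)"
    using le_supp_at[OF i(1), of "c *\<^sub>R u" x z] i(2) by simp
  moreover have "supp_at I x z (c *\<^sub>R u) \<le> c * supp_at I x z u"
    using le_supp_at[OF j(1), of u x z] j(2) c by (simp add: mult_left_mono)
  ultimately show ?thesis by simp
qed

lemma convex_supp_at: "convex_on UNIV (supp_at I x z)"
proof (rule convex_onI)
  fix t u v assume t: "0 < (t :: real)" "t < 1"
  show "supp_at I x z ((1 - t) *\<^sub>R u + t *\<^sub>R v) \<le> (1 - t) * supp_at I x z u + t * supp_at I x z v"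
    unfolding supp_at_le_iff using t
    by (auto simp: inner_add_left intro!: add_mono mult_left_mono le_supp_at)
qed auto

lemma continuous_supp_at: "continuous_on UNIV (supp_at I x z)"
  by (intro convex_on_continuous convex_supp_at) auto

lemma continuous_supp_at_line: "continuous_on UNIV (\<lambda>s. supp_at I x z (vec2 s 1))"
proof -
  have "vec2 s 1 = s *\<^sub>R axis 1 1 + axis 2 1" for s
    by (rule vec2_eqI) (simp_all add: axis_def)
  then have "continuous_on UNIV (\<lambda>s. vec2 s 1)" by (auto intro!: continuous_intros)
  then show ?thesis by (intro continuous_on_compose2[OF continuous_supp_at]) auto
qed

text \<open>On the unit circle the support function attains its minimum. Were it positive, it would
  serve as e for all u by homogeneity; so a minimising direction has a non-positive value.\<close>

lemma not_inner_ptE: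
  assumes "\<not> inner_pt I x z"
  obtains u where "u \<noteq> 0" "\<And>i. i \<in> I \<Longrightarrow> u \<bullet> (x i - z) \<le> 0"
proof -
  have ne: "sphere (0 :: real ^ 2) 1 \<noteq> {}" by simp
  obtain u0 where u0: "u0 \<in> sphere 0 1" "\<And>u. u \<in> sphere 0 1 \<Longrightarrow> supp_at I x z u0 \<le> supp_at I x z u"
    using continuous_attains_inf[OF compact_sphere ne continuous_on_subset[OF continuous_supp_at[of x z]]]
    by blast
  have "supp_at I x z u0 \<le> 0"
  proof (rule ccontr)
    assume *: "\<not> supp_at I x z u0 \<le> 0"
    have "supp_at I x z u0 * norm u \<le> supp_at I x z u" for u
    proof (cases "u = 0")
      case True
      then show ?thesis using supp_at_scale[of 0 x z 0] by simp
    next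
      case False
      have "supp_at I x z u = norm u * supp_at I x z ((1 / norm u) *\<^sub>R u)"
        using False by (subst supp_at_scale[symmetric]) auto
      moreover have "supp_at I x z u0 \<le> supp_at I x z ((1 / norm u) *\<^sub>R u)"
        using False by (intro u0) auto
      ultimately show ?thesis by (simp add: mult.commute mult_left_mono)
    qed
    then show False using assms * unfolding inner_pt_def by (meson not_le)
  qed
  moreover have "u0 \<noteq> 0" using u0 by auto
  ultimately show ?thesis using that unfolding supp_at_le_iff by blast
qed

text \<open>A line separating a point of the ball from the hull would violate the bound with e;
  conversely the point of the ball around z that is extreme in direction u bounds the support
  function from below.\<close>

lemma inner_pt_iff_interior: "inner_pt I x z \<longleftrightarrow> z \<in> interior (convex hull (x ` I))"
proof
  assume "inner_pt I x z"
  then obtain e where e: "e > 0" "\<And>u. e * norm u \<le> supp_at I x z u" unfolding inner_pt_def by blast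
  have "ball z e \<subseteq> convex hull (x ` I)"
  proof
    fix y assume y: "y \<in> ball z e"
    show "y \<in> convex hull (x ` I)"
    proof (rule ccontr)
      assume "y \<notin> convex hull (x ` I)"
      moreover have "closed (convex hull (x ` I))"
        using I by (intro compact_imp_closed finite_imp_compact_convex_hull) auto
      ultimately obtain a b where ab: "a \<bullet> y < b" "\<And>w. w \<in> convex hull (x ` I) \<Longrightarrow> a \<bullet> w > b"
        using separating_hyperplane_closed_point[OF convex_convex_hull, of "x ` I" y] by blast
      obtain i where i: "i \<in> I" "supp_at I x z (- a) = (- a) \<bullet> (x i - z)" by (rule supp_at_attained)
      have "a \<bullet> y < a \<bullet> x i" using ab(1) ab(2)[of "x i"] i by (simp add: hull_inc)
      moreover have "(- a) \<bullet> (y - z) \<le> norm a * norm (y - z)" using norm_cauchy_schwarz[of "- a" "y - z"] by simp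
      moreover have "norm a * norm (y - z) \<le> e * norm a"
        using y mult_right_mono[of "norm (y - z)" e "norm a"]
        by (simp add: dist_norm norm_minus_commute mult.commute)
      ultimately show False using e(2)[of "- a"] i by (simp add: inner_diff_right)
    qed
  qed
  then show "z \<in> interior (convex hull (x ` I))" using e(1) mem_interior by blast
next
  assume "z \<in> interior (convex hull (x ` I))"
  then obtain e where e: "e > 0" "cball z e \<subseteq> convex hull (x ` I)" by (auto simp: mem_interior_cball)
  have "e * norm u \<le> supp_at I x z u" for u
  proof (cases "u = 0")
    case True
    then show ?thesis using supp_at_scale[of 0 x z 0] by simp
  next
    case False
    have "convex hull (x ` I) \<subseteq> {y. u \<bullet> y \<le> supp_at I x z u + u \<bullet> z}"
    proof (intro hull_minimal convex_halfspace_le subsetI)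
      fix y assume "y \<in> x ` I"
      then obtain i where "i \<in> I" "y = x i" by blast
      then show "y \<in> {y. u \<bullet> y \<le> supp_at I x z u + u \<bullet> z}"
        using le_supp_at[of i u x z] by (simp add: inner_diff_right)
    qed
    moreover have "z + (e / norm u) *\<^sub>R u \<in> cball z e" using e False by (simp add: dist_norm)
    ultimately have "u \<bullet> (z + (e / norm u) *\<^sub>R u) \<le> supp_at I x z u + u \<bullet> z" using e by blast
    moreover have "u \<bullet> ((e / norm u) *\<^sub>R u) = e * norm u"
      using False by (simp add: dot_square_norm power2_eq_square)
    ultimately show ?thesis by (simp add: inner_add_right)
  qed
  then show "inner_pt I x z" unfolding inner_pt_def using e by blast
qed

lemma inner_pt_pos:
  assumes "inner_pt I x z" "u \<noteq> 0" shows "supp_at I x z u > 0"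
proof -
  obtain e where "e > 0" "e * norm u \<le> supp_at I x z u" using assms unfolding inner_pt_def by blast
  moreover from this have "e * norm u > 0" using assms by simp
  ultimately show ?thesis by linarith
qed

lemma inner_pt_pos_line: "inner_pt I x z \<Longrightarrow> supp_at I x z (vec2 s 1) > 0"
  by (rule inner_pt_pos) (auto simp: vec_eq_iff forall_2)

lemma supp_at_uminus: "supp_at I (\<lambda>i. - x i) (- z) u = supp_at I x z (- u)"
  by (simp add: supp_at_def inner_diff_right inner_minus_right)

lemma inner_pt_uminus: "inner_pt I (\<lambda>i. - x i) (- z) \<longleftrightarrow> inner_pt I x z"
  unfolding inner_pt_def supp_at_uminus by (metis minus_minus norm_minus_cancel)

text \<open>Interiority bounds the support function at (s, 1) below by e times the norm of (s, 1),
  so the integrand is dominated by a multiple of the Cauchy density.\<close>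

lemma integrable_upper_part:
  assumes "inner_pt I x z"
  shows "integrable lborel (\<lambda>s. 1 / (supp_at I x z (vec2 s 1))\<^sup>2)"
proof -
  obtain e where e: "e > 0" "\<And>u. e * norm u \<le> supp_at I x z u"
    using assms unfolding inner_pt_def by blast
  have "(1 :: real) / (supp_at I x z (vec2 s 1))\<^sup>2 \<le> (1 / e\<^sup>2) * inverse (1 + s\<^sup>2)" for s
  proof -
    have "(e * norm (vec2 s 1))\<^sup>2 \<le> (supp_at I x z (vec2 s 1))\<^sup>2"
      using e by (intro power_mono) auto
    moreover have "(e * norm (vec2 s 1))\<^sup>2 = e\<^sup>2 * (1 + s\<^sup>2)"
      by (simp add: norm_vec2 power_mult_distrib)
    moreover have "e\<^sup>2 * (1 + s\<^sup>2) > 0" using e by (auto simp: add_pos_nonneg)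
    ultimately have "1 / (supp_at I x z (vec2 s 1))\<^sup>2 \<le> 1 / (e\<^sup>2 * (1 + s\<^sup>2))"
      by (intro frac_le) simp_all
    then show ?thesis by (simp add: field_simps)
  qed
  note bound = this
  have "integrable lborel (\<lambda>x::real. inverse (1 + x\<^sup>2))"
    using integrable_inverse_1_plus_square by (simp add: set_integrable_def einterval_def)
  then have "integrable lborel (\<lambda>s. (1 / e\<^sup>2) * inverse (1 + s\<^sup>2))" by simp
  then show ?thesis
  proof (rule Bochner_Integration.integrable_bound)
    show "(\<lambda>s. 1 / (supp_at I x z (vec2 s 1))\<^sup>2) \<in> borel_measurable lborel"
      using borel_measurable_continuous_onI[OF continuous_supp_at_line[of x z]] by measurable
    show "AE s in lborel. norm (1 / (supp_at I x z (vec2 s 1))\<^sup>2) \<le> norm ((1 / e\<^sup>2) * inverse (1 + s\<^sup>2))"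
      using bound by (auto intro!: AE_I2)
  qed
qed

lemma upper_part_pos:
  assumes "inner_pt I x z" shows "upper_part I x z > 0"
proof -
  have "continuous_on UNIV (\<lambda>s. 1 / (supp_at I x z (vec2 s 1))\<^sup>2)"
    using inner_pt_pos_line[OF assms]
    by (intro continuous_intros continuous_supp_at_line) (auto simp: less_imp_neq[symmetric])
  moreover have "1 / (supp_at I x z (vec2 s 1))\<^sup>2 > 0" for s
    using inner_pt_pos_line[OF assms, of s] by simp
  ultimately obtain G where "\<And>s. 0 < G s" "\<And>s. G s < upper_part I x z"
    unfolding upper_part_def by (rule antiderivative_on_line[OF integrable_upper_part[OF assms]]) blast
  then show ?thesis by (meson less_trans)
qed

lemma polar_area_pos: "inner_pt I x z \<Longrightarrow> polar_area I x z > 0"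
  unfolding polar_area_def using upper_part_pos[of x z] upper_part_pos[of "\<lambda>i. - x i" "- z"]
  by (simp add: inner_pt_uminus)

text \<open>The polar contains w and the disc of radius 1/D, hence the rectangle spanned by w/2 and
  an orthogonal vector of length 1/(2D). The two halvings make the two contributions to each
  constraint add up to at most 1. A far point of the polar thus forces a large area.\<close>

lemma emeasure_polar_ge:
  assumes w: "w \<in> polar_pts I x z" and D: "D > 0" "\<And>i. i \<in> I \<Longrightarrow> norm (x i - z) \<le> D"
  shows "ennreal (norm w / (4 * D)) \<le> emeasure lborel (polar_pts I x z)"
proof (cases "w = 0")
  case False
  define q where "q = (1 / (2 * norm w * D)) *\<^sub>R vec2 (- (w $ 2)) (w $ 1)"
  define p where "p = (1 / 2) *\<^sub>R w"
  have nw: "norm (vec2 (- (w $ 2)) (w $ 1)) = norm w" by (simp add: norm_vec2 add.commute)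
  have "cross2 p q = norm w ^ 2 / (4 * norm w * D)"
    unfolding cross2_def p_def q_def power2_norm_eq_inner inner_vec2
    by (simp add: add_divide_distrib mult_ac)
  then have c: "cross2 p q = norm w / (4 * D)" by (simp add: power2_eq_square)
  have in_polar: "frame 0 p q y \<in> polar_pts I x z" if "0 \<le> y $ 1" "y $ 1 \<le> 1" "0 \<le> y $ 2" "y $ 2 \<le> 1" for y
    unfolding polar_pts_def
  proof safe
    fix i assume i: "i \<in> I"
    have "w \<bullet> (x i - z) \<le> 1" using w i by (simp add: polar_pts_def)
    then have 1: "y $ 1 * (w \<bullet> (x i - z)) \<le> 1" using that mult_left_mono[of "w \<bullet> (x i - z)" 1 "y $ 1"] by simp
    have "q \<bullet> (x i - z) \<le> norm q * norm (x i - z)" by (rule norm_cauchy_schwarz)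
    also have "\<dots> \<le> norm q * D" using D i by (intro mult_left_mono) auto
    also have "\<dots> = 1 / 2" using D False by (simp add: q_def nw)
    finally have "y $ 2 * (q \<bullet> (x i - z)) \<le> 1 * (1 / 2)"
      using that mult_left_mono[of "q \<bullet> (x i - z)" "1 / 2" "y $ 2"] by simp
    then show "frame 0 p q y \<bullet> (x i - z) \<le> 1"
      using 1 by (simp add: frame_def p_def inner_add_left)
  qed
  have "1 = emeasure lborel (cbox (0 :: real ^ 2) 1)"
    by (subst emeasure_lborel_cbox_eq) (auto simp: Basis_vec2 axis_eq_axis inner_axis)
  also have "\<dots> = (\<integral>\<^sup>+ y. indicator (cbox (0 :: real ^ 2) 1) y \<partial>lborel)" by simp
  also have "\<dots> \<le> (\<integral>\<^sup>+ y. indicator (polar_pts I x z) (frame 0 p q y) \<partial>lborel)"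
    using in_polar by (intro nn_integral_mono) (auto simp: indicator_def mem_box_cart forall_2)
  finally have "ennreal (norm w / (4 * D)) * 1
      \<le> ennreal \<bar>cross2 p q\<bar> * (\<integral>\<^sup>+ y. indicator (polar_pts I x z) (frame 0 p q y) \<partial>lborel)"
    using D by (intro mult_mono) (auto simp: c)
  also have "\<dots> = (\<integral>\<^sup>+ y. indicator (polar_pts I x z) y \<partial>lborel)"
    using D False by (intro nn_integral_frame) (auto simp: c)
  finally show ?thesis by simp
qed simp

lemma bounded_pts:
  fixes x :: "'i \<Rightarrow> real ^ 2"
  obtains D where "D > 0" "\<And>i. i \<in> I \<Longrightarrow> norm (x i - z) \<le> D"
proof
  let ?D = "1 + (\<Sum>i\<in>I. norm (x i - z))"
  show "?D > 0" by (smt (verit) norm_ge_zero sum_nonneg)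
  show "norm (x i - z) \<le> ?D" if "i \<in> I" for i
    using member_le_sum[of i I "\<lambda>i. norm (x i - z)"] that I by auto
qed

text \<open>If z is not interior, the polar contains a whole ray, and arbitrarily far points of it
  give arbitrarily large areas.\<close>

lemma emeasure_polar_infinite:
  assumes "\<not> inner_pt I x z" shows "emeasure lborel (polar_pts I x z) = \<infinity>"
proof -
  obtain u where u: "u \<noteq> 0" "\<And>i. i \<in> I \<Longrightarrow> u \<bullet> (x i - z) \<le> 0" using not_inner_ptE[OF assms] by blast
  obtain D where D: "D > 0" "\<And>i. i \<in> I \<Longrightarrow> norm (x i - z) \<le> D" using bounded_pts[of x z] by blast
  have *: "ennreal (real n) \<le> emeasure lborel (polar_pts I x z)" for n
  proof -
    define k where "k = real n * 4 * D / norm u"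
    have "(k *\<^sub>R u) \<bullet> (x i - z) \<le> 1" if "i \<in> I" for i
    proof -
      have "k * (u \<bullet> (x i - z)) \<le> 0" using u(2)[OF that] D by (intro mult_nonneg_nonpos) (auto simp: k_def)
      then show ?thesis by simp
    qed
    then have "ennreal (norm (k *\<^sub>R u) / (4 * D)) \<le> emeasure lborel (polar_pts I x z)"
      by (intro emeasure_polar_ge D) (auto simp: polar_pts_def)
    moreover have "norm (k *\<^sub>R u) / (4 * D) = n" using D u by (simp add: k_def)
    ultimately show ?thesis by simp
  qed
  have "(\<Squnion>n. of_nat n) \<le> emeasure lborel (polar_pts I x z)"
    by (intro SUP_least) (use * in \<open>simp add: ennreal_of_nat_eq_real_of_nat\<close>)
  then show ?thesis by (simp add: ennreal_SUP_of_nat_eq_top top.extremum_unique)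
qed

end

section \<open>The area of the polar\<close>

context
  fixes I :: "'i set"
  assumes I: "finite I" "I \<noteq> {}"
begin

lemmas supp_borel [measurable] = borel_measurable_continuous_onI[OF continuous_supp_at_line[OF I]]

text \<open>On the line of height b the substitution \<open>a = b * s\<close> has the Jacobian b,
  and membership in the polar becomes \<open>b \<le> 1 / h s\<close>. Integrating b over this range
  first leaves half of the inverse square of h.\<close>

lemma emeasure_upper_polar:
  assumes "inner_pt I x z"
  shows "emeasure lborel (polar_pts I x z \<inter> {u. u $ 2 > 0}) = ennreal (upper_part I x z / 2)"
proof -
  define h where "h s = supp_at I x z (vec2 s 1)" for s
  have h: "h s > 0" for s using inner_pt_pos_line[OF I assms] by (simp add: h_def)
  have [measurable]: "h \<in> borel_measurable borel" unfolding h_def by measurable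
  have [measurable]: "{u :: real ^ 2. u $ 2 > 0} \<in> sets borel"
    by (simp add: open_halfspace_component_gt_cart borel_open)
  define F :: "real \<Rightarrow> real \<Rightarrow> ennreal" where "F b s = (if 0 < b \<and> b \<le> 1 / h s then ennreal b else 0)" for b s
  have [measurable]: "(\<lambda>p. F (snd p) (fst p)) \<in> borel_measurable (lborel \<Otimes>\<^sub>M lborel)"
    unfolding F_def by measurable
  have mem: "b *\<^sub>R vec2 s 1 \<in> polar_pts I x z \<longleftrightarrow> b \<le> 1 / h s" if "b > 0" for b s
  proof -
    have "b *\<^sub>R vec2 s 1 \<in> polar_pts I x z \<longleftrightarrow> supp_at I x z (b *\<^sub>R vec2 s 1) \<le> 1"
      by (simp add: polar_pts_def supp_at_le_iff[OF I])
    also have "\<dots> \<longleftrightarrow> b \<le> 1 / h s" using that h[of s] by (simp add: supp_at_scale[OF I] h_def field_simps)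
    finally show ?thesis .
  qed
  have inner: "(\<integral>\<^sup>+ a. indicator (polar_pts I x z \<inter> {u. u $ 2 > 0}) (vec2 a b) \<partial>lborel) = (\<integral>\<^sup>+ s. F b s \<partial>lborel)" for b
  proof (cases "b > 0")
    case True
    have [simp]: "vec2 (b * s) b = b *\<^sub>R vec2 s 1" for s by (rule vec2_eqI) simp_all
    have "(\<integral>\<^sup>+ a. indicator (polar_pts I x z \<inter> {u. u $ 2 > 0}) (vec2 a b) \<partial>lborel)
       = ennreal b * (\<integral>\<^sup>+ s. indicator (polar_pts I x z \<inter> {u. u $ 2 > 0}) (vec2 (b * s) b) \<partial>lborel)"
      using True nn_integral_real_affine[of "\<lambda>a. indicator (polar_pts I x z \<inter> {u. u $ 2 > 0}) (vec2 a b)" b 0]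
      by simp
    also have "\<dots> = (\<integral>\<^sup>+ s. ennreal b * indicator (polar_pts I x z \<inter> {u. u $ 2 > 0}) (vec2 (b * s) b) \<partial>lborel)"
      by (rule nn_integral_cmult[symmetric]) simp
    also have "\<dots> = (\<integral>\<^sup>+ s. F b s \<partial>lborel)"
      using True mem[of b] by (intro nn_integral_cong) (auto simp: F_def indicator_def)
    finally show ?thesis .
  qed (simp add: F_def)
  have "emeasure lborel (polar_pts I x z \<inter> {u. u $ 2 > 0})
      = (\<integral>\<^sup>+ u. indicator (polar_pts I x z \<inter> {u. u $ 2 > 0}) u \<partial>lborel)" by simp
  also have "\<dots> = (\<integral>\<^sup>+ b. \<integral>\<^sup>+ a. indicator (polar_pts I x z \<inter> {u. u $ 2 > 0}) (vec2 a b) \<partial>lborel \<partial>lborel)"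
    by (rule nn_integral_vec2) measurable
  also have "\<dots> = (\<integral>\<^sup>+ b. \<integral>\<^sup>+ s. F b s \<partial>lborel \<partial>lborel)" by (simp add: inner)
  also have "\<dots> = (\<integral>\<^sup>+ s. \<integral>\<^sup>+ b. F b s \<partial>lborel \<partial>lborel)"
    by (rule lborel_pair.Fubini') (simp add: case_prod_beta')
  also have "\<dots> = (\<integral>\<^sup>+ s. ennreal (1 / 2 * (1 / (h s)\<^sup>2)) \<partial>lborel)"
  proof (rule nn_integral_cong)
    fix s :: real
    have "(\<integral>\<^sup>+ b. F b s \<partial>lborel) = (\<integral>\<^sup>+ b. ennreal b * indicator {0..1 / h s} b \<partial>lborel)"
      by (intro nn_integral_cong) (auto simp: F_def indicator_def)
    also have "\<dots> = ennreal ((1 / h s)\<^sup>2 / 2 - 0\<^sup>2 / 2)"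
      using h[of s] by (intro nn_integral_FTC_Icc) (auto intro!: derivative_eq_intros)
    finally show "(\<integral>\<^sup>+ b. F b s \<partial>lborel) = ennreal (1 / 2 * (1 / (h s)\<^sup>2))"
      by (simp add: power_divide mult.commute)
  qed
  also have "\<dots> = ennreal (\<integral>s. 1 / 2 * (1 / (h s)\<^sup>2) \<partial>lborel)"
    using integrable_upper_part[OF I assms]
    by (intro nn_integral_eq_integral integrable_mult_right) (auto simp: h_def)
  also have "(\<integral>s. 1 / 2 * (1 / (h s)\<^sup>2) \<partial>lborel) = upper_part I x z / 2"
    by (subst integral_mult_right_zero) (simp add: upper_part_def h_def)
  finally show ?thesis .
qed

lemma emeasure_horizontal_axis: "emeasure lborel {u :: real ^ 2. u $ 2 = 0} = 0"
proof -
  have "emeasure lborel {u :: real ^ 2. u $ 2 = 0} = (\<integral>\<^sup>+ u. indicator {u :: real ^ 2. u $ 2 = 0} u \<partial>lborel)"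
    by simp
  also have "\<dots> = (\<integral>\<^sup>+ a. \<integral>\<^sup>+ b. indicator {u :: real ^ 2. u $ 2 = 0} (vec2 a b) \<partial>lborel \<partial>lborel)"
    by (rule nn_integral_vec2) measurable
  also have "\<dots> = (\<integral>\<^sup>+ a. \<integral>\<^sup>+ b. indicator {0} b \<partial>(lborel :: real measure) \<partial>(lborel :: real measure))"
    by (intro nn_integral_cong) (auto simp: indicator_def)
  finally show ?thesis by simp
qed

lemma emeasure_polar_pts:
  assumes "inner_pt I x z"
  shows "emeasure lborel (polar_pts I x z) = ennreal (polar_area I x z)"
proof -
  let ?P = "polar_pts I x z"
  let ?U = "{u :: real ^ 2. u $ 2 > 0}"
  let ?L = "{u :: real ^ 2. u $ 2 < 0}"
  have [measurable]: "?U \<in> sets borel" "?L \<in> sets borel" "{u :: real ^ 2. u $ 2 = 0} \<in> sets borel"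
    by measurable
  have "emeasure lborel (?P \<inter> ?L) = emeasure lborel (polar_pts I (\<lambda>i. - x i) (- z) \<inter> ?U)"
  proof -
    have "ennreal \<bar>cross2 (vec2 (-1) 0) (vec2 0 (-1))\<bar> * (\<integral>\<^sup>+ u. indicator (?P \<inter> ?L) (frame 0 (vec2 (-1) 0) (vec2 0 (-1)) u) \<partial>lborel)
      = (\<integral>\<^sup>+ u. indicator (?P \<inter> ?L) u \<partial>lborel)"
      by (rule nn_integral_frame) (auto simp: cross2_def)
    moreover have "frame 0 (vec2 (-1) 0) (vec2 0 (-1)) u = - u" for u
      by (rule vec2_eqI) (simp_all add: frame_def)
    moreover have "indicator (?P \<inter> ?L) (- u) = (indicator (polar_pts I (\<lambda>i. - x i) (- z) \<inter> ?U) u :: ennreal)" for u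
      by (simp add: indicator_def polar_pts_def inner_diff_right)
    ultimately show ?thesis by (simp add: cross2_def)
  qed
  also have "\<dots> = ennreal (upper_part I (\<lambda>i. - x i) (- z) / 2)"
    using assms by (intro emeasure_upper_polar) (simp add: inner_pt_uminus[OF I])
  finally have L: "emeasure lborel (?P \<inter> ?L) = ennreal (upper_part I (\<lambda>i. - x i) (- z) / 2)" .
  have "emeasure lborel ?P = emeasure lborel ((?P \<inter> ?U) \<union> (?P \<inter> ?L) \<union> (?P \<inter> {u. u $ 2 = 0}))"
    by (rule arg_cong[where f = "emeasure lborel"]) auto
  also have "\<dots> = emeasure lborel ((?P \<inter> ?U) \<union> (?P \<inter> ?L))"
  proof (rule emeasure_Un_null_set)
    have "emeasure lborel (?P \<inter> {u. u $ 2 = 0}) \<le> emeasure lborel {u :: real ^ 2. u $ 2 = 0}"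
      by (intro emeasure_mono) auto
    then show "?P \<inter> {u. u $ 2 = 0} \<in> null_sets lborel" by (auto simp: null_sets_def emeasure_horizontal_axis)
  qed auto
  also have "\<dots> = emeasure lborel (?P \<inter> ?U) + emeasure lborel (?P \<inter> ?L)"
    by (intro plus_emeasure[symmetric]) auto
  also have "\<dots> = ennreal (upper_part I x z / 2) + ennreal (upper_part I (\<lambda>i. - x i) (- z) / 2)"
    by (simp add: L emeasure_upper_polar[OF assms])
  also have "\<dots> = ennreal (polar_area I x z)"
    using upper_part_pos[OF I, of x z] upper_part_pos[OF I, of "\<lambda>i. - x i" "- z"] assms
    by (subst ennreal_plus[symmetric]) (auto simp: inner_pt_uminus[OF I] polar_area_def add_divide_distrib)
  finally show ?thesis .
qed

section \<open>Strict convexity and continuity of the polar area in the centre\<close>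

lemma convex_inner_pts: "convex {z. inner_pt I x z}"
  unfolding inner_pt_iff_interior[OF I] by (simp add: convex_interior)

lemma open_inner_pts: "open {z. inner_pt I x z}"
  unfolding inner_pt_iff_interior[OF I] by simp

lemma supp_at_affine:
  "supp_at I x ((1 - t) *\<^sub>R z + t *\<^sub>R w) u = (1 - t) * supp_at I x z u + t * supp_at I x w u"
  unfolding supp_at_shift[OF I, of x z u 0] supp_at_shift[OF I, of x w u 0]
    supp_at_shift[OF I, of x "(1 - t) *\<^sub>R z + t *\<^sub>R w" u 0]
  by (simp add: inner_add_right inner_diff_right algebra_simps)

text \<open>For a fixed direction the support function is affine in the centre, so the integrand is
  convex. Equality would force equal support values in almost all directions (s, 1), which leaves no
  room for two centres.\<close>

lemma upper_part_convex:
  assumes "inner_pt I x z" "inner_pt I x w" "0 < t" "t < 1"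
  shows "upper_part I x ((1 - t) *\<^sub>R z + t *\<^sub>R w) \<le> (1 - t) * upper_part I x z + t * upper_part I x w"
    and "z \<noteq> w \<Longrightarrow> upper_part I x ((1 - t) *\<^sub>R z + t *\<^sub>R w) < (1 - t) * upper_part I x z + t * upper_part I x w"
proof -
  let ?m = "(1 - t) *\<^sub>R z + t *\<^sub>R w"
  have m: "inner_pt I x ?m"
    using convex_inner_pts[of x] assms unfolding convex_alt by auto
  define f where "f v s = 1 / (supp_at I x v (vec2 s 1))\<^sup>2" for v s
  have int: "integrable lborel (f z)" "integrable lborel (f w)" "integrable lborel (f ?m)"
    unfolding f_def using integrable_upper_part[OF I] assms m by auto
  have le: "f ?m s \<le> (1 - t) * f z s + t * f w s" for s
    unfolding f_def supp_at_affine using assms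
    by (intro inverse_square_convex inner_pt_pos_line[OF I])
  define g where "g s = (1 - t) * f z s + t * f w s - f ?m s" for s
  have intg: "integrable lborel g" unfolding g_def using int by simp
  have eq: "integral\<^sup>L lborel g = (1 - t) * upper_part I x z + t * upper_part I x w - upper_part I x ?m"
    unfolding g_def upper_part_def f_def[symmetric] using int by simp
  have "integral\<^sup>L lborel g \<ge> 0" unfolding g_def using le by (intro integral_nonneg_AE) auto
  then show 1: "upper_part I x ?m \<le> (1 - t) * upper_part I x z + t * upper_part I x w"
    using eq by simp
  assume "z \<noteq> w"
  have "integral\<^sup>L lborel g \<noteq> 0"
  proof
    assume "integral\<^sup>L lborel g = 0"
    then have "AE s in lborel. g s = 0"
      using integral_nonneg_eq_0_iff_AE[OF intg] le by (auto simp: g_def)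
    \<comment> \<open>The one direction (s, 1) orthogonal to z - w. If the first coordinates agree,
      the quotient is 0 by division by zero, and excluding that point does no harm.\<close>
    moreover have "AE s in lborel. s \<noteq> - ((z $ 2 - w $ 2) / (z $ 1 - w $ 1))"
      by (rule AE_lborel_singleton)
    ultimately have "AE s :: real in lborel. False"
    proof eventually_elim
      case (elim s)
      have "supp_at I x z (vec2 s 1) = supp_at I x w (vec2 s 1)"
      proof (rule inverse_square_convex(2))
        show "1 / ((1 - t) * supp_at I x z (vec2 s 1) + t * supp_at I x w (vec2 s 1))\<^sup>2
            = (1 - t) * (1 / (supp_at I x z (vec2 s 1))\<^sup>2) + t * (1 / (supp_at I x w (vec2 s 1))\<^sup>2)"
          using elim(1) by (simp add: g_def f_def supp_at_affine)
      qed (use assms inner_pt_pos_line[OF I] in auto)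
      then have *: "s * (z $ 1 - w $ 1) + (z $ 2 - w $ 2) = 0"
        using supp_at_shift[OF I, of x z "vec2 s 1" w] by (simp add: inner_vec2)
      show False
      proof (cases "z $ 1 = w $ 1")
        case True
        with * \<open>z \<noteq> w\<close> show False by (auto intro: vec2_eqI)
      next
        case False
        with * have "s = - ((z $ 2 - w $ 2) / (z $ 1 - w $ 1))" by (simp add: field_simps)
        with elim show False by simp
      qed
    qed
    then show False by (simp add: eventually_False ae_filter_eq_bot_iff)
  qed
  then show "upper_part I x ?m < (1 - t) * upper_part I x z + t * upper_part I x w"
    using eq 1 by simp
qed

lemma convex_on_upper_part: "convex_on {z. inner_pt I x z} (upper_part I x)"
  by (intro convex_onI convex_inner_pts) (auto intro: upper_part_convex)

lemma continuous_on_upper_part: "continuous_on {z. inner_pt I x z} (upper_part I x)"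
  by (intro convex_on_continuous open_inner_pts convex_on_upper_part)

lemma polar_area_strictly_convex:
  assumes "inner_pt I x z" "inner_pt I x w" "0 < t" "t < 1" "z \<noteq> w"
  shows "polar_area I x ((1 - t) *\<^sub>R z + t *\<^sub>R w) < (1 - t) * polar_area I x z + t * polar_area I x w"
proof -
  have "upper_part I x ((1 - t) *\<^sub>R z + t *\<^sub>R w) < (1 - t) * upper_part I x z + t * upper_part I x w"
    using assms by (intro upper_part_convex)
  moreover have "upper_part I (\<lambda>i. - x i) ((1 - t) *\<^sub>R (- z) + t *\<^sub>R (- w))
      < (1 - t) * upper_part I (\<lambda>i. - x i) (- z) + t * upper_part I (\<lambda>i. - x i) (- w)"
    using assms by (intro upper_part_convex) (auto simp: inner_pt_uminus[OF I])
  moreover have "(1 - t) *\<^sub>R (- z) + t *\<^sub>R (- w) = - ((1 - t) *\<^sub>R z + t *\<^sub>R w)" by simp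
  moreover have "(1 - t) * ((p + q) / 2) + t * ((r + s) / 2) = (((1 - t) * p + t * r) + ((1 - t) * q + t * s)) / 2"
    for p q r s :: real by (simp add: field_simps)
  ultimately show ?thesis by (simp add: polar_area_def)
qed

lemma continuous_on_polar_area: "continuous_on {z. inner_pt I x z} (polar_area I x)"
proof -
  have "continuous_on {z. inner_pt I x z} (\<lambda>z. upper_part I (\<lambda>i. - x i) (- z))"
    by (rule continuous_on_compose2[OF continuous_on_upper_part])
      (auto intro!: continuous_intros simp: inner_pt_uminus[OF I])
  then show ?thesis unfolding polar_area_def
    by (intro continuous_intros continuous_on_upper_part) auto
qed

end

section \<open>The minimal polar and vertical movements\<close>

text \<open>The infimum runs over the whole plane: centres outside the interior contribute infinity.
  Affine covariance and measurability can then be shown without a Santalo point, also for degenerate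
  configurations.\<close>

definition min_polar :: "'i set \<Rightarrow> ('i \<Rightarrow> real ^ 2) \<Rightarrow> ennreal" where
  "min_polar I x = (INF z. emeasure lborel (polar_pts I x z))"

text \<open>The weighted harmonic mean is superadditive, so lower bounds by harmonic means do not
  add up to the harmonic mean of the sums. For proportional pairs, as expressed by
  \<open>ratio\<close>, they do.\<close>

lemma harmonic_sum:
  fixes P P0 P1 Q Q0 Q1 l :: real
  assumes pos: "P0 > 0" "P1 > 0" "Q0 > 0" "Q1 > 0" and l: "0 < l" "l < 1"
    and P: "1 / ((1 - l) / P0 + l / P1) \<le> P" and Q: "1 / ((1 - l) / Q0 + l / Q1) \<le> Q"
    and ratio: "P0 * Q1 = Q0 * P1"
  shows "1 / (P + Q) \<le> (1 - l) / (P0 + Q0) + l / (P1 + Q1)"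
proof -
  define k where "k = P1 / P0"
  have k: "k > 0" "P1 = k * P0" using pos by (simp_all add: k_def)
  then have Q1: "Q1 = k * Q0" using ratio pos by simp
  define d where "d = (1 - l) + l / k"
  have d: "d > 0" using l k by (simp add: d_def add_pos_pos)
  have *: "(1 - l) / P0 + l / P1 = d / P0" "(1 - l) / Q0 + l / Q1 = d / Q0"
    "(1 - l) / (P0 + Q0) + l / (P1 + Q1) = d / (P0 + Q0)"
    using pos k by (simp_all add: Q1 d_def distrib_left[symmetric] add_divide_distrib)
  have "(P0 + Q0) / d \<le> P + Q" using P Q by (simp add: * add_divide_distrib)
  then have "1 / (P + Q) \<le> 1 / ((P0 + Q0) / d)" using pos d by (intro frac_le) auto
  then show ?thesis by (simp add: *)
qed

context
  fixes I :: "'i set"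
  assumes I: "finite I" "I \<noteq> {}"
begin

text \<open>The domain of the polar area is open, so compactness has to come from the sublevel set:
  bounded area keeps the centre at a uniform distance from the boundary.\<close>

lemma polar_area_minimizer:
  assumes "interior (convex hull (x ` I)) \<noteq> {}"
  obtains s where "inner_pt I x s" "\<And>z. inner_pt I x z \<Longrightarrow> polar_area I x s \<le> polar_area I x z"
proof -
  let ?H = "convex hull (x ` I)"
  obtain z0 where z0: "inner_pt I x z0" using assms by (auto simp: inner_pt_iff_interior[OF I])
  have H: "compact ?H" using I by (intro finite_imp_compact_convex_hull) auto
  define D where "D = 1 + diameter ?H"
  have D: "D > 0" unfolding D_def using diameter_ge_0[OF compact_imp_bounded[OF H]] by simp
  have normD: "norm (x i - z) \<le> D" if "i \<in> I" "z \<in> ?H" for i z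
    using diameter_bounded_bound[OF compact_imp_bounded[OF H], of "x i" z] that
    by (simp add: D_def dist_norm hull_inc)
  define C where "C = polar_area I x z0"
  have C: "C > 0" unfolding C_def by (rule polar_area_pos[OF I z0])
  \<comment> \<open>For u with support value h, the point u/h belongs to the polar, and
    \<open>emeasure_polar_ge\<close> gives \<open>norm u / h / (4 * D) \<le> C\<close>; this is the
    bound with e.\<close>
  define e where "e = 1 / (4 * D * C)"
  have e: "e > 0" using C D by (simp add: e_def)
  define K where "K = {z \<in> ?H. \<forall>u. e * norm u \<le> supp_at I x z u}"
  have inner_K: "inner_pt I x z" if "z \<in> K" for z using that e by (auto simp: K_def inner_pt_def)
  have sublevel: "z \<in> K" if z: "inner_pt I x z" "polar_area I x z \<le> C" for z
  proof -
    have zH: "z \<in> ?H" using z interior_subset by (auto simp: inner_pt_iff_interior[OF I])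
    have "e * norm u \<le> supp_at I x z u" for u
    proof (cases "u = 0")
      case True
      then show ?thesis using supp_at_scale[OF I, of 0 x z 0] by simp
    next
      case False
      define h where "h = supp_at I x z u"
      have h: "h > 0" unfolding h_def by (rule inner_pt_pos[OF I z(1) False])
      have "(1 / h) *\<^sub>R u \<in> polar_pts I x z"
        using h le_supp_at[OF I, of _ u x z] by (auto simp: polar_pts_def h_def[symmetric] field_simps)
      then have "ennreal (norm ((1 / h) *\<^sub>R u) / (4 * D)) \<le> ennreal (polar_area I x z)"
        using normD[OF _ zH] D by (subst emeasure_polar_pts[OF I z(1), symmetric]) (rule emeasure_polar_ge[OF I])
      then have "norm ((1 / h) *\<^sub>R u) / (4 * D) \<le> polar_area I x z"
        using polar_area_pos[OF I z(1)] by (subst (asm) ennreal_le_iff) auto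
      then have "norm u / h / (4 * D) \<le> C" using z h by simp
      then have "norm u \<le> C * (4 * D) * h" using h D by (simp add: field_simps)
      then show ?thesis using C D by (simp add: e_def h_def field_simps)
    qed
    with zH show ?thesis by (auto simp: K_def)
  qed
  \<comment> \<open>The support function is affine in the centre, so K is cut out of the hull by
    closed half planes.\<close>
  have "K = ?H \<inter> (\<Inter>u. {z. u \<bullet> z \<le> supp_at I x 0 u - e * norm u})"
  proof -
    have "e * norm u \<le> supp_at I x z u \<longleftrightarrow> u \<bullet> z \<le> supp_at I x 0 u - e * norm u" for z u
      using supp_at_shift[OF I, of x z u 0] by auto
    then show ?thesis by (auto simp: K_def)
  qed
  then have "compact K" using H by (auto intro!: compact_Int_closed closed_INT closed_halfspace_le)
  moreover have "z0 \<in> K" using sublevel[OF z0] by (simp add: C_def)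
  moreover have "continuous_on K (polar_area I x)"
    using continuous_on_subset[OF continuous_on_polar_area[OF I]] inner_K by blast
  ultimately obtain s where s: "s \<in> K" "\<And>z. z \<in> K \<Longrightarrow> polar_area I x s \<le> polar_area I x z"
    using continuous_attains_inf[of K "polar_area I x"] by blast
  have "polar_area I x s \<le> polar_area I x z" if "inner_pt I x z" for z
    using s(2)[of z] s(2)[OF \<open>z0 \<in> K\<close>] sublevel[OF that] by (cases "polar_area I x z \<le> C") (auto simp: C_def)
  then show ?thesis using that s inner_K by blast
qed

text \<open>Two minimisers would be beaten by their midpoint, so the description in
  \<open>santalo_point\<close> denotes the minimiser. As other centres have infinite polars, the
  same point attains \<open>min_polar\<close>.\<close>

lemma santalo_polar_convex_hull:
  assumes "interior (convex hull (x ` I)) \<noteq> {}"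
  obtains s where "inner_pt I x s" "\<And>z. inner_pt I x z \<Longrightarrow> polar_area I x s \<le> polar_area I x z"
    "area (santalo_polar (convex hull (x ` I))) = polar_area I x s"
    "min_polar I x = ennreal (polar_area I x s)"
proof -
  let ?H = "convex hull (x ` I)"
  obtain s where s: "inner_pt I x s" "\<And>z. inner_pt I x z \<Longrightarrow> polar_area I x s \<le> polar_area I x z"
    using polar_area_minimizer[OF assms] by blast
  have area: "area (polar_at ?H z) = polar_area I x z" if "inner_pt I x z" for z
    using that polar_area_pos[OF I that]
    by (simp add: polar_at_convex_hull measure_def emeasure_polar_pts[OF I])
  have unique: "z = s" if z: "is_santalo_point ?H z" for z
  proof (rule ccontr)
    assume "z \<noteq> s"
    have zi: "inner_pt I x z" "polar_area I x z \<le> polar_area I x s"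
      using z s(1) by (auto simp: is_santalo_point_def inner_pt_iff_interior[OF I, symmetric] area)
    let ?m = "(1 - 1 / 2) *\<^sub>R z + (1 / 2) *\<^sub>R s"
    have "polar_area I x ?m < (1 - 1 / 2) * polar_area I x z + (1 / 2) * polar_area I x s"
      using zi(1) s(1) \<open>z \<noteq> s\<close> by (intro polar_area_strictly_convex[OF I]) auto
    moreover have "inner_pt I x ?m"
      by (rule CollectD, rule convexD_alt[OF convex_inner_pts[OF I]]) (use zi(1) s(1) in auto)
    ultimately show False using s(2)[of ?m] zi(2) by simp
  qed
  have "is_santalo_point ?H s"
    using s by (auto simp: is_santalo_point_def inner_pt_iff_interior[OF I, symmetric] area)
  then have "santalo_point ?H = s" unfolding santalo_point_def using unique by (rule the_equality)
  then have 1: "area (santalo_polar ?H) = polar_area I x s"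
    by (simp add: santalo_polar_def area[OF s(1)])
  have "ennreal (polar_area I x s) \<le> emeasure lborel (polar_pts I x z)" for z
    using s(2)[of z] emeasure_polar_pts[OF I, of x z] emeasure_polar_infinite[OF I, of x z]
    by (cases "inner_pt I x z") (auto intro: ennreal_leI)
  moreover have "emeasure lborel (polar_pts I x s) = ennreal (polar_area I x s)"
    by (rule emeasure_polar_pts[OF I s(1)])
  ultimately have "min_polar I x = ennreal (polar_area I x s)"
    unfolding min_polar_def by (intro antisym INF_greatest) (auto intro: INF_lower2[of s])
  with 1 show ?thesis using that s by blast
qed

text \<open>Equal first coordinates remove the mixed terms: the inner product at the interpolated
  slope is the interpolation of the two inner products, even for different slopes s and t. This is
  the hypothesis of the integral inequality.\<close>

lemma upper_part_harmonic:
  assumes inner: "inner_pt I x0 z0" "inner_pt I x1 z1" "inner_pt I x z"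
    and l: "0 < l" "l < 1"
    and x: "\<And>i. i \<in> I \<Longrightarrow> x i = (1 - l) *\<^sub>R x0 i + l *\<^sub>R x1 i" "z = (1 - l) *\<^sub>R z0 + l *\<^sub>R z1"
    and vert: "\<And>i. i \<in> I \<Longrightarrow> x0 i $ 1 = x1 i $ 1" "z0 $ 1 = z1 $ 1"
  shows "1 / ((1 - l) / upper_part I x0 z0 + l / upper_part I x1 z1) \<le> upper_part I x z"
  unfolding upper_part_def
proof (rule harmonic_integral_inverse_square)
  fix s t :: real
  show "supp_at I x z (vec2 ((1 - l) * s + l * t) 1)
      \<le> (1 - l) * supp_at I x0 z0 (vec2 s 1) + l * supp_at I x1 z1 (vec2 t 1)"
    unfolding supp_at_le_iff[OF I]
  proof
    fix i assume i: "i \<in> I"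
    have "vec2 ((1 - l) * s + l * t) 1 \<bullet> (x i - z)
        = (1 - l) * (vec2 s 1 \<bullet> (x0 i - z0)) + l * (vec2 t 1 \<bullet> (x1 i - z1))"
      using vert(1)[OF i] vert(2) by (simp add: x(1)[OF i] x(2) inner_vec2 algebra_simps)
    also have "\<dots> \<le> (1 - l) * supp_at I x0 z0 (vec2 s 1) + l * supp_at I x1 z1 (vec2 t 1)"
      using l by (intro add_mono mult_left_mono le_supp_at[OF I i]) auto
    finally show "vec2 ((1 - l) * s + l * t) 1 \<bullet> (x i - z)
      \<le> (1 - l) * supp_at I x0 z0 (vec2 s 1) + l * supp_at I x1 z1 (vec2 t 1)" .
  qed
qed (use inner l in \<open>auto intro: inner_pt_pos_line[OF I] continuous_supp_at_line[OF I] integrable_upper_part[OF I]\<close>)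

abbreviation up :: "real ^ 2" where "up \<equiv> vec2 0 1"

lemma upper_part_mono:
  assumes "inner_pt I x z" "inner_pt I x (z + c *\<^sub>R up)" "c \<ge> 0"
  shows "upper_part I x z \<le> upper_part I x (z + c *\<^sub>R up)"
  unfolding upper_part_def
proof (rule integral_mono)
  fix s :: real
  have "supp_at I x (z + c *\<^sub>R up) (vec2 s 1) \<le> supp_at I x z (vec2 s 1)"
    using assms(3) by (subst supp_at_shift[OF I, of _ _ _ z]) (simp add: inner_vec2)
  then show "1 / (supp_at I x z (vec2 s 1))\<^sup>2 \<le> 1 / (supp_at I x (z + c *\<^sub>R up) (vec2 s 1))\<^sup>2"
    using inner_pt_pos_line[OF I assms(2), of s]
    by (intro frac_le power_mono) auto
qed (use assms in \<open>auto intro: integrable_upper_part[OF I]\<close>)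

text \<open>When the rising centre reaches the boundary, the support value at some slope s0 has
  dropped to 0 or below. Just before that, the support function is of the order of the remaining
  distance d on an interval of length 2 d, so the integral of its inverse square is of order
  1/d.\<close>

lemma upper_part_unbounded:
  assumes inner: "\<And>t. 0 \<le> t \<Longrightarrow> t < A \<Longrightarrow> inner_pt I x (z + (t * a) *\<^sub>R up)"
    and A: "A > 0" "a > 0" and not: "\<not> inner_pt I x (z + (A * a) *\<^sub>R up)"
  obtains t where "0 \<le> t" "t < A" "upper_part I x (z + (t * a) *\<^sub>R up) \<ge> C"
proof -
  have z: "inner_pt I x z" using inner[of 0] A by simp
  obtain u where u: "u \<noteq> 0" "\<And>i. i \<in> I \<Longrightarrow> u \<bullet> (x i - (z + (A * a) *\<^sub>R up)) \<le> 0"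
    using not_inner_ptE[OF I not] by blast
  then have le0: "supp_at I x (z + (A * a) *\<^sub>R up) u \<le> 0" unfolding supp_at_le_iff[OF I] by blast
  have shift: "supp_at I x (z + c *\<^sub>R up) v = supp_at I x z v - c * v $ 2" for c v
    by (subst supp_at_shift[OF I, of _ _ _ z]) (simp add: inner_vec2)
  \<comment> \<open>The support value at u was positive at z and is lost by moving upwards, so u
    points upwards and can be rescaled to the form (s0, 1).\<close>
  have "A * a * u $ 2 > 0" using le0 inner_pt_pos[OF I z u(1)] by (simp add: shift)
  then have u2: "u $ 2 > 0" using A by (metis mult_pos_pos zero_less_mult_pos)
  define s0 where "s0 = u $ 1 / u $ 2"
  have "u = u $ 2 *\<^sub>R vec2 s0 1" using u2 by (intro vec2_eqI) (simp_all add: s0_def)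
  then have "u $ 2 * supp_at I x (z + (A * a) *\<^sub>R up) (vec2 s0 1) \<le> 0"
    using le0 supp_at_scale[OF I, of "u $ 2" x "z + (A * a) *\<^sub>R up" "vec2 s0 1"] u2 by simp
  then have s0: "supp_at I x z (vec2 s0 1) \<le> A * a"
    using u2 by (simp add: shift mult_le_0_iff)
  obtain D where D: "D > 0" "\<And>i. i \<in> I \<Longrightarrow> norm (x i - z) \<le> D" using bounded_pts[OF I, of x z] by blast
  \<comment> \<open>On the interval the support function is at most d (1 + D), so the integral is at
    least \<open>2 / (d * (1 + D)\<^sup>2)\<close>; the second bound on d makes this at least
    \<open>\<bar>C\<bar> + 1\<close>. The first one keeps t non-negative.\<close>
  define d where "d = min (A * a) (2 / ((\<bar>C\<bar> + 1) * (1 + D)\<^sup>2))"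
  have d: "d > 0" "d \<le> A * a" "d \<le> 2 / ((\<bar>C\<bar> + 1) * (1 + D)\<^sup>2)"
    using A D by (auto simp: d_def add_pos_nonneg)
  define t where "t = A - d / a"
  have t: "0 \<le> t" "t < A" using d A by (auto simp: t_def field_simps)
  let ?z = "z + (t * a) *\<^sub>R up"
  have zt: "inner_pt I x ?z" by (rule inner[OF t])
  have bound: "supp_at I x ?z (vec2 s 1) \<le> d * (1 + D)" if "\<bar>s - s0\<bar> \<le> d" for s
  proof -
    have "supp_at I x z (vec2 s 1) \<le> supp_at I x z (vec2 s0 1) + d * D"
      unfolding supp_at_le_iff[OF I]
    proof
      fix i assume i: "i \<in> I"
      have "\<bar>(x i - z) $ 1\<bar> \<le> D" using D(2)[OF i] component_le_norm_cart[of "x i - z" 1] by linarith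
      then have "\<bar>s - s0\<bar> * \<bar>(x i - z) $ 1\<bar> \<le> d * D" using that D by (intro mult_mono) auto
      then have "(s - s0) * (x i - z) $ 1 \<le> d * D" by (metis abs_ge_self abs_mult order_trans)
      moreover have "vec2 s 1 \<bullet> (x i - z) = vec2 s0 1 \<bullet> (x i - z) + (s - s0) * (x i - z) $ 1"
        by (simp add: inner_vec2 algebra_simps)
      ultimately show "vec2 s 1 \<bullet> (x i - z) \<le> supp_at I x z (vec2 s0 1) + d * D"
        using le_supp_at[OF I i, of "vec2 s0 1" x z] by linarith
    qed
    moreover have "t * a = A * a - d" using A by (simp add: t_def field_simps)
    ultimately show ?thesis using s0 by (simp add: shift algebra_simps)
  qed
  define c where "c = 1 / (d * (1 + D))\<^sup>2"
  have "2 * d * c = (\<integral>s. c * indicator {s0 - d..s0 + d} s \<partial>lborel)"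
    using d by simp
  also have "\<dots> \<le> upper_part I x ?z"
    unfolding upper_part_def
  proof (rule integral_mono)
    fix s :: real
    show "c * indicator {s0 - d..s0 + d} s \<le> 1 / (supp_at I x ?z (vec2 s 1))\<^sup>2"
    proof (cases "\<bar>s - s0\<bar> \<le> d")
      case True
      then have "c \<le> 1 / (supp_at I x ?z (vec2 s 1))\<^sup>2"
        unfolding c_def using bound[OF True] inner_pt_pos_line[OF I zt, of s]
        by (intro frac_le power_mono) auto
      then show ?thesis by (simp add: indicator_def)
    qed (auto simp: indicator_def abs_le_iff)
  next
    show "integrable lborel (\<lambda>s. c * indicator {s0 - d..s0 + d} s)"
      by (intro integrable_mult_right integrable_real_indicator) (auto simp: emeasure_lborel_Icc_eq)
  qed (use zt in \<open>auto intro: integrable_upper_part[OF I]\<close>)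
  finally have "2 * d * c \<le> upper_part I x ?z" .
  moreover have "C \<le> 2 * d * c"
  proof -
    have D': "(1 + D)\<^sup>2 > 0" using D by simp
    have "d * ((\<bar>C\<bar> + 1) * (1 + D)\<^sup>2) \<le> 2" using d(3) D' by (simp add: pos_le_divide_eq)
    then have "\<bar>C\<bar> + 1 \<le> 2 / (d * (1 + D)\<^sup>2)" using d(1) D' by (simp add: pos_le_divide_eq mult_ac)
    also have "\<dots> = 2 * d * c" using d(1) by (simp add: c_def power_mult_distrib power2_eq_square[of d])
    finally show ?thesis by simp
  qed
  ultimately have "C \<le> upper_part I x ?z" by linarith
  then show ?thesis by (rule that[OF t])
qed

lemma bounded_inner_ray: "\<exists>t\<ge>0. \<not> inner_pt I x (z + (t * a) *\<^sub>R up)" if a: "a > 0"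
proof -
  obtain D where D: "D > 0" "\<And>i. i \<in> I \<Longrightarrow> norm (x i - z) \<le> D" using bounded_pts[OF I, of x z] by blast
  have "\<not> inner_pt I x (z + (D / a * a) *\<^sub>R up)"
  proof
    assume "inner_pt I x (z + (D / a * a) *\<^sub>R up)"
    then have "supp_at I x (z + (D / a * a) *\<^sub>R up) up > 0"
      by (rule inner_pt_pos[OF I]) (auto simp: vec_eq_iff forall_2)
    moreover obtain i where i: "i \<in> I" "supp_at I x z up = up \<bullet> (x i - z)" by (rule supp_at_attained[OF I])
    moreover have "up \<bullet> (x i - z) \<le> D"
      using D(2)[OF i(1)] component_le_norm_cart[of "x i - z" 2] by (simp add: inner_vec2)
    moreover have "supp_at I x (z + (D / a * a) *\<^sub>R up) up = supp_at I x z up - D"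
      using a supp_at_shift[OF I, of x "z + (D / a * a) *\<^sub>R up" up z] by (simp add: inner_vec2)
    ultimately show False by linarith
  qed
  then show ?thesis using D a by (intro exI[of _ "D / a"]) auto
qed

lemma inner_ray_downward:
  assumes "inner_pt I x z" "inner_pt I x (z + t *\<^sub>R v)" "0 \<le> s" "s \<le> t"
  shows "inner_pt I x (z + s *\<^sub>R v)"
proof (cases "t = 0")
  case False
  then have "z + s *\<^sub>R v = (1 - s / t) *\<^sub>R z + (s / t) *\<^sub>R (z + t *\<^sub>R v)"
    by (simp add: scaleR_add_right scaleR_diff_left)
  also have "\<dots> \<in> {z. inner_pt I x z}"
    by (rule convexD_alt[OF convex_inner_pts[OF I]]) (use assms False in \<open>simp_all add: divide_le_eq\<close>)
  finally show ?thesis by simp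
qed (use assms in simp)

text \<open>Raising the first centre enlarges its upper part and shrinks its lower part; lowering
  the second does the opposite. Since the first upper part becomes arbitrarily large before time A,
  it outweighs the initial values of the other three.\<close>

lemma upper_part_overtakes_aux:
  assumes z: "inner_pt I x0 z0" "inner_pt I x1 z1" and ab: "a > 0" "b > 0" and A: "A > 0"
    and inner: "\<And>t. 0 \<le> t \<Longrightarrow> t < A \<Longrightarrow> inner_pt I x0 (z0 + (t * a) *\<^sub>R up)"
      "\<And>t. 0 \<le> t \<Longrightarrow> t < A \<Longrightarrow> inner_pt I x1 (z1 - (t * b) *\<^sub>R up)"
    and not: "\<not> inner_pt I x0 (z0 + (A * a) *\<^sub>R up)"
  obtains t where "0 \<le> t" "t < A"
    "upper_part I (\<lambda>i. - x0 i) (- (z0 + (t * a) *\<^sub>R up)) * upper_part I x1 (z1 - (t * b) *\<^sub>R up)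
     \<le> upper_part I x0 (z0 + (t * a) *\<^sub>R up) * upper_part I (\<lambda>i. - x1 i) (- (z1 - (t * b) *\<^sub>R up))"
proof -
  define M0 where "M0 = upper_part I (\<lambda>i. - x0 i) (- z0)"
  define M1 where "M1 = upper_part I (\<lambda>i. - x1 i) (- z1)"
  define P1 where "P1 = upper_part I x1 z1"
  have pos: "M0 > 0" "M1 > 0" "P1 > 0"
    unfolding M0_def M1_def P1_def using z by (auto intro!: upper_part_pos[OF I] simp: inner_pt_uminus[OF I])
  obtain t where t: "0 \<le> t" "t < A" "upper_part I x0 (z0 + (t * a) *\<^sub>R up) \<ge> M0 * P1 / M1"
    by (rule upper_part_unbounded[OF inner(1) A ab(1) not])
  note i0 = inner(1)[OF t(1,2)] and i1 = inner(2)[OF t(1,2)]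
  have "upper_part I (\<lambda>i. - x0 i) (- (z0 + (t * a) *\<^sub>R up)) \<le> M0"
    using upper_part_mono[of "\<lambda>i. - x0 i" "- (z0 + (t * a) *\<^sub>R up)" "t * a"] i0 z ab t
    by (simp add: M0_def inner_pt_uminus[OF I] flip: minus_add_distrib)
  moreover have "upper_part I x1 (z1 - (t * b) *\<^sub>R up) \<le> P1"
    using upper_part_mono[of x1 "z1 - (t * b) *\<^sub>R up" "t * b"] i1 z ab t by (simp add: P1_def)
  ultimately have "upper_part I (\<lambda>i. - x0 i) (- (z0 + (t * a) *\<^sub>R up)) * upper_part I x1 (z1 - (t * b) *\<^sub>R up) \<le> M0 * P1"
    using upper_part_pos[OF I i1] pos by (intro mult_mono) auto
  also have "M0 * P1 = M0 * P1 / M1 * M1" using pos by simp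
  also have "\<dots> \<le> upper_part I x0 (z0 + (t * a) *\<^sub>R up) * upper_part I (\<lambda>i. - x1 i) (- (z1 - (t * b) *\<^sub>R up))"
  proof (rule mult_mono[OF t(3)])
    have "- z1 + (t * b) *\<^sub>R up = - (z1 - (t * b) *\<^sub>R up)" by simp
    then show "M1 \<le> upper_part I (\<lambda>i. - x1 i) (- (z1 - (t * b) *\<^sub>R up))"
      using upper_part_mono[of "\<lambda>i. - x1 i" "- z1" "t * b"] i1 z ab t
      unfolding M1_def by (metis inner_pt_uminus[OF I] less_imp_le mult_nonneg_nonneg)
  qed (use pos upper_part_pos[OF I i0] in auto)
  finally show ?thesis using that t by blast
qed

lemma upper_part_overtakes:
  assumes z: "inner_pt I x0 z0" "inner_pt I x1 z1" and ab: "a > 0" "b > 0"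
  obtains t where "0 \<le> t" "inner_pt I x0 (z0 + (t * a) *\<^sub>R up)" "inner_pt I x1 (z1 - (t * b) *\<^sub>R up)"
    "upper_part I (\<lambda>i. - x0 i) (- (z0 + (t * a) *\<^sub>R up)) * upper_part I x1 (z1 - (t * b) *\<^sub>R up)
     \<le> upper_part I x0 (z0 + (t * a) *\<^sub>R up) * upper_part I (\<lambda>i. - x1 i) (- (z1 - (t * b) *\<^sub>R up))"
proof -
  define ok where "ok t \<longleftrightarrow> inner_pt I x0 (z0 + (t * a) *\<^sub>R up) \<and> inner_pt I x1 (z1 - (t * b) *\<^sub>R up)" for t
  have ok0: "ok 0" using z by (simp add: ok_def)
  have down: "ok s" if "ok t" "0 \<le> s" "s \<le> t" for s t
  proof -
    have "inner_pt I x0 (z0 + s *\<^sub>R (a *\<^sub>R up))"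
      by (rule inner_ray_downward[OF z(1), of t]) (use that in \<open>auto simp: ok_def\<close>)
    moreover have "inner_pt I x1 (z1 + s *\<^sub>R (- b *\<^sub>R up))"
      by (rule inner_ray_downward[OF z(2), of t]) (use that in \<open>auto simp: ok_def\<close>)
    ultimately show ?thesis by (simp add: ok_def)
  qed
  obtain t0 where t0: "t0 \<ge> 0" "\<not> ok t0" using bounded_inner_ray[OF ab(1), of x0 z0] by (auto simp: ok_def)
  define B where "B = {t. 0 \<le> t \<and> \<not> ok t}"
  have "open {t. ok t}"
  proof -
    have "{t. ok t} = (\<lambda>t. z0 + (t * a) *\<^sub>R up) -` {z. inner_pt I x0 z} \<inter> (\<lambda>t. z1 - (t * b) *\<^sub>R up) -` {z. inner_pt I x1 z}"
      by (auto simp: ok_def)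
    then show ?thesis
      by (simp only:) (intro open_Int open_vimage open_inner_pts[OF I] continuous_intros)
  qed
  then have "closed ({0..} \<inter> - {t. ok t})" by (intro closed_Int) auto
  also have "{0..} \<inter> - {t. ok t} = B" by (auto simp: B_def)
  finally have closedB: "closed B" .
  \<comment> \<open>The first time at which one of the two centres leaves its interior; it is
    attained because the bad times form a closed set.\<close>
  define A where "A = Inf B"
  have B: "B \<noteq> {}" "bdd_below B" using t0 by (auto simp: B_def intro: bdd_belowI)
  have "A \<in> B" unfolding A_def using closedB B by (intro closed_contains_Inf)
  then have A: "A > 0" "\<not> ok A" using ok0 by (auto simp: B_def le_less)
  have okA: "ok t" if "0 \<le> t" "t < A" for t
    using cInf_lower[OF _ B(2), of t] that by (force simp: A_def B_def)
  show ?thesis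
  proof (cases "inner_pt I x0 (z0 + (A * a) *\<^sub>R up)")
    case False
    show ?thesis
      by (rule upper_part_overtakes_aux[OF z ab A(1) _ _ False])
        (use okA that in \<open>auto simp: ok_def\<close>)
  next
    case True
    \<comment> \<open>Here the second centre hits the boundary from above. Reflection in the origin
      turns its descent into an ascent and exchanges upper and lower parts, so the auxiliary lemma
      applies with the configurations in the other order.\<close>
    with A have False': "\<not> inner_pt I (\<lambda>i. - x1 i) (- z1 + (A * b) *\<^sub>R up)"
      using inner_pt_uminus[OF I, of x1 "z1 - (A * b) *\<^sub>R up"] by (simp add: ok_def)
    have in1: "inner_pt I (\<lambda>i. - x1 i) (- z1 + (t * b) *\<^sub>R up)"
      and in0: "inner_pt I (\<lambda>i. - x0 i) (- z0 - (t * a) *\<^sub>R up)" if "0 \<le> t" "t < A" for t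
      using okA[OF that] inner_pt_uminus[OF I, of x1 "z1 - (t * b) *\<^sub>R up"]
        inner_pt_uminus[OF I, of x0 "z0 + (t * a) *\<^sub>R up"] by (simp_all add: ok_def)
    have z': "inner_pt I (\<lambda>i. - x1 i) (- z1)" "inner_pt I (\<lambda>i. - x0 i) (- z0)"
      using z by (simp_all add: inner_pt_uminus[OF I])
    obtain t where t: "0 \<le> t" "t < A" and
      le: "upper_part I (\<lambda>i. - (- x1 i)) (- (- z1 + (t * b) *\<^sub>R up)) * upper_part I (\<lambda>i. - x0 i) (- z0 - (t * a) *\<^sub>R up)
     \<le> upper_part I (\<lambda>i. - x1 i) (- z1 + (t * b) *\<^sub>R up) * upper_part I (\<lambda>i. - (- x0 i)) (- (- z0 - (t * a) *\<^sub>R up))"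
      by (rule upper_part_overtakes_aux[OF z' ab(2,1) A(1) in1 in0 False'])
    show ?thesis
      by (rule that[of t]) (use t okA[OF t] le in \<open>auto simp: ok_def mult.commute add.commute\<close>)
  qed
qed

text \<open>An interior point can be pushed slightly away from the barycentre c without leaving the
  hull. Mixing the pushed point back with c gives every point a share, so all weights become
  positive.\<close>

lemma interior_positive_weights:
  assumes "inner_pt I x z"
  obtains w where "\<And>i. i \<in> I \<Longrightarrow> w i > 0" "sum w I = (1 :: real)" "z = (\<Sum>i\<in>I. w i *\<^sub>R x i)"
proof -
  let ?S = "{\<Sum>i\<in>I. v i *\<^sub>R x i | v. (\<forall>i\<in>I. v i \<ge> 0) \<and> sum v I = (1 :: real)}"
  have "convex hull (x ` I) \<subseteq> ?S"
  proof (rule hull_minimal)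
    show "x ` I \<subseteq> ?S"
    proof safe
      fix j assume "j \<in> I"
      then show "\<exists>v. x j = (\<Sum>i\<in>I. v i *\<^sub>R x i) \<and> (\<forall>i\<in>I. v i \<ge> 0) \<and> sum v I = (1 :: real)"
        using I by (intro exI[of _ "\<lambda>i. if i = j then 1 else 0"]) (auto simp: if_distrib[of "\<lambda>c. c *\<^sub>R _"] cong: if_cong)
    qed
    show "convex ?S"
      unfolding convex_alt
    proof safe
      fix v v' :: "'i \<Rightarrow> real" and t :: real
      assume *: "\<forall>i\<in>I. 0 \<le> v i" "sum v I = 1" "\<forall>i\<in>I. 0 \<le> v' i" "sum v' I = 1" "0 \<le> t" "t \<le> 1"
      show "\<exists>w. (1 - t) *\<^sub>R (\<Sum>i\<in>I. v i *\<^sub>R x i) + t *\<^sub>R (\<Sum>i\<in>I. v' i *\<^sub>R x i) = (\<Sum>i\<in>I. w i *\<^sub>R x i)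
          \<and> (\<forall>i\<in>I. 0 \<le> w i) \<and> sum w I = 1"
        using * by (intro exI[of _ "\<lambda>i. (1 - t) * v i + t * v' i"])
          (simp add: sum.distrib scaleR_sum_right scaleR_add_left sum_distrib_left[symmetric])
    qed
  qed
  moreover define c where "c = (\<Sum>i\<in>I. (1 / card I) *\<^sub>R x i)"
  obtain e where e: "e > 0" "ball z e \<subseteq> convex hull (x ` I)"
    using assms by (auto simp: inner_pt_iff_interior[OF I] mem_interior)
  \<comment> \<open>The summand 1 avoids a division by zero when z is the barycentre itself.\<close>
  define t where "t = e / (2 * (1 + norm (z - c)))"
  have t: "t > 0" using e by (simp add: t_def add_pos_nonneg)
  have "norm (t *\<^sub>R (z - c)) < e"
  proof -
    have "1 + norm (z - c) > 0" by (simp add: add_pos_nonneg)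
    then have "t * (1 + norm (z - c)) = e / 2"
      unfolding t_def by (metis less_irrefl nonzero_mult_divide_mult_cancel_right times_divide_eq_left)
    moreover have "norm (t *\<^sub>R (z - c)) \<le> t * (1 + norm (z - c))" using t by simp
    ultimately have "norm (t *\<^sub>R (z - c)) \<le> e / 2" by simp
    then show ?thesis using e by simp
  qed
  then have "z + t *\<^sub>R (z - c) \<in> ball z e" by (simp add: dist_norm)
  ultimately obtain v where v: "\<forall>i\<in>I. v i \<ge> 0" "sum v I = 1" "z + t *\<^sub>R (z - c) = (\<Sum>i\<in>I. v i *\<^sub>R x i)"
    using e by blast
  define w where "w i = (v i + t / card I) / (1 + t)" for i
  have "(1 + t) *\<^sub>R z = (\<Sum>i\<in>I. v i *\<^sub>R x i) + t *\<^sub>R c"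
    using v(3)[symmetric] by (simp add: algebra_simps)
  also have "\<dots> = (\<Sum>i\<in>I. (v i + t / card I) *\<^sub>R x i)"
    by (simp add: c_def scaleR_sum_right sum.distrib scaleR_add_left)
  also have "\<dots> = (1 + t) *\<^sub>R (\<Sum>i\<in>I. w i *\<^sub>R x i)" using t by (simp add: w_def scaleR_sum_right)
  finally have "z = (\<Sum>i\<in>I. w i *\<^sub>R x i)" using t by simp
  moreover have "sum w I = 1"
    using v(2) I t by (simp add: w_def sum_divide_distrib[symmetric] sum.distrib)
  moreover have "w i > 0" if "i \<in> I" for i
  proof -
    have "real (card I) > 0" using I by (simp add: card_gt_0_iff)
    then show ?thesis using v(1) that t by (simp add: w_def add_nonneg_pos)
  qed
  ultimately show ?thesis using that by blast
qed

text \<open>A supporting direction at the weighted mean would make all terms of a sum equal to 0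
  non-positive, hence all points collinear. Together with \<open>interior_positive_weights\<close>
  this carries an interior point of one configuration to another along fixed weights.\<close>

lemma inner_pt_positive_weights:
  assumes ne: "interior (convex hull (x ` I)) \<noteq> {}"
    and w: "\<And>i. i \<in> I \<Longrightarrow> w i > 0" "sum w I = (1 :: real)"
  shows "inner_pt I x (\<Sum>i\<in>I. w i *\<^sub>R x i)"
proof (rule ccontr)
  let ?z = "\<Sum>i\<in>I. w i *\<^sub>R x i"
  assume "\<not> inner_pt I x ?z"
  then obtain u where u: "u \<noteq> 0" "\<And>i. i \<in> I \<Longrightarrow> u \<bullet> (x i - ?z) \<le> 0" using not_inner_ptE[OF I] by blast
  have "(\<Sum>i\<in>I. w i * (u \<bullet> (x i - ?z))) = u \<bullet> ?z - sum w I * (u \<bullet> ?z)"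
    by (simp add: inner_diff_right right_diff_distrib sum_subtractf inner_sum_right sum_distrib_right)
  then have sum0: "(\<Sum>i\<in>I. - (w i * (u \<bullet> (x i - ?z)))) = 0" using w(2) by (simp add: sum_negf)
  have "- (w i * (u \<bullet> (x i - ?z))) = 0" if "i \<in> I" for i
  proof -
    have "- (w j * (u \<bullet> (x j - ?z))) \<ge> 0" if "j \<in> I" for j
      using w(1)[OF that] u(2)[OF that] by (simp add: mult_nonneg_nonpos)
    then show ?thesis using sum_nonneg_eq_0_iff[OF I(1), of "\<lambda>j. - (w j * (u \<bullet> (x j - ?z)))"] sum0 that by blast
  qed
  note zero = this
  have const: "u \<bullet> x i = u \<bullet> ?z" if "i \<in> I" for i
    using zero[OF that] w(1)[OF that] by (simp add: inner_diff_right)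
  obtain y where y: "inner_pt I x y" using ne by (auto simp: inner_pt_iff_interior[OF I])
  obtain i where "i \<in> I" "supp_at I x y u = u \<bullet> (x i - y)" by (rule supp_at_attained[OF I])
  moreover obtain j where "j \<in> I" "supp_at I x y (- u) = (- u) \<bullet> (x j - y)" by (rule supp_at_attained[OF I])
  ultimately show False
    using inner_pt_pos[OF I y, of u] inner_pt_pos[OF I y, of "- u"] u(1) const
    by (simp add: inner_diff_right)
qed

text \<open>Moving \<open>z\<^sub>0\<close> up and \<open>z\<^sub>1\<close> down in the proportion that fixes \<open>z\<close>, the intermediate value
  theorem makes the ratio of the upper and the lower part of the polar the same for both
  configurations. Only then do the harmonic bounds for the two parts add up.\<close>

lemma polar_area_harmonic:
  assumes ne: "interior (convex hull (x0 ` I)) \<noteq> {}" "interior (convex hull (x1 ` I)) \<noteq> {}"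
    and l: "0 < l" "l < 1" and z: "inner_pt I x z"
    and x: "\<And>i. i \<in> I \<Longrightarrow> x i = (1 - l) *\<^sub>R x0 i + l *\<^sub>R x1 i"
    and vert: "\<And>i. i \<in> I \<Longrightarrow> x0 i $ 1 = x1 i $ 1"
  obtains z0 z1 where "inner_pt I x0 z0" "inner_pt I x1 z1"
    "1 / polar_area I x z \<le> (1 - l) / polar_area I x0 z0 + l / polar_area I x1 z1"
proof -
  obtain w where w: "\<And>i. i \<in> I \<Longrightarrow> w i > 0" "sum w I = (1 :: real)" "z = (\<Sum>i\<in>I. w i *\<^sub>R x i)"
    using interior_positive_weights[OF z] by blast
  \<comment> \<open>Weights taken from z produce interior centres at both ends that interpolate to z
    and lie on a common vertical line.\<close>
  define y0 where "y0 = (\<Sum>i\<in>I. w i *\<^sub>R x0 i)"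
  define y1 where "y1 = (\<Sum>i\<in>I. w i *\<^sub>R x1 i)"
  have y: "inner_pt I x0 y0" "inner_pt I x1 y1"
    unfolding y0_def y1_def using w ne by (auto intro: inner_pt_positive_weights)
  have zy: "z = (1 - l) *\<^sub>R y0 + l *\<^sub>R y1"
    unfolding y0_def y1_def w(3)
    by (simp add: x scaleR_sum_right sum.distrib[symmetric] scaleR_add_right mult.commute)
  have y_vert: "y0 $ 1 = y1 $ 1" using vert by (simp add: y0_def y1_def)
  define Z0 where "Z0 t = y0 + (t * l) *\<^sub>R up" for t
  define Z1 where "Z1 t = y1 - (t * (1 - l)) *\<^sub>R up" for t
  define P0 where "P0 t = upper_part I x0 (Z0 t)" for t
  define P1 where "P1 t = upper_part I x1 (Z1 t)" for t
  define Q0 where "Q0 t = upper_part I (\<lambda>i. - x0 i) (- Z0 t)" for t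
  define Q1 where "Q1 t = upper_part I (\<lambda>i. - x1 i) (- Z1 t)" for t
  define S where "S = {t. inner_pt I x0 (Z0 t) \<and> inner_pt I x1 (Z1 t)}"
  obtain a where a: "a \<ge> 0" "a \<in> S" "Q0 a * P1 a \<le> P0 a * Q1 a"
    using upper_part_overtakes[OF y, of l "1 - l"] l
    unfolding S_def P0_def P1_def Q0_def Q1_def Z0_def Z1_def by auto
  \<comment> \<open>The configurations exchanged: the second centre now rises and the first one
    descends, which is the same one-parameter movement run backwards, hence the opposite sign of
    R.\<close>
  obtain b where b: "b \<ge> 0" "- b \<in> S" "Q1 (- b) * P0 (- b) \<le> P1 (- b) * Q0 (- b)"
    using upper_part_overtakes[OF y(2,1), of "1 - l" l] l
    unfolding S_def P0_def P1_def Q0_def Q1_def Z0_def Z1_def by auto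
  have conv: "convex S"
    unfolding convex_alt
  proof safe
    fix s t r :: real assume st: "s \<in> S" "t \<in> S" "0 \<le> r" "r \<le> 1"
    have "Z0 ((1 - r) *\<^sub>R s + r *\<^sub>R t) = (1 - r) *\<^sub>R Z0 s + r *\<^sub>R Z0 t"
      "Z1 ((1 - r) *\<^sub>R s + r *\<^sub>R t) = (1 - r) *\<^sub>R Z1 s + r *\<^sub>R Z1 t"
      by (rule vec2_eqI; simp add: Z0_def Z1_def algebra_simps)+
    moreover have "(1 - r) *\<^sub>R Z0 s + r *\<^sub>R Z0 t \<in> {z. inner_pt I x0 z}"
      by (rule convexD_alt[OF convex_inner_pts[OF I]]) (use st in \<open>auto simp: S_def\<close>)
    moreover have "(1 - r) *\<^sub>R Z1 s + r *\<^sub>R Z1 t \<in> {z. inner_pt I x1 z}"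
      by (rule convexD_alt[OF convex_inner_pts[OF I]]) (use st in \<open>auto simp: S_def\<close>)
    ultimately show "(1 - r) *\<^sub>R s + r *\<^sub>R t \<in> S" by (simp add: S_def)
  qed
  have seg: "{- b..a} \<subseteq> S"
    using conv a b closed_segment_subset[of "- b" S a] closed_segment_eq_real_ivl[of "- b" a] by auto
  have cont: "continuous_on S P0" "continuous_on S P1" "continuous_on S Q0" "continuous_on S Q1"
    unfolding P0_def P1_def Q0_def Q1_def
    by (rule continuous_on_compose2[OF continuous_on_upper_part[OF I]];
        auto simp: S_def Z0_def Z1_def inner_pt_uminus[OF I] intro!: continuous_intros
          simp del: minus_add_distrib minus_diff_eq)+
  define R where "R t = P0 t * Q1 t - Q0 t * P1 t" for t
  have "continuous_on {- b..a} R"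
    unfolding R_def using seg by (intro continuous_intros continuous_on_subset[OF cont(1)]
      continuous_on_subset[OF cont(2)] continuous_on_subset[OF cont(3)] continuous_on_subset[OF cont(4)]) auto
  moreover have "R (- b) \<le> 0" "0 \<le> R a" using a b by (simp_all add: R_def mult.commute)
  ultimately obtain t where t: "t \<in> {- b..a}" "R t = 0"
    using IVT'[of R "- b" 0 a] a b by auto
  then have tS: "t \<in> S" using seg by blast
  have zZ: "z = (1 - l) *\<^sub>R Z0 t + l *\<^sub>R Z1 t"
    unfolding zy Z0_def Z1_def by (rule vec2_eqI) (simp_all add: algebra_simps)
  have i: "inner_pt I x0 (Z0 t)" "inner_pt I x1 (Z1 t)" using tS by (auto simp: S_def)
  have Zv: "Z0 t $ 1 = Z1 t $ 1" using y_vert by (simp add: Z0_def Z1_def)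
  have P: "1 / ((1 - l) / P0 t + l / P1 t) \<le> upper_part I x z"
    unfolding P0_def P1_def by (rule upper_part_harmonic[OF i z l x zZ vert Zv])
  have Q: "1 / ((1 - l) / Q0 t + l / Q1 t) \<le> upper_part I (\<lambda>i. - x i) (- z)"
    unfolding Q0_def Q1_def
  proof (rule upper_part_harmonic[OF iffD2[OF inner_pt_uminus[OF I] i(1)]
        iffD2[OF inner_pt_uminus[OF I] i(2)] iffD2[OF inner_pt_uminus[OF I] z] l])
    show "- x i = (1 - l) *\<^sub>R (- x0 i) + l *\<^sub>R (- x1 i)" if "i \<in> I" for i
      using x[OF that] by simp
    show "- z = (1 - l) *\<^sub>R (- Z0 t) + l *\<^sub>R (- Z1 t)"
      by (subst zZ) simp
  qed (simp_all add: vert Zv)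
  have pos: "P0 t > 0" "P1 t > 0" "Q0 t > 0" "Q1 t > 0"
    unfolding P0_def P1_def Q0_def Q1_def using i by (auto intro!: upper_part_pos[OF I] simp: inner_pt_uminus[OF I])
  have "1 / (upper_part I x z + upper_part I (\<lambda>i. - x i) (- z))
     \<le> (1 - l) / (P0 t + Q0 t) + l / (P1 t + Q1 t)"
    by (rule harmonic_sum[OF pos l P Q]) (use t in \<open>simp add: R_def\<close>)
  then have "1 / polar_area I x z \<le> (1 - l) / polar_area I x0 (Z0 t) + l / polar_area I x1 (Z1 t)"
  proof -
    assume "1 / (upper_part I x z + upper_part I (\<lambda>i. - x i) (- z))
      \<le> (1 - l) / (P0 t + Q0 t) + l / (P1 t + Q1 t)"
    moreover have "c / (a / 2) = 2 * (c / a)" for a c :: real by simp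
    ultimately show ?thesis
      unfolding polar_area_def P0_def P1_def Q0_def Q1_def by (simp only:)
  qed
  then show ?thesis using that i by blast
qed

end

section \<open>Powers of the minimal polar area\<close>

lemma min_polar_cong: "(\<And>i. i \<in> I \<Longrightarrow> x i = y i) \<Longrightarrow> min_polar I x = min_polar I y"
  unfolding min_polar_def polar_pts_def by simp

text \<open>The polar area is continuous on the open set of interior centres, so points of a dense
  set come arbitrarily close to the minimum. One countable set for all configurations makes
  \<open>min_polar\<close> a countable infimum of measurable functions.\<close>

lemma min_polar_countable:
  obtains D :: "(real ^ 2) set" where "countable D"
    "\<And>(I :: 'i set) x. finite I \<Longrightarrow> I \<noteq> {} \<Longrightarrow> min_polar I x = (INF z\<in>D. emeasure lborel (polar_pts I x z))"
proof -
  obtain D :: "(real ^ 2) set" where D: "countable D" "\<And>X. open X \<Longrightarrow> X \<noteq> {} \<Longrightarrow> \<exists>d\<in>D. d \<in> X"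
    using countable_dense_exists by blast
  have "min_polar I x = (INF z\<in>D. emeasure lborel (polar_pts I x z))" if I: "finite I" "I \<noteq> {}" for I :: "'i set" and x
  proof (rule antisym)
    show "min_polar I x \<le> (INF z\<in>D. emeasure lborel (polar_pts I x z))"
      unfolding min_polar_def by (intro INF_superset_mono) auto
    show "(INF z\<in>D. emeasure lborel (polar_pts I x z)) \<le> min_polar I x"
    proof (cases "interior (convex hull (x ` I)) = {}")
      case True
      then have "emeasure lborel (polar_pts I x z) = \<infinity>" for z
        by (intro emeasure_polar_infinite[OF I]) (simp add: inner_pt_iff_interior[OF I])
      then have "min_polar I x = \<infinity>" by (simp add: min_polar_def)
      then show ?thesis by simp
    next
      case False
      obtain s where s: "inner_pt I x s" "min_polar I x = ennreal (polar_area I x s)"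
        by (rule santalo_polar_convex_hull[OF I False])
      show ?thesis
      proof (rule ennreal_le_epsilon)
        fix e :: real assume e: "e > 0"
        let ?X = "{z. inner_pt I x z} \<inter> polar_area I x -` {..<polar_area I x s + e}"
        have "open ?X"
          by (intro continuous_open_preimage continuous_on_polar_area[OF I] open_inner_pts[OF I]) auto
        moreover have "s \<in> ?X" using s e by simp
        ultimately obtain d where d: "d \<in> D" "inner_pt I x d" "polar_area I x d < polar_area I x s + e"
          using D(2)[of ?X] by blast
        have "(INF z\<in>D. emeasure lborel (polar_pts I x z)) \<le> ennreal (polar_area I x d)"
          using d by (intro INF_lower2[of d]) (auto simp: emeasure_polar_pts[OF I])
        also have "\<dots> \<le> ennreal (polar_area I x s + e)" using d by (intro ennreal_leI) simp
        also have "\<dots> = min_polar I x + ennreal e"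
          using s e polar_area_pos[OF I s(1)] by (simp add: ennreal_plus)
        finally show "(INF z\<in>D. emeasure lborel (polar_pts I x z)) \<le> min_polar I x + ennreal e" .
      qed
    qed
  qed
  with D(1) show ?thesis using that by blast
qed

lemma min_polar_measurable:
  assumes I: "finite (I :: 'i set)" "I \<noteq> {}"
  shows "min_polar I \<in> borel_measurable (PiM I (\<lambda>_. borel))"
proof -
  obtain D :: "(real ^ 2) set" where D: "countable D"
    "\<And>(I :: 'i set) x. finite I \<Longrightarrow> I \<noteq> {} \<Longrightarrow> min_polar I x = (INF z\<in>D. emeasure lborel (polar_pts I x z))"
    using min_polar_countable by blast
  have [measurable]: "(\<lambda>x. emeasure lborel (polar_pts I x z)) \<in> borel_measurable (PiM I (\<lambda>_. borel))" for z
  proof -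
    have "(\<lambda>p. indicator (polar_pts I (fst p) z) (snd p) :: ennreal) = (\<lambda>p. if \<forall>i\<in>I. snd p \<bullet> (fst p i - z) \<le> 1 then 1 else 0)"
      by (auto simp: polar_pts_def indicator_def)
    also have "\<dots> \<in> borel_measurable (PiM I (\<lambda>_. borel) \<Otimes>\<^sub>M lborel)"
      using I(1) by measurable
    finally have "(\<lambda>x. \<integral>\<^sup>+ u. indicator (polar_pts I x z) u \<partial>lborel) \<in> borel_measurable (PiM I (\<lambda>_. borel))"
      by (intro lborel.borel_measurable_nn_integral) (simp add: case_prod_beta')
    then show ?thesis by simp
  qed
  have "min_polar I = (\<lambda>x. INF z\<in>D. emeasure lborel (polar_pts I x z))"
    using D(2)[OF I] by auto
  also have "\<dots> \<in> borel_measurable (PiM I (\<lambda>_. borel))"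
    using D(1) by (intro borel_measurable_INF) auto
  finally show ?thesis .
qed

lemma frame_inverse:
  assumes "cross2 p q \<noteq> 0"
  obtains c' p' q' where "\<And>x. frame c' p' q' (frame c p q x) = x" "\<And>y. frame c p q (frame c' p' q' y) = y"
    "cross2 p' q' \<noteq> 0"
proof -
  define k where "k = cross2 p q"
  define p' where "p' = vec2 (q $ 2 / k) (- p $ 2 / k)"
  define q' where "q' = vec2 (- q $ 1 / k) (p $ 1 / k)"
  define c' where "c' = - (c $ 1 *\<^sub>R p' + c $ 2 *\<^sub>R q')"
  have k: "k \<noteq> 0" "k = p $ 1 * q $ 2 - p $ 2 * q $ 1" using assms by (simp_all add: k_def cross2_def)
  have 1: "frame c' p' q' (frame c p q x) = x" for x
  proof (rule vec2_eqI)
    have "(frame c' p' q' (frame c p q x)) $ 1 = x $ 1 * (p $ 1 * q $ 2 - p $ 2 * q $ 1) / k"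
      by (simp add: frame_def c'_def p'_def q'_def diff_divide_distrib[symmetric] add_divide_distrib[symmetric] algebra_simps)
    then show "(frame c' p' q' (frame c p q x)) $ 1 = x $ 1" using k by simp
    have "(frame c' p' q' (frame c p q x)) $ 2 = x $ 2 * (p $ 1 * q $ 2 - p $ 2 * q $ 1) / k"
      by (simp add: frame_def c'_def p'_def q'_def diff_divide_distrib[symmetric] add_divide_distrib[symmetric] algebra_simps)
    then show "(frame c' p' q' (frame c p q x)) $ 2 = x $ 2" using k by simp
  qed
  have 2: "frame c p q (frame c' p' q' y) = y" for y
  proof (rule vec2_eqI)
    have "(frame c p q (frame c' p' q' y)) $ 1 = c $ 1 + (y $ 1 - c $ 1) * (p $ 1 * q $ 2 - p $ 2 * q $ 1) / k"
      by (simp add: frame_def c'_def p'_def q'_def diff_divide_distrib[symmetric] add_divide_distrib[symmetric] algebra_simps)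
    then show "(frame c p q (frame c' p' q' y)) $ 1 = y $ 1" using k by simp
    have "(frame c p q (frame c' p' q' y)) $ 2 = c $ 2 + (y $ 2 - c $ 2) * (p $ 1 * q $ 2 - p $ 2 * q $ 1) / k"
      by (simp add: frame_def c'_def p'_def q'_def diff_divide_distrib[symmetric] add_divide_distrib[symmetric] algebra_simps)
    then show "(frame c p q (frame c' p' q' y)) $ 2 = y $ 2" using k by simp
  qed
  have "cross2 p' q' = (p $ 1 * q $ 2 - p $ 2 * q $ 1) / (k * k)"
    by (simp add: cross2_def p'_def q'_def diff_divide_distrib[symmetric] algebra_simps)
  then have "cross2 p' q' \<noteq> 0" using k by simp
  with 1 2 show ?thesis using that by blast
qed

lemma min_polar_frame:
  assumes pq: "cross2 p q \<noteq> 0"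
  shows "ennreal \<bar>cross2 p q\<bar> * min_polar I (\<lambda>i. frame c p q (x i)) = min_polar I x"
proof -
  let ?k = "\<bar>cross2 p q\<bar>"
  let ?x = "\<lambda>i. frame c p q (x i)"
  obtain c' p' q' where inv: "\<And>y. frame c p q (frame c' p' q' y) = y" using frame_inverse[OF pq] by metis
  have *: "ennreal ?k * emeasure lborel (polar_pts I ?x (frame c p q z)) = emeasure lborel (polar_pts I x z)" for z
  proof -
    \<comment> \<open>The adjoint of the linear part: it moves the affine map from the points to the
      polar variable u, where it acts as a linear substitution with the same determinant.\<close>
    let ?B = "frame 0 (vec2 (p $ 1) (q $ 1)) (vec2 (p $ 2) (q $ 2))"
    have "cross2 (vec2 (p $ 1) (q $ 1)) (vec2 (p $ 2) (q $ 2)) = cross2 p q" by (simp add: cross2_def)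
    moreover have "u \<bullet> (frame c p q y - frame c p q z) = ?B u \<bullet> (y - z)" for u y
      by (simp add: frame_def inner_vec2 algebra_simps)
    then have "indicator (polar_pts I ?x (frame c p q z)) u = (indicator (polar_pts I x z) (?B u) :: ennreal)" for u
      by (simp add: polar_pts_def indicator_def)
    ultimately have "ennreal ?k * (\<integral>\<^sup>+ u. indicator (polar_pts I ?x (frame c p q z)) u \<partial>lborel)
        = (\<integral>\<^sup>+ u. indicator (polar_pts I x z) u \<partial>lborel)"
      using pq nn_integral_frame[of "indicator (polar_pts I x z)" "vec2 (p $ 1) (q $ 1)" "vec2 (p $ 2) (q $ 2)" 0] by simp
    then show ?thesis by simp
  qed
  have k: "ennreal (1 / ?k) * ennreal ?k = 1" using pq by (subst ennreal_mult[symmetric]) auto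
  show ?thesis
  proof (rule antisym)
    show "ennreal ?k * min_polar I ?x \<le> min_polar I x"
      unfolding min_polar_def *[symmetric] by (intro INF_greatest mult_left_mono INF_lower) auto
    have "ennreal (1 / ?k) * min_polar I x \<le> emeasure lborel (polar_pts I ?x w)" for w
    proof -
      have "ennreal (1 / ?k) * min_polar I x \<le> ennreal (1 / ?k) * emeasure lborel (polar_pts I x (frame c' p' q' w))"
        unfolding min_polar_def by (intro mult_left_mono INF_lower) auto
      also have "\<dots> = emeasure lborel (polar_pts I ?x w)"
        by (simp add: *[symmetric] inv k mult.assoc[symmetric])
      finally show ?thesis .
    qed
    then have "ennreal (1 / ?k) * min_polar I x \<le> min_polar I ?x"
      unfolding min_polar_def by (intro INF_greatest) (simp add: min_polar_def)
    then have "ennreal ?k * (ennreal (1 / ?k) * min_polar I x) \<le> ennreal ?k * min_polar I ?x"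
      by (intro mult_left_mono) auto
    then show "min_polar I x \<le> ennreal ?k * min_polar I ?x"
      by (metis k mult.assoc mult.commute mult_1)
  qed
qed

text \<open>In the degenerate case \<open>min_polar I x = \<infinity>\<close> the value is \<open>0\<close>, because \<open>enn2real \<infinity> = 0\<close>
  and \<open>1 / 0 = 0\<close>.\<close>

definition polar_power :: "real \<Rightarrow> 'i set \<Rightarrow> ('i \<Rightarrow> real ^ 2) \<Rightarrow> ennreal" where
  "polar_power r I x = ennreal ((1 / enn2real (min_polar I x)) powr r)"

lemma polar_power_cong: "(\<And>i. i \<in> I \<Longrightarrow> x i = y i) \<Longrightarrow> polar_power r I x = polar_power r I y"
  unfolding polar_power_def using min_polar_cong[of I x y] by simp

lemma polar_power_measurable [measurable]:
  assumes "finite I" "I \<noteq> {}"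
  shows "polar_power r I \<in> borel_measurable (PiM I (\<lambda>_. borel))"
  using min_polar_measurable[OF assms] unfolding polar_power_def by measurable

lemma polar_power_frame:
  assumes "cross2 p q \<noteq> 0"
  shows "polar_power r I (\<lambda>i. frame c p q (x i)) = ennreal (\<bar>cross2 p q\<bar> powr r) * polar_power r I x"
proof -
  have "enn2real (min_polar I x) = \<bar>cross2 p q\<bar> * enn2real (min_polar I (\<lambda>i. frame c p q (x i)))"
    by (simp add: min_polar_frame[OF assms, symmetric, of I x c] enn2real_mult)
  then have "1 / enn2real (min_polar I (\<lambda>i. frame c p q (x i))) = \<bar>cross2 p q\<bar> * (1 / enn2real (min_polar I x))"
    using assms by simp
  then have "(1 / enn2real (min_polar I (\<lambda>i. frame c p q (x i)))) powr r
      = \<bar>cross2 p q\<bar> powr r * (1 / enn2real (min_polar I x)) powr r"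
    by (simp only:) (rule powr_mult; simp)
  then show ?thesis unfolding polar_power_def by (simp only: ennreal_mult powr_ge_zero)
qed

lemma santalo_polar_power:
  assumes "finite I" "I \<noteq> {}" "interior (convex hull (x ` I)) \<noteq> {}"
  shows "ennreal (area (santalo_polar (convex hull (x ` I))) powr - r) = polar_power r I x"
proof -
  obtain s where s: "inner_pt I x s" "area (santalo_polar (convex hull (x ` I))) = polar_area I x s"
    "min_polar I x = ennreal (polar_area I x s)"
    by (rule santalo_polar_convex_hull[OF assms])
  then show ?thesis using polar_area_pos[OF assms(1,2) s(1)]
    by (simp add: polar_power_def powr_minus_divide powr_divide)
qed

lemma powr_convex_combination:
  fixes a b l r :: real
  assumes "a > 0" "b > 0" "0 < l" "l < 1" "r \<ge> 1"
  shows "((1 - l) * a + l * b) powr r \<le> (1 - l) * a powr r + l * b powr r"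
  using convex_onD[OF powr_convex[OF assms(5)], of l a b] assms by simp

text \<open>The harmonic bound is applied at the Santalo point of the middle configuration. At the
  ends, passing to the minimal areas increases the reciprocals, and for \<open>r \<ge> 1\<close> the
  power is monotone and convex.\<close>

lemma polar_power_shadow:
  assumes I: "finite I" "I \<noteq> {}" and r: "r \<ge> 1"
    and ne: "interior (convex hull (x0 ` I)) \<noteq> {}" "interior (convex hull (x1 ` I)) \<noteq> {}"
      "interior (convex hull (x ` I)) \<noteq> {}"
    and l: "0 < l" "l < 1"
    and x: "\<And>i. i \<in> I \<Longrightarrow> x i = (1 - l) *\<^sub>R x0 i + l *\<^sub>R x1 i"
    and vert: "\<And>i. i \<in> I \<Longrightarrow> x0 i $ 1 = x1 i $ 1"
  shows "polar_power r I x \<le> ennreal (1 - l) * polar_power r I x0 + ennreal l * polar_power r I x1"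
proof -
  obtain s where s: "inner_pt I x s" "min_polar I x = ennreal (polar_area I x s)"
    by (rule santalo_polar_convex_hull[OF I ne(3)])
  obtain s0 where s0: "inner_pt I x0 s0" "\<And>z. inner_pt I x0 z \<Longrightarrow> polar_area I x0 s0 \<le> polar_area I x0 z"
    "area (santalo_polar (convex hull (x0 ` I))) = polar_area I x0 s0"
    "min_polar I x0 = ennreal (polar_area I x0 s0)"
    by (rule santalo_polar_convex_hull[OF I ne(1)]) (rule that; simp)
  obtain s1 where s1: "inner_pt I x1 s1" "\<And>z. inner_pt I x1 z \<Longrightarrow> polar_area I x1 s1 \<le> polar_area I x1 z"
    "area (santalo_polar (convex hull (x1 ` I))) = polar_area I x1 s1"
    "min_polar I x1 = ennreal (polar_area I x1 s1)"
    by (rule santalo_polar_convex_hull[OF I ne(2)]) (rule that; simp)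
  define a where "a = polar_area I x s"
  define a0 where "a0 = polar_area I x0 s0"
  define a1 where "a1 = polar_area I x1 s1"
  have pos: "a > 0" "a0 > 0" "a1 > 0"
    using polar_area_pos[OF I] s s0 s1 by (auto simp: a_def a0_def a1_def)
  obtain z0 z1 where z: "inner_pt I x0 z0" "inner_pt I x1 z1"
    "1 / a \<le> (1 - l) / polar_area I x0 z0 + l / polar_area I x1 z1"
    unfolding a_def by (rule polar_area_harmonic[OF I ne(1,2) l s(1) x vert])
  note z(3)
  also have "(1 - l) / polar_area I x0 z0 + l / polar_area I x1 z1 \<le> (1 - l) / a0 + l / a1"
    using pos z s0 s1 l by (intro add_mono divide_left_mono mult_pos_pos) (auto simp: a0_def a1_def polar_area_pos[OF I])
  finally have "(1 / a) powr r \<le> ((1 - l) * (1 / a0) + l * (1 / a1)) powr r"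
    using pos r by (intro powr_mono2) auto
  also have "\<dots> \<le> (1 - l) * (1 / a0) powr r + l * (1 / a1) powr r"
    using pos l r by (intro powr_convex_combination) auto
  finally have "ennreal ((1 / a) powr r) \<le> ennreal ((1 - l) * (1 / a0) powr r + l * (1 / a1) powr r)"
    by (rule ennreal_leI)
  also have "\<dots> = ennreal (1 - l) * ennreal ((1 / a0) powr r) + ennreal l * ennreal ((1 / a1) powr r)"
    using l by (simp add: ennreal_plus ennreal_mult)
  finally show ?thesis
    using pos s(2) s0(4) s1(4) by (simp add: polar_power_def a_def a0_def a1_def)
qed

section \<open>Expectations over independent uniform points\<close>

abbreviation unif :: "(real ^ 2) set \<Rightarrow> (real ^ 2) measure" where
  "unif K \<equiv> uniform_measure lborel K"

definition mean_power :: "real \<Rightarrow> 'i set \<Rightarrow> (real ^ 2) set \<Rightarrow> ennreal" where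
  "mean_power r I K = (\<integral>\<^sup>+ x. polar_power r I x \<partial>PiM I (\<lambda>_. unif K))"

text \<open>The sets whose uniform measure is a probability measure.\<close>

definition fat :: "(real ^ 2) set \<Rightarrow> bool" where
  "fat K \<longleftrightarrow> K \<in> sets borel \<and> emeasure lborel K \<noteq> 0 \<and> emeasure lborel K \<noteq> \<infinity>"

lemma prob_space_unif: "fat K \<Longrightarrow> prob_space (unif K)"
  by (intro prob_space_uniform_measure) (auto simp: fat_def)

lemma measurable_PiM_unif:
  "f \<in> borel_measurable (PiM I (\<lambda>_. unif K)) \<longleftrightarrow> f \<in> borel_measurable (PiM I (\<lambda>_. borel))"
  by (intro arg_cong[where f = "\<lambda>M. f \<in> M"] measurable_cong_sets sets_PiM_cong) auto

text \<open>Serves both affine maps, with c the absolute value of the determinant, and the piecewise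
  linear shears, with c = 1. A constant factor cancels in the normalisation, so uniform laws are
  carried to uniform laws.\<close>

locale area_scaling =
  fixes T S :: "real ^ 2 \<Rightarrow> real ^ 2" and c :: real
  assumes T [measurable]: "T \<in> borel_measurable borel" and S [measurable]: "S \<in> borel_measurable borel"
    and ST: "\<And>x. S (T x) = x" and TS: "\<And>x. T (S x) = x"
    and c: "c > 0"
    and scale: "\<And>A. A \<in> sets borel \<Longrightarrow> emeasure lborel (T ` A) = ennreal c * emeasure lborel A"
begin

lemma image_eq: "T ` A = S -` A"
  by (auto simp: ST) (metis TS imageI)

lemma image_borel: "A \<in> sets borel \<Longrightarrow> T ` A \<in> sets borel"
  unfolding image_eq using measurable_sets[OF S, of A] by simp

lemma fat_image: "fat K \<Longrightarrow> fat (T ` K)"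
  using c by (auto simp: fat_def image_borel scale ennreal_mult_eq_top_iff)

lemma distr_unif:
  assumes "fat K"
  shows "distr (unif K) (unif (T ` K)) T = unif (T ` K)"
proof (rule measure_eqI)
  fix A assume "A \<in> sets (distr (unif K) (unif (T ` K)) T)"
  then have A [measurable]: "A \<in> sets borel" by simp
  have K [measurable]: "K \<in> sets borel" using assms by (simp add: fat_def)
  have TK: "T ` K \<in> sets borel" by (rule image_borel) simp
  have TA: "T -` A \<in> sets borel" using measurable_sets[OF T, of A] by simp
  have "T ` K \<inter> A = T ` (K \<inter> T -` A)" by auto
  then have "emeasure lborel (T ` K \<inter> A) = ennreal c * emeasure lborel (K \<inter> T -` A)"
    using TA by (simp add: scale)
  then have "emeasure (unif (T ` K)) A = (ennreal c * emeasure lborel (K \<inter> T -` A)) / (ennreal c * emeasure lborel K)"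
    using TK by (simp add: scale)
  also have "\<dots> = emeasure lborel (K \<inter> T -` A) / emeasure lborel K"
    using c by (simp add: divide_mult_eq mult.commute[of "ennreal c"])
  also have "\<dots> = emeasure (distr (unif K) (unif (T ` K)) T) A"
    using TA by (subst emeasure_distr) auto
  finally show "emeasure (distr (unif K) (unif (T ` K)) T) A = emeasure (unif (T ` K)) A" by simp
qed simp

lemma PiM_unif_image:
  assumes "finite I" "fat K"
  shows "PiM I (\<lambda>_. unif (T ` K)) = distr (PiM I (\<lambda>_. unif K)) (PiM I (\<lambda>_. unif (T ` K))) (compose I T)"
  using distr_PiM_finite_prob_space'[of I "\<lambda>_. unif K" "\<lambda>_. unif (T ` K)" T] assms fat_image
  by (simp add: prob_space_unif distr_unif)

lemma compose_measurable:
  "compose I T \<in> measurable (PiM I (\<lambda>_. unif K)) (PiM I (\<lambda>_. unif (T ` K)))"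
  unfolding compose_def by (rule measurable_restrict) measurable

lemma mean_power_image:
  assumes I: "finite I" "I \<noteq> {}" and K: "fat K"
  shows "mean_power r I (T ` K) = (\<integral>\<^sup>+ x. polar_power r I (\<lambda>i. T (x i)) \<partial>PiM I (\<lambda>_. unif K))"
proof -
  have "mean_power r I (T ` K) = (\<integral>\<^sup>+ x. polar_power r I (compose I T x) \<partial>PiM I (\<lambda>_. unif K))"
    unfolding mean_power_def using polar_power_measurable[OF I]
    by (subst PiM_unif_image[OF I(1) K], subst nn_integral_distr) (auto simp: compose_measurable measurable_PiM_unif)
  then show ?thesis
    using polar_power_cong[of I "compose I T _" "\<lambda>i. T (_ i)"]
    by (simp add: compose_def cong: polar_power_cong)
qed

lemma AE_PiM_unif_image:
  assumes I: "finite I" and K: "fat K" and "AE x in PiM I (\<lambda>_. unif (T ` K)). P x"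
  shows "AE x in PiM I (\<lambda>_. unif K). P (compose I T x)"
  using assms(3) by (subst (asm) PiM_unif_image[OF I K]) (rule AE_distrD[OF compose_measurable])

end

lemma emeasure_image_frame:
  assumes "cross2 p q \<noteq> 0" "A \<in> sets borel"
  shows "emeasure lborel (frame c p q ` A) = ennreal \<bar>cross2 p q\<bar> * emeasure lborel A"
proof -
  obtain c' p' q' where inv: "\<And>x. frame c' p' q' (frame c p q x) = x" "\<And>y. frame c p q (frame c' p' q' y) = y"
    using frame_inverse[OF assms(1)] by metis
  have eq: "frame c p q ` A = frame c' p' q' -` A" using inv by (auto simp: inv) (metis inv(2) imageI)
  then have meas: "frame c p q ` A \<in> sets borel"
    using measurable_sets[OF frame_measurable assms(2), of c' p' q'] by simp
  have ind: "indicator (frame c p q ` A) (frame c p q x) = (indicator A x :: ennreal)" for x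
    by (simp add: eq inv indicator_def)
  have "ennreal \<bar>cross2 p q\<bar> * (\<integral>\<^sup>+ x. indicator (frame c p q ` A) (frame c p q x) \<partial>lborel)
      = (\<integral>\<^sup>+ x. indicator (frame c p q ` A) x \<partial>lborel)"
    using meas by (intro nn_integral_frame assms) auto
  also have "\<dots> = emeasure lborel (frame c p q ` A)" using meas by simp
  finally show ?thesis using assms(2) by (simp add: ind)
qed

lemma mean_power_frame:
  assumes pq: "cross2 p q \<noteq> 0" and I: "finite I" "I \<noteq> {}" and K: "fat K"
  shows "fat (frame c p q ` K)"
    and "mean_power r I (frame c p q ` K) = ennreal (\<bar>cross2 p q\<bar> powr r) * mean_power r I K"
proof -
  obtain c' p' q' where inv: "\<And>x. frame c' p' q' (frame c p q x) = x" "\<And>y. frame c p q (frame c' p' q' y) = y"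
    using frame_inverse[OF pq] by metis
  interpret area_scaling "frame c p q" "frame c' p' q'" "\<bar>cross2 p q\<bar>"
    using inv pq by unfold_locales (auto simp: emeasure_image_frame)
  show "fat (frame c p q ` K)" by (rule fat_image[OF K])
  show "mean_power r I (frame c p q ` K) = ennreal (\<bar>cross2 p q\<bar> powr r) * mean_power r I K"
    unfolding mean_power_image[OF I K] polar_power_frame[OF pq] unfolding mean_power_def
    using polar_power_measurable[OF I] by (intro nn_integral_cmult) (simp add: measurable_PiM_unif)
qed

text \<open>The movement of a polygon in normalised position: fixed left of the vertical axis and
  sheared right of it. A point moves with the constant vertical speed
  \<open>max 0 (y $ 1)\<close>.\<close>

definition half_shear :: "real \<Rightarrow> real ^ 2 \<Rightarrow> real ^ 2" where
  "half_shear t y = vec2 (y $ 1) (y $ 2 + t * max 0 (y $ 1))"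

lemma half_shear_inverse: "half_shear (- t) (half_shear t y) = y" "half_shear t (half_shear (- t) y) = y"
  by (rule vec2_eqI; simp add: half_shear_def)+

lemma half_shear_measurable [measurable]: "half_shear t \<in> borel_measurable borel"
  unfolding half_shear_def by measurable

lemma area_scaling_half_shear: "area_scaling (half_shear t) (half_shear (- t)) 1"
proof
  fix A :: "(real ^ 2) set" assume A [measurable]: "A \<in> sets borel"
  have eq: "half_shear t ` A = half_shear (- t) -` A"
    by (auto simp: half_shear_inverse) (metis half_shear_inverse(2) imageI)
  have meas [measurable]: "half_shear t ` A \<in> sets borel"
    unfolding eq using measurable_sets[OF half_shear_measurable A, of "- t"] by simp
  have "emeasure lborel (half_shear t ` A) = (\<integral>\<^sup>+ u. indicator (half_shear t ` A) u \<partial>lborel)" by simp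
  also have "\<dots> = (\<integral>\<^sup>+ u. indicator (half_shear t ` A) (vec2 ((u :: real ^ 2) $ 1) (u $ 2 + t * max 0 (u $ 1))) \<partial>lborel)"
    by (rule nn_integral_vertical_shear[symmetric]) measurable
  also have "\<dots> = (\<integral>\<^sup>+ u. indicator (half_shear t ` A) (half_shear t u) \<partial>lborel)"
    by (simp add: half_shear_def)
  also have "\<dots> = (\<integral>\<^sup>+ u. indicator A u \<partial>lborel)"
    by (intro nn_integral_cong) (simp add: eq half_shear_inverse indicator_def)
  finally show "emeasure lborel (half_shear t ` A) = ennreal 1 * emeasure lborel A" by simp
qed (simp_all add: half_shear_inverse)

section \<open>Almost sure non-degeneracy, and the mean under a half shear\<close>

lemma AE_unif_hyperplane:
  assumes "fat K" "v \<noteq> 0"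
  shows "AE w in unif K. cross2 v (w - c) \<noteq> 0"
proof -
  define a where "a = vec2 (- v $ 2) (v $ 1)"
  have "a \<noteq> 0" using assms(2) by (auto simp: a_def vec_eq_iff forall_2)
  have eq: "cross2 v (w - c) = 0 \<longleftrightarrow> a \<bullet> w = a \<bullet> c" for w
    by (auto simp: cross2_def a_def inner_vec2 algebra_simps)
  have "negligible {w. a \<bullet> w = a \<bullet> c}" using \<open>a \<noteq> 0\<close> by (intro negligible_hyperplane) auto
  then have "{w. a \<bullet> w = a \<bullet> c} \<in> null_sets lebesgue" by (simp add: negligible_iff_null_sets)
  moreover have "{w. a \<bullet> w = a \<bullet> c} \<in> sets lborel" by (simp add: closed_hyperplane borel_closed)
  ultimately have "{w. a \<bullet> w = a \<bullet> c} \<in> null_sets lborel" by (simp add: null_sets_completion_iff)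
  then have "AE w in lborel. w \<notin> {w. a \<bullet> w = a \<bullet> c}" by (rule AE_not_in)
  then have "AE w in lborel. cross2 v (w - c) \<noteq> 0" by eventually_elim (simp add: eq)
  then show ?thesis using assms(1) by (intro AE_uniform_measureI) (auto simp: fat_def elim: eventually_mono)
qed

text \<open>Fubini for a null set: one coordinate is drawn last, with the others held fixed.\<close>

lemma AE_PiM_update:
  assumes M: "\<And>i. prob_space (M i)" and I: "finite I" "i \<in> I"
    and P: "{x \<in> space (PiM I M). P x} \<in> sets (PiM I M)"
    and AE: "AE y in PiM (I - {i}) M. AE w in M i. P (y(i := w))"
  shows "AE x in PiM I M. P x"
proof -
  interpret product_sigma_finite M
    using M by (auto simp: product_sigma_finite_def intro: prob_space_imp_sigma_finite)
  have ins: "insert i (I - {i}) = I" using I by auto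
  have "{x \<in> space (PiM I M). \<not> P x} = space (PiM I M) - {x \<in> space (PiM I M). P x}" by auto
  then have N: "{x \<in> space (PiM I M). \<not> P x} \<in> sets (PiM I M)" using P by simp
  then have [measurable]: "indicator {x \<in> space (PiM I M). \<not> P x} \<in> borel_measurable (PiM I M)" by simp
  have "(\<integral>\<^sup>+ x. indicator {x \<in> space (PiM I M). \<not> P x} x \<partial>PiM (insert i (I - {i})) M)
     = (\<integral>\<^sup>+ y. \<integral>\<^sup>+ w. indicator {x \<in> space (PiM I M). \<not> P x} (y(i := w)) \<partial>M i \<partial>PiM (I - {i}) M)"
    using I by (intro product_nn_integral_insert) (simp_all add: ins del: insert_Diff_single)
  also have "\<dots> = (\<integral>\<^sup>+ y. 0 \<partial>PiM (I - {i}) M)"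
  proof (rule nn_integral_cong_AE)
    show "AE y in PiM (I - {i}) M. (\<integral>\<^sup>+ w. indicator {x \<in> space (PiM I M). \<not> P x} (y(i := w)) \<partial>M i) = 0"
      using AE
    proof eventually_elim
      case (elim y)
      have "(\<integral>\<^sup>+ w. indicator {x \<in> space (PiM I M). \<not> P x} (y(i := w)) \<partial>M i) = (\<integral>\<^sup>+ w. 0 \<partial>M i)"
        by (intro nn_integral_cong_AE) (use elim in \<open>eventually_elim, simp\<close>)
      then show ?case by simp
    qed
  qed
  finally have "emeasure (PiM I M) {x \<in> space (PiM I M). \<not> P x} = 0" using N I by (simp add: insert_absorb)
  then show ?thesis using AE_iff_null[OF N] N by (auto simp: null_sets_def)
qed

lemma interior_convex_hull_triangle:
  assumes "cross2 (b - a) (c - a) \<noteq> 0" "{a, b, c} \<subseteq> S"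
  shows "interior (convex hull S) \<noteq> {}"
proof
  assume "interior (convex hull S) = {}"
  then obtain n d where n: "n \<noteq> 0" "convex hull S \<subseteq> {x. n \<bullet> x = d}"
    using empty_interior_subset_hyperplane[OF convex_convex_hull] by metis
  have "n \<bullet> a = d" "n \<bullet> b = d" "n \<bullet> c = d"
    using n(2) assms(2) hull_subset[of S convex] by blast+
  then have eq: "n $ 1 * (b - a) $ 1 + n $ 2 * (b - a) $ 2 = 0" "n $ 1 * (c - a) $ 1 + n $ 2 * (c - a) $ 2 = 0"
    by (simp_all add: inner_vec2 algebra_simps)
  have "n $ 1 * cross2 (b - a) (c - a) = (n $ 1 * (b - a) $ 1 + n $ 2 * (b - a) $ 2) * (c - a) $ 2
      - (n $ 1 * (c - a) $ 1 + n $ 2 * (c - a) $ 2) * (b - a) $ 2"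
    "n $ 2 * cross2 (b - a) (c - a) = (n $ 1 * (c - a) $ 1 + n $ 2 * (c - a) $ 2) * (b - a) $ 1
      - (n $ 1 * (b - a) $ 1 + n $ 2 * (b - a) $ 2) * (c - a) $ 1"
    unfolding cross2_def by algebra+
  then have "n $ 1 = 0" "n $ 2 = 0" using assms(1) unfolding eq by simp_all
  with n(1) show False by (auto intro: vec2_eqI)
qed

text \<open>Three of the points suffice: almost surely the second differs from the first, and then
  the third avoids the line through them.\<close>

lemma AE_full_dimensional:
  assumes I: "finite (I :: 'i set)" "card I \<ge> 3" and K: "fat K"
  shows "AE x in PiM I (\<lambda>_. unif K). interior (convex hull (x ` I)) \<noteq> {}"
proof -
  obtain J where J: "J \<subseteq> I" "card J = 3" using I(2) by (meson obtain_subset_with_card_n)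
  then obtain i j k where ijk: "J = {i, j, k}" "i \<noteq> j" "i \<noteq> k" "j \<noteq> k" by (auto simp: card_3_iff)
  with J have mem: "i \<in> I" "j \<in> I" "k \<in> I" by auto
  note prob = prob_space_unif[OF K]
  have sets: "sets (PiM J (\<lambda>_. unif K)) = sets (PiM J (\<lambda>_. borel))" for J :: "'i set"
    by (intro sets_PiM_cong) auto
  have space: "space (PiM J (\<lambda>_. unif K)) = space (PiM J (\<lambda>_. borel))" for J :: "'i set"
    by (simp add: space_PiM)
  have "AE y in PiM (I - {k}) (\<lambda>_. unif K). norm (y j - y i) \<noteq> 0"
  proof (rule AE_PiM_update[where i = j])
    show "{x \<in> space (PiM (I - {k}) (\<lambda>_. unif K)). norm (x j - x i) \<noteq> 0} \<in> sets (PiM (I - {k}) (\<lambda>_. unif K))"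
    proof -
      have "i \<in> I - {k}" "j \<in> I - {k}" using mem ijk by auto
      then show ?thesis unfolding sets space by measurable
    qed
    have "AE w in unif K. w - c \<noteq> 0" for c
    proof -
      have "AE w in lborel. w \<noteq> c" by (rule AE_lborel_singleton)
      then have "AE w in lborel. w \<in> K \<longrightarrow> w - c \<noteq> 0" by eventually_elim simp
      then show ?thesis using K by (intro AE_uniform_measureI) (auto simp: fat_def)
    qed
    then show "AE y in PiM (I - {k} - {j}) (\<lambda>_. unif K). AE w in unif K. norm ((y(j := w)) j - (y(j := w)) i) \<noteq> 0"
      using ijk by simp
  qed (use prob mem ijk I in auto)
  then have "AE y in PiM (I - {k}) (\<lambda>_. unif K). AE w in unif K. cross2 ((y(k := w)) j - (y(k := w)) i) ((y(k := w)) k - (y(k := w)) i) \<noteq> 0"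
    by eventually_elim (use ijk AE_unif_hyperplane[OF K] in simp)
  then have "AE x in PiM I (\<lambda>_. unif K). cross2 (x j - x i) (x k - x i) \<noteq> 0"
  proof (rule AE_PiM_update[rotated -1])
    show "{x \<in> space (PiM I (\<lambda>_. unif K)). cross2 (x j - x i) (x k - x i) \<noteq> 0} \<in> sets (PiM I (\<lambda>_. unif K))"
      unfolding sets space cross2_def using mem by measurable
  qed (use prob mem I in auto)
  then show ?thesis
    by eventually_elim (rule interior_convex_hull_triangle, use mem in auto)
qed

lemma mean_power_half_shear:
  assumes I: "finite (I :: 'i set)" "card I \<ge> 3" and K: "fat K" and r: "r \<ge> 1"
    and l: "0 < l" "l < 1" and ab: "(1 - l) * a + l * b = 0"
  shows "mean_power r I K \<le> ennreal (1 - l) * mean_power r I (half_shear a ` K) + ennreal l * mean_power r I (half_shear b ` K)"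
proof -
  interpret A: area_scaling "half_shear a" "half_shear (- a)" 1 by (rule area_scaling_half_shear)
  interpret B: area_scaling "half_shear b" "half_shear (- b)" 1 by (rule area_scaling_half_shear)
  have I': "I \<noteq> {}" using I by auto
  let ?M = "PiM I (\<lambda>_. unif K)"
  have meas: "(\<lambda>x. polar_power r I (\<lambda>i. half_shear t (x i))) \<in> borel_measurable ?M" for t
  proof -
    interpret area_scaling "half_shear t" "half_shear (- t)" 1 by (rule area_scaling_half_shear)
    have "(\<lambda>x. polar_power r I (compose I (half_shear t) x)) \<in> borel_measurable ?M"
      using polar_power_measurable[OF I(1) I']
      by (intro measurable_compose[OF compose_measurable]) (simp add: measurable_PiM_unif)
    then show ?thesis by (simp add: compose_def cong: polar_power_cong)
  qed
  \<comment> \<open>The sheared samples are again uniform samples, on the sheared bodies, so their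
    hulls are almost surely non-degenerate as well.\<close>
  have ne: "AE x in ?M. interior (convex hull (x ` I)) \<noteq> {}"
    "AE x in ?M. interior (convex hull (compose I (half_shear a) x ` I)) \<noteq> {}"
    "AE x in ?M. interior (convex hull (compose I (half_shear b) x ` I)) \<noteq> {}"
    by (intro A.AE_PiM_unif_image B.AE_PiM_unif_image AE_full_dimensional I K A.fat_image B.fat_image)+
  have "mean_power r I K \<le> (\<integral>\<^sup>+ x. ennreal (1 - l) * polar_power r I (\<lambda>i. half_shear a (x i))
      + ennreal l * polar_power r I (\<lambda>i. half_shear b (x i)) \<partial>?M)"
    unfolding mean_power_def
  proof (rule nn_integral_mono_AE)
    show "AE x in ?M. polar_power r I x \<le> ennreal (1 - l) * polar_power r I (\<lambda>i. half_shear a (x i))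
      + ennreal l * polar_power r I (\<lambda>i. half_shear b (x i))"
      using ne
    proof eventually_elim
      case (elim x)
      \<comment> \<open>The weights balance the two speeds, so the sample itself lies between its
        two sheared copies, on the same vertical lines.\<close>
      have "y = (1 - l) *\<^sub>R half_shear a y + l *\<^sub>R half_shear b y" for y
      proof (rule vec2_eqI)
        have "((1 - l) *\<^sub>R half_shear a y + l *\<^sub>R half_shear b y) $ 2
            = y $ 2 + ((1 - l) * a + l * b) * max 0 (y $ 1)"
          by (simp add: half_shear_def algebra_simps)
        then show "y $ 2 = ((1 - l) *\<^sub>R half_shear a y + l *\<^sub>R half_shear b y) $ 2" using ab by simp
      qed (simp add: half_shear_def algebra_simps)
      moreover have "compose I f x ` I = (\<lambda>i. f (x i)) ` I" for f :: "real ^ 2 \<Rightarrow> real ^ 2"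
        by (auto simp: compose_def)
      ultimately show ?case using elim l
        by (intro polar_power_shadow I(1) I' r) (auto simp: half_shear_def)
    qed
  qed
  also have "\<dots> = ennreal (1 - l) * mean_power r I (half_shear a ` K) + ennreal l * mean_power r I (half_shear b ` K)"
    using meas by (simp add: nn_integral_add nn_integral_cmult A.mean_power_image[OF I(1) I' K] B.mean_power_image[OF I(1) I' K])
  finally show ?thesis .
qed

text \<open>The product law on P has a density with respect to the one on K, equal on samples inside
  P to a power of the area ratio k. Since \<open>P \<subseteq> K\<close> this factor is at least 1,
  so omitting it gives a lower bound.\<close>

lemma mean_power_restrict:
  assumes I: "finite (I :: 'i set)" "I \<noteq> {}" and K: "fat K" and PK: "fat P" "P \<subseteq> K"
  shows "(\<integral>\<^sup>+ x. polar_power r I x * indicator {x. \<forall>i\<in>I. x i \<in> P} x \<partial>PiM I (\<lambda>_. unif K)) \<le> mean_power r I P"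
proof -
  let ?M = "PiM I (\<lambda>_. unif K)"
  define k where "k = emeasure lborel K / emeasure lborel P"
  have fin: "emeasure lborel K \<noteq> 0" "emeasure lborel K \<noteq> \<infinity>" "emeasure lborel P \<noteq> 0" "emeasure lborel P \<noteq> \<infinity>"
    using K PK by (auto simp: fat_def)
  have [measurable]: "K \<in> sets borel" "P \<in> sets borel" using K PK by (auto simp: fat_def)
  have "emeasure lborel P \<le> emeasure lborel K" using PK by (intro emeasure_mono) auto
  then have "emeasure lborel P / emeasure lborel P \<le> k" unfolding k_def by (rule divide_right_mono_ennreal)
  then have k: "1 \<le> k" using fin by (simp add: less_top)
  define D where "D x = (\<Prod>i\<in>I. k * indicator P (x i))" for x :: "'i \<Rightarrow> real ^ 2"
  have D [measurable]: "D \<in> borel_measurable ?M" unfolding D_def by measurable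
  interpret product_prob_space "\<lambda>_ :: 'i. unif K"
    using prob_space_unif[OF K] by (intro product_prob_spaceI)
  interpret Pp: product_prob_space "\<lambda>_ :: 'i. unif P"
    using prob_space_unif[OF PK(1)] by (intro product_prob_spaceI)
  have "density ?M D = PiM I (\<lambda>_. unif P)"
  proof (rule Pp.PiM_eqI)
    fix A :: "'i \<Rightarrow> (real ^ 2) set" assume "\<And>i. i \<in> I \<Longrightarrow> A i \<in> sets (unif P)"
    then have A [measurable]: "i \<in> I \<Longrightarrow> A i \<in> sets borel" for i by simp
    have PA: "Pi\<^sub>E I A \<in> sets ?M" using A I by (intro sets_PiM_I_finite) auto
    have "emeasure (density ?M D) (Pi\<^sub>E I A) = (\<integral>\<^sup>+ x. D x * indicator (Pi\<^sub>E I A) x \<partial>?M)"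
      using PA D by (intro emeasure_density) auto
    also have "\<dots> = (\<integral>\<^sup>+ x. (\<Prod>i\<in>I. k * indicator (P \<inter> A i) (x i)) \<partial>?M)"
    proof (rule nn_integral_cong)
      fix x assume "x \<in> space ?M"
      then have "x \<in> Pi\<^sub>E I A \<longleftrightarrow> (\<forall>i\<in>I. x i \<in> A i)" by (auto simp: space_PiM PiE_iff)
      then show "D x * indicator (Pi\<^sub>E I A) x = (\<Prod>i\<in>I. k * indicator (P \<inter> A i) (x i))"
      proof (cases "\<forall>i\<in>I. x i \<in> A i")
        case True
        with \<open>x \<in> Pi\<^sub>E I A \<longleftrightarrow> _\<close> show ?thesis by (auto simp: D_def indicator_def intro!: prod.cong)
      next
        case False
        then obtain i where "i \<in> I" "x i \<notin> A i" by blast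
        then have "(\<Prod>i\<in>I. k * indicator (P \<inter> A i) (x i)) = 0" using I(1) by (intro prod_zero bexI[of _ i]) auto
        with False \<open>x \<in> Pi\<^sub>E I A \<longleftrightarrow> _\<close> show ?thesis by simp
      qed
    qed
    also have "\<dots> = (\<Prod>i\<in>I. \<integral>\<^sup>+ w. k * indicator (P \<inter> A i) w \<partial>unif K)"
      using I(1) A by (intro product_nn_integral_prod) auto
    also have "\<dots> = (\<Prod>i\<in>I. emeasure (unif P) (A i))"
    proof (rule prod.cong[OF refl])
      fix i assume i: "i \<in> I"
      have "(\<integral>\<^sup>+ w. k * indicator (P \<inter> A i) w \<partial>unif K) = k * emeasure (unif K) (P \<inter> A i)"
        using A[OF i] by (intro nn_integral_cmult_indicator) auto
      also have "K \<inter> (P \<inter> A i) = P \<inter> A i" using PK by auto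
      then have "k * emeasure (unif K) (P \<inter> A i) = emeasure lborel K / emeasure lborel P * (emeasure lborel (P \<inter> A i) / emeasure lborel K)"
        using A[OF i] by (simp add: k_def)
      also have "\<dots> = emeasure lborel (P \<inter> A i) / emeasure lborel P"
      proof -
        have "emeasure lborel K / emeasure lborel P * (emeasure lborel (P \<inter> A i) / emeasure lborel K)
            = emeasure lborel K / emeasure lborel P * emeasure lborel (P \<inter> A i) / emeasure lborel K"
          by (rule ennreal_times_divide)
        also have "emeasure lborel K / emeasure lborel P * emeasure lborel (P \<inter> A i)
            = emeasure lborel (P \<inter> A i) / emeasure lborel P * emeasure lborel K"
          by (subst ennreal_divide_times) (rule mult.commute)
        also have "\<dots> / emeasure lborel K = emeasure lborel (P \<inter> A i) / emeasure lborel P"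
          using fin by (intro mult_divide_eq_ennreal) auto
        finally show ?thesis .
      qed
      finally show "(\<integral>\<^sup>+ w. k * indicator (P \<inter> A i) w \<partial>unif K) = emeasure (unif P) (A i)"
        using A[OF i] by simp
    qed
    finally show "emeasure (density ?M D) (Pi\<^sub>E I A) = (\<Prod>i\<in>I. emeasure (unif P) (A i))" .
  qed (use I in \<open>auto intro!: sets_PiM_cong\<close>)
  then have "mean_power r I P = (\<integral>\<^sup>+ x. polar_power r I x \<partial>density ?M D)"
    by (simp add: mean_power_def)
  also have "\<dots> = (\<integral>\<^sup>+ x. D x * polar_power r I x \<partial>?M)"
    using D polar_power_measurable[OF I] by (intro nn_integral_density) (auto simp: measurable_PiM_unif)
  also have "\<dots> \<ge> (\<integral>\<^sup>+ x. polar_power r I x * indicator {x. \<forall>i\<in>I. x i \<in> P} x \<partial>?M)"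
  proof (rule nn_integral_mono)
    fix x
    have "1 \<le> D x" if "\<forall>i\<in>I. x i \<in> P"
    proof -
      have "1 \<le> (\<Prod>i\<in>I. k)" using k by (simp add: one_le_power)
      also have "\<dots> = D x" unfolding D_def using that by (intro prod.cong) auto
      finally show ?thesis .
    qed
    then show "polar_power r I x * indicator {x. \<forall>i\<in>I. x i \<in> P} x \<le> D x * polar_power r I x"
      using mult_right_mono[of 1 "D x" "polar_power r I x"] by (auto simp: indicator_def)
  qed
  finally show ?thesis .
qed

text \<open>Almost surely each of the finitely many sample points lies in some \<open>P n\<close>,
  hence all lie in one of them, as the sequence increases. Monotone convergence then reduces the
  claim to \<open>mean_power_restrict\<close>.\<close>

lemma mean_power_exhaust:
  assumes I: "finite (I :: 'i set)" "I \<noteq> {}" and K: "fat K"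
    and P: "\<And>n. fat (P n)" "\<And>n. P n \<subseteq> K" "incseq P" and null: "AE w in unif K. w \<in> (\<Union>n. P n)"
    and bound: "\<And>n. mean_power r I (P n) \<le> C"
  shows "mean_power r I K \<le> C"
proof -
  let ?M = "PiM I (\<lambda>_. unif K)"
  let ?f = "\<lambda>n x. polar_power r I x * indicator {x. \<forall>i\<in>I. x i \<in> P n} x"
  have "\<forall>i\<in>I. AE x in ?M. x i \<in> (\<Union>n. P n)"
    using null prob_space_unif[OF K] by (auto intro!: AE_PiM_component)
  then have AE: "AE x in ?M. \<forall>i\<in>I. x i \<in> (\<Union>n. P n)"
    using I(1) by (simp add: AE_finite_all)
  have "mean_power r I K \<le> (\<integral>\<^sup>+ x. (SUP n. ?f n x) \<partial>?M)"
    unfolding mean_power_def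
  proof (rule nn_integral_mono_AE)
    show "AE x in ?M. polar_power r I x \<le> (SUP n. ?f n x)"
      using AE
    proof eventually_elim
      case (elim x)
      then have "\<forall>i\<in>I. \<exists>n. x i \<in> P n" by auto
      then obtain m where m: "\<And>i. i \<in> I \<Longrightarrow> x i \<in> P (m i)" by metis
      have "x i \<in> P (Max (m ` I))" if "i \<in> I" for i
        using m[OF that] incseqD[OF P(3), of "m i" "Max (m ` I)"] that I(1) by auto
      then show ?case by (intro SUP_upper2[of "Max (m ` I)"]) auto
    qed
  qed
  also have "\<dots> = (SUP n. \<integral>\<^sup>+ x. ?f n x \<partial>?M)"
  proof (rule nn_integral_monotone_convergence_SUP)
    show "incseq ?f"
      using P(3) by (auto simp: incseq_def le_fun_def indicator_def)
    fix n
    have [measurable]: "P n \<in> sets borel" using P(1) by (simp add: fat_def)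
    have "(\<lambda>x. indicator {x. \<forall>i\<in>I. x i \<in> P n} x :: ennreal) = (\<lambda>x. if \<forall>i\<in>I. x i \<in> P n then 1 else 0)"
      by (auto simp: indicator_def)
    also have "\<dots> \<in> borel_measurable ?M" using I(1) by measurable
    finally show "?f n \<in> borel_measurable ?M"
      using polar_power_measurable[OF I] by (intro borel_measurable_times_ennreal) (auto simp: measurable_PiM_unif)
  qed
  also have "\<dots> \<le> C"
    using mean_power_restrict[OF I K P(1,2)] bound by (intro SUP_least) (meson order_trans)
  finally show ?thesis .
qed

section \<open>Movements of polygons\<close>

lemma linear_frame: "linear (frame 0 p q)"
  by (rule linearI) (simp_all add: frame_def algebra_simps)

lemma convex_hull_frame: "convex hull (frame c p q ` S) = frame c p q ` (convex hull S)"
proof -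
  have "frame c p q = (\<lambda>x. c + frame 0 p q x)" by (simp add: frame_def fun_eq_iff add.assoc)
  then have eq: "frame c p q ` X = (+) c ` (frame 0 p q ` X)" for X by (simp add: image_image)
  show ?thesis unfolding eq
    by (simp only: convex_hull_translation convex_hull_linear_image[OF linear_frame])
qed

lemma not_fat_line:
  assumes "v \<noteq> 0" "\<And>y. y \<in> S \<Longrightarrow> cross2 v (y - c) = 0"
  shows "\<not> fat (convex hull S)"
proof
  assume fat: "fat (convex hull S)"
  interpret prob_space "unif (convex hull S)" by (rule prob_space_unif[OF fat])
  define a where "a = vec2 (- v $ 2) (v $ 1)"
  have eq: "cross2 v (w - c) = 0 \<longleftrightarrow> a \<bullet> w = a \<bullet> c" for w
    by (auto simp: cross2_def a_def inner_vec2 algebra_simps)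
  have "convex hull S \<subseteq> {w. a \<bullet> w = a \<bullet> c}"
    using assms(2) eq by (intro hull_minimal convex_hyperplane) auto
  then have "AE w in unif (convex hull S). cross2 v (w - c) = 0"
    using fat by (intro AE_uniform_measureI) (auto simp: fat_def eq)
  moreover have "AE w in unif (convex hull S). cross2 v (w - c) \<noteq> 0"
    by (rule AE_unif_hyperplane[OF fat assms(1)])
  ultimately have "AE w in unif (convex hull S). False" by eventually_elim simp
  then show False by simp
qed

lemma fat_compact:
  assumes "compact K" "interior K \<noteq> {}" shows "fat K"
proof -
  have "K \<in> sets borel" using assms(1) by (simp add: borel_compact)
  moreover have "emeasure lborel K \<noteq> \<infinity>"
    using emeasure_bounded_finite[OF compact_imp_bounded[OF assms(1)]] by simp
  moreover have "emeasure lborel K \<noteq> 0"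
  proof
    assume "emeasure lborel K = 0"
    then have "emeasure lborel (interior K) = 0"
      using emeasure_mono[OF interior_subset, of K lborel] \<open>K \<in> sets borel\<close> by simp
    then have "interior K \<in> null_sets lborel" by (auto simp: null_sets_def)
    then have "negligible (interior K)"
      by (simp add: negligible_iff_null_sets null_sets_completion_iff)
    then show False using open_not_negligible[OF open_interior assms(2)] by simp
  qed
  ultimately show ?thesis by (simp add: fat_def)
qed

text \<open>The half plane \<open>{y. y $ 1 \<ge> 0}\<close> meets the polygon in the triangle with vertices \<open>0\<close>, \<open>(0, 1)\<close>
  and \<open>(1, t)\<close> exactly when every segment from \<open>(1, t)\<close> to another vertex \<open>y\<close> crosses the vertical axis
  inside \<open>[0, 1]\<close>.\<close>

definition admissible :: "(real ^ 2) set \<Rightarrow> real \<Rightarrow> bool" where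
  "admissible R t \<longleftrightarrow> (\<forall>y\<in>R. 0 \<le> y $ 2 - t * y $ 1 \<and> y $ 2 - t * y $ 1 \<le> 1 - y $ 1)"

text \<open>A segment from the moving vertex to a point of the fixed hull is broken at the vertical
  axis. Its left part stays in the fixed hull, and its right part is sheared onto a segment ending
  at the new position of the vertex.\<close>

lemma half_shear_polygon_subset:
  fixes R :: "(real ^ 2) set"
  defines "Q \<equiv> insert 0 (insert (vec2 0 1) R)"
  assumes R: "\<And>y. y \<in> R \<Longrightarrow> y $ 1 < 0" and s: "admissible R s"
  shows "half_shear (t - s) ` (convex hull (insert (vec2 1 s) Q)) \<subseteq> convex hull (insert (vec2 1 t) Q)"
proof safe
  fix y assume y: "y \<in> convex hull (insert (vec2 1 s) Q)"
  have "Q \<noteq> {}" by (simp add: Q_def)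
  from y[unfolded convex_hull_insert[OF this]] obtain u v c where uv: "u \<ge> 0" "v \<ge> 0" "u + v = 1" and c: "c \<in> convex hull Q"
    and y: "y = u *\<^sub>R vec2 1 s + v *\<^sub>R c"
    by blast
  have halfspace: "convex {z :: real ^ 2. z $ 1 \<le> 0 \<and> 0 \<le> z $ 2 - s * z $ 1 \<and> z $ 2 - s * z $ 1 \<le> 1 - z $ 1}"
  proof -
    have "{z :: real ^ 2. z $ 1 \<le> 0 \<and> 0 \<le> z $ 2 - s * z $ 1 \<and> z $ 2 - s * z $ 1 \<le> 1 - z $ 1}
      = {z. vec2 1 0 \<bullet> z \<le> 0} \<inter> {z. vec2 s (- 1) \<bullet> z \<le> 0} \<inter> {z. vec2 (1 - s) 1 \<bullet> z \<le> 1}"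
      by (auto simp: inner_vec2 algebra_simps)
    then show ?thesis by (auto intro!: convex_Int convex_halfspace_le)
  qed
  have "convex hull Q \<subseteq> {z :: real ^ 2. z $ 1 \<le> 0 \<and> 0 \<le> z $ 2 - s * z $ 1 \<and> z $ 2 - s * z $ 1 \<le> 1 - z $ 1}"
    using R s by (intro hull_minimal halfspace) (force simp: Q_def admissible_def)
  with c have c': "c $ 1 \<le> 0" "0 \<le> c $ 2 - s * c $ 1" "c $ 2 - s * c $ 1 \<le> 1 - c $ 1" by auto
  \<comment> \<open>The height at which the line from (1, s) to c crosses the vertical axis;
    admissibility places it on the side from 0 to (0, 1).\<close>
  define k where "k = (c $ 2 - s * c $ 1) / (1 - c $ 1)"
  have k: "0 \<le> k" "k \<le> 1" "k * (1 - c $ 1) = c $ 2 - s * c $ 1" using c' by (simp_all add: k_def divide_le_eq)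
  have sub: "convex hull Q \<subseteq> convex hull (insert (vec2 1 t) Q)" by (intro hull_mono) auto
  have d: "vec2 0 k \<in> convex hull Q"
  proof -
    have "(1 - k) *\<^sub>R 0 + k *\<^sub>R vec2 0 1 \<in> convex hull Q"
      using k by (intro convexD_alt convex_convex_hull hull_inc) (auto simp: Q_def)
    also have "(1 - k) *\<^sub>R 0 + k *\<^sub>R vec2 0 1 = vec2 0 k" by (rule vec2_eqI) simp_all
    finally show ?thesis .
  qed
  have u: "u = 1 - v" using uv by simp
  have y1: "y $ 1 = u + v * c $ 1" and y2: "y $ 2 = u * s + v * c $ 2" by (simp_all add: y)
  show "half_shear (t - s) y \<in> convex hull (insert (vec2 1 t) Q)"
  proof (cases "y $ 1 \<le> 0")
    case True
    then have hs: "half_shear (t - s) y = y" by (intro vec2_eqI) (simp_all add: half_shear_def)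
    have "y \<in> convex hull Q"
    proof (cases "c $ 1 = 0")
      case True
      then have "u = 0" using \<open>y $ 1 \<le> 0\<close> uv y1 by simp
      then show ?thesis using c uv by (simp add: y)
    next
      case False
      with c' have neg: "c $ 1 < 0" by simp
      define b where "b = y $ 1 / c $ 1"
      have "v * c $ 1 \<ge> c $ 1" using uv neg by (simp add: u mult_le_cancel_right1 algebra_simps)
      then have "y $ 1 \<ge> c $ 1" using uv y1 by linarith
      then have b: "0 \<le> b" "b \<le> 1" "b * c $ 1 = y $ 1"
        using neg True by (simp_all add: b_def divide_nonpos_neg)
      have "(1 - b) *\<^sub>R vec2 0 k + b *\<^sub>R c \<in> convex hull Q"
        using b by (intro convexD_alt convex_convex_hull d c) auto
      moreover have "(1 - b) *\<^sub>R vec2 0 k + b *\<^sub>R c = y"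
      proof (rule vec2_eqI)
        have "c $ 1 * ((1 - b) * k + b * c $ 2) = (c $ 1 - b * c $ 1) * k + (b * c $ 1) * c $ 2" by algebra
        also have "\<dots> = (c $ 1 - y $ 1) * k + y $ 1 * c $ 2" by (simp only: b)
        also have "\<dots> = - (u * (k * (1 - c $ 1))) + y $ 1 * c $ 2" by (simp add: y1 u algebra_simps)
        also have "\<dots> = c $ 1 * y $ 2" unfolding k(3) y1 y2 by (simp add: u algebra_simps)
        finally show "((1 - b) *\<^sub>R vec2 0 k + b *\<^sub>R c) $ 2 = y $ 2" using neg by simp
      qed (use b in simp)
      ultimately show ?thesis by simp
    qed
    then show ?thesis using sub hs by auto
  next
    case False
    have "v * c $ 1 \<le> 0" using uv c' by (simp add: mult_nonneg_nonpos)
    then have y1': "0 \<le> y $ 1" "y $ 1 \<le> 1" using False uv y1 by auto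
    have "(1 - y $ 1) *\<^sub>R vec2 0 k + (y $ 1) *\<^sub>R vec2 1 t \<in> convex hull (insert (vec2 1 t) Q)"
      using y1' d sub by (intro convexD_alt convex_convex_hull) (auto intro: hull_inc)
    also have "(1 - y $ 1) *\<^sub>R vec2 0 k + (y $ 1) *\<^sub>R vec2 1 t = half_shear (t - s) y"
    proof (rule vec2_eqI)
      have "(1 - y $ 1) * k = v * (k * (1 - c $ 1))" by (simp add: y1 u algebra_simps)
      then have "(1 - y $ 1) * k = v * (c $ 2 - s * c $ 1)" by (simp only: k)
      then have "(1 - y $ 1) * k + y $ 1 * t = y $ 2 + (t - s) * y $ 1" unfolding y2 by (simp add: y1 u algebra_simps)
      then show "((1 - y $ 1) *\<^sub>R vec2 0 k + y $ 1 *\<^sub>R vec2 1 t) $ 2 = half_shear (t - s) y $ 2"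
        using y1' by (simp add: half_shear_def)
    qed (simp add: half_shear_def)
    finally show ?thesis .
  qed
qed

lemma half_shear_polygon:
  fixes R :: "(real ^ 2) set"
  defines "Q \<equiv> insert 0 (insert (vec2 0 1) R)"
  assumes R: "\<And>y. y \<in> R \<Longrightarrow> y $ 1 < 0" and adm: "admissible R 0" "admissible R t"
  shows "half_shear t ` (convex hull (insert (vec2 1 0) Q)) = convex hull (insert (vec2 1 t) Q)"
proof
  show "half_shear t ` (convex hull (insert (vec2 1 0) Q)) \<subseteq> convex hull (insert (vec2 1 t) Q)"
    using half_shear_polygon_subset[OF R adm(1), of t] by (simp add: Q_def)
  have "half_shear (- t) ` (convex hull (insert (vec2 1 t) Q)) \<subseteq> convex hull (insert (vec2 1 0) Q)"
    using half_shear_polygon_subset[OF R adm(2), of 0] by (simp add: Q_def)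
  then have "half_shear t ` half_shear (- t) ` (convex hull (insert (vec2 1 t) Q)) \<subseteq> half_shear t ` (convex hull (insert (vec2 1 0) Q))"
    by (rule image_mono)
  then show "convex hull (insert (vec2 1 t) Q) \<subseteq> half_shear t ` (convex hull (insert (vec2 1 0) Q))"
    by (simp add: image_image half_shear_inverse)
qed

text \<open>Equality in an admissibility condition says that the segment from (1, t) to y passes
  through the corner (0, k), which thereby becomes a convex combination of other points.\<close>

lemma redundant_vertex:
  fixes R :: "(real ^ 2) set"
  defines "Q \<equiv> insert 0 (insert (vec2 0 1) R)"
  assumes R: "\<And>y. y \<in> R \<Longrightarrow> y $ 1 < 0" and y: "y \<in> R" "y $ 2 - t * y $ 1 = k * (1 - y $ 1)" and k: "k = 0 \<or> k = 1"
  shows "convex hull (insert (vec2 1 t) Q) = convex hull (insert (vec2 1 t) (Q - {vec2 0 k}))"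
proof -
  let ?S = "insert (vec2 1 t) (Q - {vec2 0 k})"
  have y1: "y $ 1 < 0" by (rule R[OF y(1)])
  define l where "l = 1 / (1 - y $ 1)"
  have l: "0 \<le> l" "l \<le> 1" "l * (1 - y $ 1) = 1" using y1 by (simp_all add: l_def)
  have "(1 - l) *\<^sub>R vec2 1 t + l *\<^sub>R y \<in> convex hull ?S"
  proof (intro convexD_alt convex_convex_hull l(1,2))
    have "y \<noteq> vec2 0 k" using y1 by auto
    then show "y \<in> convex hull ?S" using y(1) by (intro hull_inc) (auto simp: Q_def)
  qed (simp add: hull_inc)
  also have "(1 - l) *\<^sub>R vec2 1 t + l *\<^sub>R y = vec2 0 k"
  proof (rule vec2_eqI)
    have "(1 - l) * t + l * y $ 2 = l * (y $ 2 - t * y $ 1) + (1 - l * (1 - y $ 1)) * t" by algebra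
    also have "\<dots> = (l * (1 - y $ 1)) * k" using l(3) y(2) by simp
    finally show "((1 - l) *\<^sub>R vec2 1 t + l *\<^sub>R y) $ 2 = vec2 0 k $ 2" using l(3) by simp
  qed (use l(3) in \<open>simp add: algebra_simps\<close>)
  finally have "convex hull (insert (vec2 0 k) ?S) = convex hull ?S" by (rule hull_redundant)
  moreover have "vec2 0 0 = 0" by (rule vec2_eqI) simp_all
  then have "insert (vec2 0 k) ?S = insert (vec2 1 t) Q" using k by (auto simp: Q_def)
  ultimately show ?thesis by simp
qed

text \<open>Both sides scale with the same power of the determinant, so with a fixed B the bound is
  invariant under affine maps. B plays the role of the value for a triangle of unit area.\<close>

definition power_bound :: "real \<Rightarrow> 'i set \<Rightarrow> ennreal \<Rightarrow> (real ^ 2) set \<Rightarrow> bool" where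
  "power_bound r I B K \<longleftrightarrow> mean_power r I K \<le> ennreal (area K powr r) * B"

context
  fixes r :: real and I :: "'i set" and B :: ennreal
  assumes I: "finite I" "card I \<ge> 3" and r: "r \<ge> 1"
begin

lemma I_nonempty: "I \<noteq> {}" using I by auto

lemma power_bound_frame:
  assumes "cross2 p q \<noteq> 0" "fat K" "power_bound r I B K"
  shows "power_bound r I B (frame c p q ` K)"
proof -
  have "area (frame c p q ` K) = \<bar>cross2 p q\<bar> * area K"
    using assms by (simp add: measure_def emeasure_image_frame fat_def enn2real_mult)
  then have "ennreal (area (frame c p q ` K) powr r) * B = ennreal (\<bar>cross2 p q\<bar> powr r) * (ennreal (area K powr r) * B)"
    by (simp add: powr_mult ennreal_mult mult.assoc)
  then show ?thesis
    using assms(3) mean_power_frame(2)[OF assms(1) I(1) I_nonempty assms(2)]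
    unfolding power_bound_def by (simp add: mult_left_mono)
qed

text \<open>The moving vertex is (1, 0) and its neighbours are 0 and (0, 1). At each end of the
  range it is a neighbour that drops out, while the moved vertex stays, so the number of points
  decreases by one.\<close>

lemma power_bound_standard_position:
  fixes R :: "(real ^ 2) set"
  defines "Q \<equiv> insert 0 (insert (vec2 0 1) R)"
  assumes R: "finite R" "R \<noteq> {}" "\<And>y. y \<in> R \<Longrightarrow> y $ 1 < 0" "admissible R 0"
    and fat: "fat (convex hull (insert (vec2 1 0) Q))"
    and IH: "\<And>S. finite S \<Longrightarrow> card S < card (insert (vec2 1 0) Q) \<Longrightarrow> fat (convex hull S) \<Longrightarrow> power_bound r I B (convex hull S)"
  shows "power_bound r I B (convex hull (insert (vec2 1 0) Q))"
proof -
  let ?P = "\<lambda>t. convex hull (insert (vec2 1 t) Q)"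
  have fQ: "finite Q" using R by (simp add: Q_def)
  have "vec2 1 0 \<notin> Q" using R(3)[of "vec2 1 0"] by (auto simp: Q_def vec_eq_iff forall_2)
  then have card: "card (insert (vec2 1 0) Q) = Suc (card Q)" using fQ by simp
  have image: "half_shear t ` ?P 0 = ?P t" if "admissible R t" for t
    unfolding Q_def by (rule half_shear_polygon[OF R(3,4) that])
  have fat_t: "fat (?P t)" if "admissible R t" for t
    using area_scaling.fat_image[OF area_scaling_half_shear fat, of t] image[OF that] by simp
  have area_t: "area (?P t) = area (?P 0)" if "admissible R t" for t
    using area_scaling.scale[OF area_scaling_half_shear, of "?P 0" t] image[OF that] fat
    by (simp add: measure_def fat_def)
  have end_good: "power_bound r I B (?P t)" if t: "admissible R t" and y: "y \<in> R" "y $ 2 - t * y $ 1 = k * (1 - y $ 1)" "k = 0 \<or> k = 1" for t y k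
  proof -
    have eq: "?P t = convex hull (insert (vec2 1 t) (Q - {vec2 0 k}))"
      unfolding Q_def by (rule redundant_vertex[OF R(3) y])
    have "vec2 0 0 = 0" by (rule vec2_eqI) simp_all
    then have "vec2 0 k \<in> Q" using y(3) by (auto simp: Q_def)
    then have "card (Q - {vec2 0 k}) < card Q" using fQ by (intro psubset_card_mono) auto
    then have "card (insert (vec2 1 t) (Q - {vec2 0 k})) < card (insert (vec2 1 0) Q)"
      using fQ by (simp add: card card_insert_if)
    then show ?thesis using IH fat_t[OF t] fQ unfolding eq by simp
  qed
  \<comment> \<open>Solving the two admissibility inequalities for t; dividing by the negative
    \<open>y $ 1\<close> reverses them. The extremal y at lo makes 0 redundant, the one at hi makes
    (0, 1) redundant.\<close>
  define lo where "lo = Max ((\<lambda>y. y $ 2 / y $ 1) ` R)"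
  define hi where "hi = Min ((\<lambda>y. (1 - y $ 1 - y $ 2) / (- (y $ 1))) ` R)"
  have adm_iff: "admissible R t \<longleftrightarrow> lo \<le> t \<and> t \<le> hi" for t
  proof -
    have "lo \<le> t \<longleftrightarrow> (\<forall>y\<in>R. 0 \<le> y $ 2 - t * y $ 1)"
      using R by (simp add: lo_def neg_divide_le_eq)
    moreover have "t \<le> hi \<longleftrightarrow> (\<forall>y\<in>R. t \<le> (1 - y $ 1 - y $ 2) / (- (y $ 1)))"
      using R(1,2) by (simp add: hi_def del: divide_minus_right)
    moreover have "t \<le> (1 - y $ 1 - y $ 2) / (- (y $ 1)) \<longleftrightarrow> y $ 2 - t * y $ 1 \<le> 1 - y $ 1" if "y \<in> R" for y
      using R(3)[OF that] by (subst pos_le_divide_eq) (auto simp: algebra_simps)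
    ultimately show ?thesis by (auto simp: admissible_def)
  qed
  have lh: "lo \<le> 0" "0 \<le> hi" using R(4) adm_iff by auto
  have "lo \<in> (\<lambda>y. y $ 2 / y $ 1) ` R"
    unfolding lo_def by (rule Max_in) (use R(1,2) in auto)
  then obtain y where "y \<in> R" "lo = y $ 2 / y $ 1" by blast
  then have good_lo: "power_bound r I B (?P lo)"
    using R(3)[of y] lh by (intro end_good[of lo y 0]) (auto simp: adm_iff)
  have "hi \<in> (\<lambda>y. (1 - y $ 1 - y $ 2) / (- (y $ 1))) ` R"
    unfolding hi_def by (rule Min_in) (use R(1,2) in auto)
  then obtain z where z: "z \<in> R" "hi = (1 - z $ 1 - z $ 2) / (- (z $ 1))" by blast
  then have "hi * z $ 1 = - (1 - z $ 1 - z $ 2)" using R(3)[of z] by simp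
  then have good_hi: "power_bound r I B (?P hi)"
    using z lh by (intro end_good[of hi z 1]) (auto simp: adm_iff)
  show ?thesis
  proof (cases "lo = 0 \<or> hi = 0")
    case True
    \<comment> \<open>Time 0 is itself an end of the range, so no averaging takes place.\<close>
    then show ?thesis using good_lo good_hi by auto
  next
    case False
    with lh have lh': "lo < 0" "0 < hi" by auto
    define l where "l = - lo / (hi - lo)"
    have l: "0 < l" "l < 1" using lh' by (auto simp: l_def field_simps)
    have "l * (hi - lo) = - lo" using lh' by (simp add: l_def)
    then have l0: "(1 - l) * lo + l * hi = 0" by (simp add: algebra_simps)
    let ?C = "ennreal (area (?P 0) powr r) * B"
    have adm: "admissible R lo" "admissible R hi" using lh by (simp_all add: adm_iff)
    have "mean_power r I (?P 0) \<le> ennreal (1 - l) * mean_power r I (?P lo) + ennreal l * mean_power r I (?P hi)"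
      using mean_power_half_shear[OF I fat r l l0] unfolding image[OF adm(1)] image[OF adm(2)] .
    also have "\<dots> \<le> ennreal (1 - l) * ?C + ennreal l * ?C"
      using good_lo good_hi unfolding power_bound_def area_t[OF adm(1)] area_t[OF adm(2)]
      by (intro add_mono mult_left_mono) simp_all
    also have "\<dots> = ennreal ((1 - l) + l) * ?C"
      using l by (subst ennreal_plus) (simp_all add: distrib_right)
    finally show ?thesis by (simp add: power_bound_def)
  qed
qed

end

section \<open>The extremal property of triangles\<close>

lemma cross2_scaleR: "cross2 (k *\<^sub>R u) v = k * cross2 u v" "cross2 u (k *\<^sub>R v) = k * cross2 u v"
  by (simp_all add: cross2_def algebra_simps)

text \<open>Seen from the vertex \<open>p\<close>, the other vertices lie in a half plane, and its neighbours \<open>a\<close> and \<open>b\<close>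
  are those of extreme slope.\<close>

lemma vertex_with_neighbours:
  fixes S :: "(real ^ 2) set"
  assumes S: "finite S" "fat (convex hull S)" and extreme: "\<And>s. s \<in> S \<Longrightarrow> s \<notin> convex hull (S - {s})"
  obtains p a b where "{p, a, b} \<subseteq> S" "cross2 (p - a) (b - a) \<noteq> 0"
    "\<And>y. y \<in> S - {p, a, b} \<Longrightarrow> \<exists>z. y = frame a (p - a) (b - a) z \<and> z $ 1 < 0 \<and> 0 \<le> z $ 2 \<and> z $ 2 \<le> 1 - z $ 1"
proof -
  have "S \<noteq> {}" using S(2) by (auto simp: fat_def)
  then obtain p where p: "p \<in> S" by blast
  define S1 where "S1 = S - {p}"
  have "closed (convex hull S1)"
    using S(1) by (intro compact_imp_closed finite_imp_compact_convex_hull) (simp add: S1_def)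
  then obtain n d where nd: "n \<bullet> p < d" "\<And>y. y \<in> convex hull S1 \<Longrightarrow> n \<bullet> y > d"
    using separating_hyperplane_closed_point[OF convex_convex_hull, of S1 p] extreme[OF p] by (auto simp: S1_def)
  define L where "L y = n \<bullet> (y - p)" for y
  have L: "L y > 0" if "y \<in> S1" for y
    using nd(1) nd(2)[of y] that by (simp add: L_def inner_diff_right hull_inc)
  define sl where "sl y = cross2 n (y - p) / L y" for y
  \<comment> \<open>In the orthogonal basis of n and n turned by a right angle, y - p is a positive
    multiple of the direction \<open>w (sl y)\<close>.\<close>
  define w where "w s = n + s *\<^sub>R vec2 (- n $ 2) (n $ 1)" for s
  have decomp: "(n \<bullet> n) *\<^sub>R (y - p) = L y *\<^sub>R w (sl y)" if "y \<in> S1" for y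
  proof -
    have "L y *\<^sub>R w (sl y) = L y *\<^sub>R n + cross2 n (y - p) *\<^sub>R vec2 (- n $ 2) (n $ 1)"
      using L[OF that] by (simp add: w_def sl_def scaleR_add_right)
    also have "\<dots> = (n \<bullet> n) *\<^sub>R (y - p)"
      by (rule vec2_eqI) (simp_all add: L_def cross2_def inner_vec2 algebra_simps)
    finally show ?thesis ..
  qed
  have "S1 \<noteq> {}"
  proof
    assume "S1 = {}"
    then have "S = {p}" using p by (auto simp: S1_def)
    moreover have "vec2 1 0 \<noteq> 0" by (simp add: vec_eq_iff forall_2)
    ultimately have "\<not> fat (convex hull S)"
      by (intro not_fat_line[of "vec2 1 0" _ p]) (auto simp: cross2_def)
    with S(2) show False by simp
  qed
  then have n0: "n \<noteq> 0" using L by (auto simp: L_def)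
  then have nn: "n \<bullet> n > 0" by simp
  have fS1: "finite (sl ` S1)" "sl ` S1 \<noteq> {}" using S(1) \<open>S1 \<noteq> {}\<close> by (auto simp: S1_def)
  obtain a where a: "a \<in> S1" "sl a = Min (sl ` S1)" using Min_in[OF fS1] by (metis imageE)
  obtain b where b: "b \<in> S1" "sl b = Max (sl ` S1)" using Max_in[OF fS1] by (metis imageE)
  have le: "sl a \<le> sl y" "sl y \<le> sl b" if "y \<in> S1" for y
    using that fS1(1) by (auto simp: a b)
  \<comment> \<open>A single slope would put all of S on one line through p, against positive
    area.\<close>
  have "sl a \<noteq> sl b"
  proof
    assume eq: "sl a = sl b"
    have "w (sl a) \<noteq> 0"
    proof
      assume "w (sl a) = 0"
      moreover have "n \<bullet> w (sl a) = n \<bullet> n" by (simp add: w_def inner_vec2 algebra_simps)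
      ultimately show False using nn by simp
    qed
    moreover have "cross2 (w (sl a)) (y - p) = 0" if "y \<in> S" for y
    proof (cases "y = p")
      case False
      then have y: "y \<in> S1" using that by (simp add: S1_def)
      then have "sl y = sl a" using le[OF y] eq by simp
      have "(n \<bullet> n) * cross2 (w (sl a)) (y - p) = cross2 (w (sl a)) ((n \<bullet> n) *\<^sub>R (y - p))"
        by (simp add: cross2_scaleR)
      also have "\<dots> = L y * cross2 (w (sl a)) (w (sl a))"
        unfolding decomp[OF y] \<open>sl y = sl a\<close> by (simp add: cross2_scaleR)
      also have "\<dots> = 0" by (simp add: cross2_def)
      finally show ?thesis using nn by simp
    qed (simp add: cross2_def)
    ultimately show False using not_fat_line[of "w (sl a)" S p] S(2) by blast
  qed
  with le[OF a(1)] have ab: "sl a < sl b" by simp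
  have cross: "cross2 (p - a) (b - a) \<noteq> 0"
  proof
    assume *: "cross2 (p - a) (b - a) = 0"
    have "cross2 (p - a) (b - a) = - cross2 (a - p) (b - p)" by (simp add: cross2_def algebra_simps)
    then have "cross2 ((n \<bullet> n) *\<^sub>R (a - p)) ((n \<bullet> n) *\<^sub>R (b - p)) = 0"
      using * by (simp add: cross2_scaleR)
    moreover have "cross2 (L a *\<^sub>R w (sl a)) (L b *\<^sub>R w (sl b)) = L a * L b * ((sl b - sl a) * (n \<bullet> n))"
      unfolding cross2_scaleR by (simp add: cross2_def w_def inner_vec2 algebra_simps)
    ultimately show False using decomp[OF a(1)] decomp[OF b(1)] L[OF a(1)] L[OF b(1)] ab nn by simp
  qed
  have "\<exists>z. y = frame a (p - a) (b - a) z \<and> z $ 1 < 0 \<and> 0 \<le> z $ 2 \<and> z $ 2 \<le> 1 - z $ 1"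
    if y: "y \<in> S - {p, a, b}" for y
  proof -
    have y1: "y \<in> S1" using y by (simp add: S1_def)
    define h where "h = (sl y - sl a) / (sl b - sl a)"
    have h: "0 \<le> h" "h \<le> 1" "h * (sl b - sl a) = sl y - sl a"
      using le[OF y1] ab by (simp_all add: h_def)
    \<comment> \<open>Coordinates of y - p with respect to a - p and b - p: w is affine in the
      slope, so the direction to y interpolates those to a and b with weight h, and the factors L
      adjust the lengths.\<close>
    define \<mu> where "\<mu> = L y * (1 - h) / L a"
    define \<nu> where "\<nu> = L y * h / L b"
    have \<mu>\<nu>: "\<mu> \<ge> 0" "\<nu> \<ge> 0" "\<mu> * L a = L y * (1 - h)" "\<nu> * L b = L y * h"
      using h L[OF y1] L[OF a(1)] L[OF b(1)] by (simp_all add: \<mu>_def \<nu>_def)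
    have "(n \<bullet> n) *\<^sub>R (y - p) = (n \<bullet> n) *\<^sub>R (\<mu> *\<^sub>R (a - p) + \<nu> *\<^sub>R (b - p))"
    proof -
      have "w (sl y) = (1 - h) *\<^sub>R w (sl a) + h *\<^sub>R w (sl b)"
      proof -
        have "sl y = (1 - h) * sl a + h * sl b" using h(3) by (simp add: algebra_simps)
        then show ?thesis by (simp only:) (simp add: w_def algebra_simps)
      qed
      then have "L y *\<^sub>R w (sl y) = (L y * (1 - h)) *\<^sub>R w (sl a) + (L y * h) *\<^sub>R w (sl b)"
        by (simp add: scaleR_add_right)
      also have "\<dots> = \<mu> *\<^sub>R (L a *\<^sub>R w (sl a)) + \<nu> *\<^sub>R (L b *\<^sub>R w (sl b))" by (simp add: \<mu>\<nu>)
      also have "\<dots> = \<mu> *\<^sub>R ((n \<bullet> n) *\<^sub>R (a - p)) + \<nu> *\<^sub>R ((n \<bullet> n) *\<^sub>R (b - p))"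
        by (simp only: decomp[OF a(1)] decomp[OF b(1)])
      also have "\<dots> = (n \<bullet> n) *\<^sub>R (\<mu> *\<^sub>R (a - p) + \<nu> *\<^sub>R (b - p))"
        by (simp add: scaleR_add_right mult.commute)
      finally show ?thesis using decomp[OF y1] by simp
    qed
    then have yp: "y - p = \<mu> *\<^sub>R (a - p) + \<nu> *\<^sub>R (b - p)" using nn by simp
    then have y_eq: "y = (1 - \<mu> - \<nu>) *\<^sub>R p + \<mu> *\<^sub>R a + \<nu> *\<^sub>R b"
      by (simp add: algebra_simps)
    \<comment> \<open>Otherwise y would lie in the triangle p, a, b, against extremality.
      Geometrically, y lies beyond the line through a and b as seen from p, which is the negative
      first coordinate.\<close>
    have "\<mu> + \<nu> > 1"
    proof (rule ccontr)
      assume "\<not> \<mu> + \<nu> > 1"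
      then have "y \<in> convex hull {p, a, b}"
        unfolding convex_hull_3 using \<mu>\<nu> y_eq
        by (intro CollectI exI[of _ "1 - \<mu> - \<nu>"] exI[of _ \<mu>] exI[of _ \<nu>]) auto
      also have "\<dots> \<subseteq> convex hull (S - {y})"
        using p a b y by (intro hull_mono) (auto simp: S1_def)
      finally show False using extreme[of y] y by simp
    qed
    moreover have "y = frame a (p - a) (b - a) (vec2 (1 - \<mu> - \<nu>) \<nu>)"
      by (subst y_eq) (simp add: frame_def algebra_simps)
    ultimately show ?thesis using \<mu>\<nu> by (intro exI[of _ "vec2 (1 - \<mu> - \<nu>) \<nu>"]) auto
  qed
  moreover have "{p, a, b} \<subseteq> S" using p a b by (auto simp: S1_def)
  ultimately show ?thesis using that cross by blast
qed

lemma frame_standard_triangle: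
  "frame a (c - a) (b - a) ` (convex hull {0, vec2 0 1, vec2 1 0}) = convex hull {a, b, c}"
  unfolding convex_hull_frame[symmetric] by (simp add: frame_def)

lemma fat_triangle_cross:
  assumes "fat (convex hull {a, b, c})" shows "cross2 (c - a) (b - a) \<noteq> 0"
proof
  assume *: "cross2 (c - a) (b - a) = 0"
  define v where "v = (if c \<noteq> a then c - a else if b \<noteq> a then b - a else vec2 1 0)"
  have "v \<noteq> 0" by (auto simp: v_def vec_eq_iff forall_2)
  moreover have "cross2 v (y - a) = 0" if "y \<in> {a, b, c}" for y
    using that * by (auto simp: v_def cross2_def algebra_simps)
  ultimately show False using not_fat_line[of v "{a, b, c}" a] assms by blast
qed

context
  fixes r :: real and I :: "'i set" and B :: ennreal
  assumes I: "finite I" "card I \<ge> 3" and r: "r \<ge> 1"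
    and std: "power_bound r I B (convex hull {0, vec2 0 1, vec2 1 0})"
begin

lemma power_bound_frame_iff:
  assumes pq: "cross2 p q \<noteq> 0" and fat: "fat (frame c p q ` K)"
  obtains "fat K" "power_bound r I B K \<Longrightarrow> power_bound r I B (frame c p q ` K)"
proof -
  obtain c' p' q' where inv: "\<And>x. frame c' p' q' (frame c p q x) = x" "cross2 p' q' \<noteq> 0"
    using frame_inverse[OF pq] by metis
  have "fat (frame c' p' q' ` (frame c p q ` K))"
    using I by (intro mean_power_frame(1)[OF inv(2) I(1) _ fat]) auto
  then have "fat K" by (simp add: image_image inv)
  then show ?thesis using that power_bound_frame[OF I r pq] by blast
qed

text \<open>The induction counts generating points rather than vertices, so a redundant point is
  discarded as a case of its own and the set obtained at the end of a movement need not be in convex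
  position.\<close>

lemma power_bound_polygon:
  "finite S \<Longrightarrow> fat (convex hull S) \<Longrightarrow> power_bound r I B (convex hull S)"
proof (induction "card S" arbitrary: S rule: less_induct)
  case less
  note S = less.prems
  consider s where "s \<in> S" "s \<in> convex hull (S - {s})" | "card S \<le> 3"
    | "card S \<ge> 4" "\<And>s. s \<in> S \<Longrightarrow> s \<notin> convex hull (S - {s})" by fastforce
  then show ?case
  proof cases
    case 1
    then have "convex hull S = convex hull (S - {s})"
      using hull_redundant[of s convex "S - {s}"] by (simp add: insert_absorb)
    moreover have "card (S - {s}) < card S" using 1(1) S(1) by (intro psubset_card_mono) auto
    ultimately show ?thesis using less.hyps[of "S - {s}"] S by simp
  next
    case 2
    have "S \<noteq> {}" using S(2) by (auto simp: fat_def)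
    then have "card S = 1 \<or> card S = 2 \<or> card S = 3" using 2 S(1) card_0_eq[OF S(1)] by linarith
    \<comment> \<open>Repetitions are allowed, which covers sets of fewer than three points;
      positive area then excludes them.\<close>
    then obtain a b c where abc: "S = {a, b, c}"
      using S(1) by (auto simp: card_1_singleton_iff card_2_iff card_3_iff)
    have "cross2 (c - a) (b - a) \<noteq> 0" using S(2) unfolding abc by (rule fat_triangle_cross)
    moreover have "fat (frame a (c - a) (b - a) ` (convex hull {0, vec2 0 1, vec2 1 0}))"
      using S(2) unfolding frame_standard_triangle abc .
    ultimately have "power_bound r I B (frame a (c - a) (b - a) ` (convex hull {0, vec2 0 1, vec2 1 0}))"
      using power_bound_frame_iff std by metis
    then show ?thesis unfolding frame_standard_triangle abc .
  next
    case 3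
    obtain p a b where pab: "{p, a, b} \<subseteq> S" "cross2 (p - a) (b - a) \<noteq> 0" and
      z: "\<And>y. y \<in> S - {p, a, b} \<Longrightarrow> \<exists>z. y = frame a (p - a) (b - a) z \<and> z $ 1 < 0 \<and> 0 \<le> z $ 2 \<and> z $ 2 \<le> 1 - z $ 1"
      using vertex_with_neighbours[OF S 3(2)] by metis
    let ?f = "frame a (p - a) (b - a)"
    obtain Z where Z: "\<And>y. y \<in> S - {p, a, b} \<Longrightarrow> y = ?f (Z y) \<and> Z y $ 1 < 0 \<and> 0 \<le> Z y $ 2 \<and> Z y $ 2 \<le> 1 - Z y $ 1"
      using z by metis
    define R where "R = Z ` (S - {p, a, b})"
    let ?S = "insert (vec2 1 0) (insert 0 (insert (vec2 0 1) R))"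
    have fR: "finite R" using S(1) by (simp add: R_def)
    have "R \<noteq> {}"
    proof
      assume "R = {}"
      then have "S \<subseteq> {p, a, b}" by (auto simp: R_def)
      then have "card S \<le> card {p, a, b}" by (intro card_mono) auto
      also have "\<dots> \<le> 3" by (simp add: card_insert_if)
      finally show False using 3 by simp
    qed
    have neg: "y $ 1 < 0" if "y \<in> R" for y using Z that by (auto simp: R_def)
    have adm: "admissible R 0" using Z by (auto simp: admissible_def R_def)
    have "?f ` R = S - {p, a, b}"
      unfolding R_def image_image using Z by force
    moreover have "?f 0 = a" "?f (vec2 0 1) = b" "?f (vec2 1 0) = p" by (simp_all add: frame_def)
    ultimately have fS: "?f ` ?S = S" using pab(1) by auto
    then have img: "convex hull S = ?f ` (convex hull ?S)" by (simp only: convex_hull_frame[symmetric])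
    obtain c' p' q' where inv: "\<And>x. frame c' p' q' (?f x) = x" using frame_inverse[OF pab(2)] by metis
    then have "inj ?f" by (metis injI)
    then have cardS: "card ?S = card S" using card_image[of ?f ?S] fS by (metis inj_on_subset subset_UNIV)
    obtain fatS: "fat (convex hull ?S)" and goodS: "power_bound r I B (convex hull ?S) \<Longrightarrow> power_bound r I B (?f ` (convex hull ?S))"
      using power_bound_frame_iff[OF pab(2), of a "convex hull ?S"] S(2) unfolding img by metis
    have "power_bound r I B (convex hull ?S)"
      using less.hyps unfolding cardS[symmetric]
      by (intro power_bound_standard_position[OF I r fR \<open>R \<noteq> {}\<close> neg adm fatS]) auto
    then show ?thesis unfolding img by (rule goodS)
  qed
qed

text \<open>Inscribed polygons exhaust K up to its boundary, a null set. Their areas are at most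
  that of K, so their bounds are uniform.\<close>

lemma power_bound_convex_body:
  assumes K: "convex_body K" shows "power_bound r I B K"
proof -
  have K': "compact K" "convex K" "interior K \<noteq> {}" using K by (auto simp: convex_body_def)
  have fatK: "fat K" by (rule fat_compact[OF K'(1,3)])
  obtain D :: "(real ^ 2) set" where D: "countable D" "\<And>X. open X \<Longrightarrow> X \<noteq> {} \<Longrightarrow> \<exists>d\<in>D. d \<in> X"
    using countable_dense_exists by blast
  define E where "E = D \<inter> interior K"
  have E: "countable E" "E \<noteq> {}" using D K'(3) by (auto simp: E_def)
  obtain z e where e: "e > 0" "cball z e \<subseteq> K" using K'(3) mem_interior_cball by (metis ex_in_conv)
  \<comment> \<open>A small triangle inside K, included in every polygon so that each has interior
    points from the start.\<close>
  define A where "A = {z, z + vec2 e 0, z + vec2 0 e}"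
  define P where "P n = convex hull (A \<union> from_nat_into E ` {..n})" for n :: nat
  have A: "A \<subseteq> K" using e by (auto simp: A_def dist_norm norm_vec2 intro!: subsetD[OF e(2)])
  have "cross2 (vec2 e 0) (vec2 0 e) \<noteq> 0" using e by (simp add: cross2_def)
  then have intP: "interior (P n) \<noteq> {}" for n
    unfolding P_def by (intro interior_convex_hull_triangle[of "z + vec2 e 0" z "z + vec2 0 e"]) (auto simp: A_def)
  have fin: "finite (A \<union> from_nat_into E ` {..n})" for n by (simp add: A_def)
  have fatP: "fat (P n)" for n
    using fat_compact[OF _ intP] finite_imp_compact_convex_hull[OF fin] unfolding P_def by blast
  have PK: "P n \<subseteq> K" for n
    unfolding P_def using A from_nat_into[OF E(2)] interior_subset[of K]
    by (intro hull_minimal K'(2)) (auto simp: E_def)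
  have incP: "incseq P" by (auto simp: incseq_def P_def intro!: hull_mono)
  define C where "C = (\<Union>n. P n)"
  have "convex C"
    unfolding convex_alt
  proof safe
    fix x y and u :: real assume "x \<in> C" "y \<in> C" "0 \<le> u" "u \<le> 1"
    then obtain m n where "x \<in> P m" "y \<in> P n" by (auto simp: C_def)
    then have "x \<in> P (max m n)" "y \<in> P (max m n)"
      using incseqD[OF incP, of m "max m n"] incseqD[OF incP, of n "max m n"] by auto
    then have "(1 - u) *\<^sub>R x + u *\<^sub>R y \<in> P (max m n)"
      unfolding P_def using \<open>0 \<le> u\<close> \<open>u \<le> 1\<close> by (intro convexD_alt convex_convex_hull)
    then show "(1 - u) *\<^sub>R x + u *\<^sub>R y \<in> C" by (auto simp: C_def)
  qed
  have "E \<subseteq> C"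
  proof
    fix x assume "x \<in> E"
    then obtain n where "x = from_nat_into E n" using from_nat_into_surj[OF E(1)] by metis
    then have "x \<in> P n" by (auto simp: P_def intro!: hull_inc)
    then show "x \<in> C" by (auto simp: C_def)
  qed
  moreover have "interior K \<subseteq> closure E"
  proof
    fix x assume x: "x \<in> interior K"
    show "x \<in> closure E"
      unfolding closure_iff_nhds_not_empty
    proof (intro allI impI)
      fix X V assume V: "V \<subseteq> X" "open V" "x \<in> V"
      then obtain d where "d \<in> D" "d \<in> V \<inter> interior K" using D(2)[of "V \<inter> interior K"] x by blast
      then show "E \<inter> X \<noteq> {}" using V by (auto simp: E_def)
    qed
  qed
  \<comment> \<open>Density alone gives only the closure of C; as C is convex, it has the same
    interior as its closure, and so contains the interior of K.\<close>
  ultimately have "interior K \<subseteq> closure C" using closure_mono by blast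
  then have "interior K \<subseteq> interior (closure C)" by (rule interior_maximal) simp
  then have intC: "interior K \<subseteq> C"
    using convex_interior_closure[OF \<open>convex C\<close>] interior_subset by blast
  have "negligible (frontier K)" by (rule negligible_convex_frontier[OF K'(2)])
  then have "frontier K \<in> null_sets lborel"
    by (simp add: negligible_iff_null_sets null_sets_completion_iff borel_closed)
  then have "AE w in lborel. w \<notin> frontier K" by (rule AE_not_in)
  then have "AE w in lborel. w \<in> K \<longrightarrow> w \<in> C"
    by eventually_elim (use intC closure_subset[of K] in \<open>auto simp: frontier_def\<close>)
  then have AE: "AE w in unif K. w \<in> (\<Union>n. P n)"
    using fatK by (intro AE_uniform_measureI) (auto simp: fat_def C_def)
  have "mean_power r I (P n) \<le> ennreal (area K powr r) * B" for n
  proof -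
    have "power_bound r I B (P n)" unfolding P_def by (rule power_bound_polygon[OF fin]) (use fatP in \<open>simp add: P_def\<close>)
    moreover have "area (P n) \<le> area K"
      using fatK fatP[of n] PK[of n]
      by (intro measure_mono_fmeasurable) (auto simp: fmeasurable_def fat_def less_top)
    then have "ennreal (area (P n) powr r) * B \<le> ennreal (area K powr r) * B"
      using r by (intro mult_right_mono ennreal_leI powr_mono2) auto
    ultimately show ?thesis unfolding power_bound_def by (rule order_trans)
  qed
  then show ?thesis
    unfolding power_bound_def using I by (intro mean_power_exhaust[OF I(1) _ fatK fatP PK incP AE]) auto
qed

end

lemma cross2_eq_0_imp_scaleR:
  assumes "cross2 u v = 0" "v \<noteq> 0" shows "\<exists>k. u = k *\<^sub>R v"
proof (cases "v $ 1 = 0")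
  case True
  then have "v $ 2 \<noteq> 0" using assms(2) by (auto intro: vec2_eqI)
  then have "u = (u $ 2 / v $ 2) *\<^sub>R v" using assms(1) True by (intro vec2_eqI) (auto simp: cross2_def)
  then show ?thesis ..
next
  case False
  then have "u = (u $ 1 / v $ 1) *\<^sub>R v" using assms(1) by (intro vec2_eqI) (auto simp: cross2_def field_simps)
  then show ?thesis ..
qed

lemma triangle_vertices:
  assumes "is_triangle T"
  obtains a b c where "T = convex hull {a, b, c}" "cross2 (c - a) (b - a) \<noteq> 0"
proof -
  obtain a b c where abc: "\<not> collinear {a, b, c}" "T = convex hull {a, b, c}"
    using assms by (auto simp: is_triangle_def)
  then have "b \<noteq> a" by auto
  moreover have "c \<noteq> a + k *\<^sub>R (b - a)" for k
  proof
    assume "c = a + k *\<^sub>R (b - a)"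
    then have "collinear {a, b, c}"
      by (intro collinear_alt[THEN iffD2] exI[of _ a] exI[of _ "b - a"]) (auto intro: exI[of _ 0] exI[of _ 1])
    with abc(1) show False by simp
  qed
  then have "c - a \<noteq> k *\<^sub>R (b - a)" for k by (metis add_diff_cancel_left' diff_add_cancel add.commute)
  ultimately have "cross2 (c - a) (b - a) \<noteq> 0"
    using cross2_eq_0_imp_scaleR[of "c - a" "b - a"] by auto
  then show ?thesis using that abc(2) by blast
qed

lemma fat_triangle:
  assumes "is_triangle T" shows "fat T"
proof -
  obtain a b c where abc: "T = convex hull {a, b, c}" "cross2 (c - a) (b - a) \<noteq> 0"
    using triangle_vertices[OF assms] by metis
  have "cross2 (c - a) (b - a) = - cross2 (b - a) (c - a)" by (simp add: cross2_def)
  then have "interior T \<noteq> {}"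
    unfolding abc(1) using abc(2) by (intro interior_convex_hull_triangle[of b a c]) auto
  moreover have "compact T" unfolding abc(1) by (intro finite_imp_compact_convex_hull) simp
  ultimately show ?thesis by (intro fat_compact)
qed

lemma mean_power_triangle_max:
  fixes I :: "'i set"
  assumes I: "finite I" "card I \<ge> 3" and r: "r \<ge> 1" and K: "convex_body K" and T: "is_triangle T"
    and area: "area T = area K"
  shows "mean_power r I K \<le> mean_power r I T"
proof -
  obtain a b c where abc: "T = convex hull {a, b, c}" and cr: "cross2 (c - a) (b - a) \<noteq> 0"
    using triangle_vertices[OF T] by metis
  have fatT: "fat T" by (rule fat_triangle[OF T])
  let ?Std = "convex hull {0, vec2 0 1, vec2 1 0}"
  have imgT: "frame a (c - a) (b - a) ` ?Std = T" using frame_standard_triangle abc by simp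
  define k where "k = area T powr r"
  have k: "k > 0" using fatT by (simp add: k_def measure_def fat_def enn2real_eq_0_iff)
  \<comment> \<open>The constant for which T satisfies the power bound with equality, also if its
    mean is infinite. Affine invariance then provides the base case of the standard
    triangle.\<close>
  define B where "B = ennreal (1 / k) * mean_power r I T"
  have kB: "ennreal k * B = mean_power r I T"
    using k by (simp add: B_def mult.assoc[symmetric] ennreal_mult[symmetric])
  obtain c' p' q' where inv: "\<And>x. frame c' p' q' (frame a (c - a) (b - a) x) = x" "cross2 p' q' \<noteq> 0"
    using frame_inverse[OF cr] by metis
  have "power_bound r I B (frame c' p' q' ` T)"
    by (rule power_bound_frame[OF I r inv(2) fatT]) (simp add: power_bound_def k_def[symmetric] kB)
  also have "frame c' p' q' ` T = ?Std" unfolding imgT[symmetric] by (simp add: image_image inv)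
  finally have "power_bound r I B K" by (rule power_bound_convex_body[OF I r _ K])
  then show ?thesis by (simp add: power_bound_def area[symmetric] k_def[symmetric] kB)
qed

text \<open>Independence makes the law of the sample vector a product measure. The integrands agree
  off the null event of a degenerate hull, where the Santalo point is meaningless.\<close>

lemma expectation_eq_mean_power:
  assumes iid: "iid_uniform M X N K" and N: "N \<ge> 3" and K: "fat K"
  shows "(\<integral>\<^sup>+ \<omega>. ennreal (area (santalo_polar (random_polytope X N \<omega>)) powr - r) \<partial>M)
    = mean_power r {1..N} K"
proof -
  interpret prob_space M using iid by (simp add: iid_uniform_def)
  have I: "finite {1..N}" "card {1..N} \<ge> 3" "{1..N} \<noteq> {}" using N by auto
  have indep: "indep_vars (\<lambda>_. borel) X {1..N}" using iid by (simp add: iid_uniform_def)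
  then have X [measurable]: "X i \<in> borel_measurable M" if "i \<in> {1..N}" for i
    using that by (simp add: indep_vars_def)
  define F where "F \<omega> = (\<lambda>i\<in>{1..N}. X i \<omega>)" for \<omega>
  have F: "F \<in> measurable M (PiM {1..N} (\<lambda>_. borel))"
    unfolding F_def by (rule measurable_restrict) (rule X)
  have "distr M borel (X i) = unif K" if "i \<in> {1..N}" for i
    using iid that by (auto simp: iid_uniform_def cong: distr_cong)
  then have "PiM {1..N} (\<lambda>i. distr M borel (X i)) = PiM {1..N} (\<lambda>_. unif K)" by (intro PiM_cong) auto
  moreover have "distr M (PiM {1..N} (\<lambda>_. borel)) F = PiM {1..N} (\<lambda>i. distr M borel (X i))"
    using indep_vars_iff_distr_eq_PiM'[OF I(3), where M' = "\<lambda>_. borel" and X = X] X indep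
    unfolding F_def by blast
  ultimately have law: "distr M (PiM {1..N} (\<lambda>_. borel)) F = PiM {1..N} (\<lambda>_. unif K)" by simp
  have img: "F \<omega> ` {1..N} = (\<lambda>i. X i \<omega>) ` {1..N}" for \<omega> by (auto simp: F_def)
  have "AE x in distr M (PiM {1..N} (\<lambda>_. borel)) F. interior (convex hull (x ` {1..N})) \<noteq> {}"
    unfolding law by (rule AE_full_dimensional[OF I(1,2) K])
  then have "AE \<omega> in M. interior (convex hull (F \<omega> ` {1..N})) \<noteq> {}" by (rule AE_distrD[OF F])
  then have "AE \<omega> in M. ennreal (area (santalo_polar (random_polytope X N \<omega>)) powr - r) = polar_power r {1..N} (F \<omega>)"
  proof eventually_elim
    case (elim \<omega>)
    show ?case
      unfolding random_polytope_def img[symmetric] by (rule santalo_polar_power[OF I(1,3) elim])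
  qed
  then have "(\<integral>\<^sup>+ \<omega>. ennreal (area (santalo_polar (random_polytope X N \<omega>)) powr - r) \<partial>M)
    = (\<integral>\<^sup>+ \<omega>. polar_power r {1..N} (F \<omega>) \<partial>M)" by (rule nn_integral_cong_AE)
  also have "\<dots> = (\<integral>\<^sup>+ x. polar_power r {1..N} x \<partial>distr M (PiM {1..N} (\<lambda>_. borel)) F)"
    using F polar_power_measurable[OF I(1,3)] by (intro nn_integral_distr[symmetric]) simp_all
  finally show ?thesis unfolding law mean_power_def .
qed

theorem theorem1p3:
  fixes K T :: "(real ^ 2) set" and r :: real and N :: nat
    and M :: "'a measure" and X :: "nat \<Rightarrow> 'a \<Rightarrow> real ^ 2"
    and M' :: "'b measure" and Y :: "nat \<Rightarrow> 'b \<Rightarrow> real ^ 2"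
  assumes "convex_body K"
    and "r \<ge> 1"
    and "N \<ge> 3"
    and "is_triangle T"
    and "centroid T = 0"
    and "area T = area K"
    and "iid_uniform M X N K"
    and "iid_uniform M' Y N T"
  shows "(\<integral>\<^sup>+ \<omega>. ennreal (area (santalo_polar (random_polytope X N \<omega>)) powr (- r)) \<partial>M)
       \<le> (\<integral>\<^sup>+ \<omega>. ennreal (area (santalo_polar (random_polytope Y N \<omega>)) powr (- r)) \<partial>M')"
proof -
  have fatK: "fat K" using assms(1) by (intro fat_compact) (auto simp: convex_body_def)
  have fatT: "fat T" by (rule fat_triangle[OF assms(4)])
  show ?thesis
    unfolding expectation_eq_mean_power[OF assms(7,3) fatK] expectation_eq_mean_power[OF assms(8,3) fatT]
    by (rule mean_power_triangle_max) (use assms in auto)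
qed

end
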